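(* For every $f\in C_r^*(\mathbb F_2)$ there exist an enumeration $(g_\ell)_{\ell\ge1}$ of $\mathbb F_2$ (each group element listed exactly once) and strictly increasing positive integers $M_j$ ($j\ge1$) such that $$\lim_{j\to\infty}\Bigl\|\sum_{\ell=1}^{M_j}\widehat f(g_\ell)\lambda_{g_\ell}-f\Bigr\|_\infty=0 .$$ The enumeration and the $M_j$ can be chosen so that the sets $E_j=\{g_1,\dots,g_{M_j}\}$ satisfy, for some integers $n_j$ with $n_{j+1}>2n_j$, $$\{g:|g|\le n_j\}\subset E_j\subset\{g:|g|\le 2n_j\},\qquad E_j\subsetneq E_{j+1},\qquad \bigcup_j E_j=\mathbb F_2,$$ and $$\Bigl\|\sum_{g\in E_j}\widehat f(g)\lambda_g-f\Bigr\|_\infty\le 2^{1-j}\qquad(j\ge1).$$ The same subsequence of partial sums then converges to $f$ in $\|\cdot\|_q$ for every $1\le q<\infty$.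
   Context: $\mathbb F_2$ is the free group on two generators, $|g|$ is reduced word length, and $\lambda_g\delta_h=\delta_{gh}$ is the left regular representation on $\ell^2(\mathbb F_2)$. $C_r^*(\mathbb F_2)$ is the operator-norm closure of $\operatorname{span}\{\lambda_g:g\in\mathbb F_2\}$, and $\|\cdot\|_\infty$ is the operator norm. $L(\mathbb F_2)$ is the group von Neumann algebra with canonical trace $\tau$, $\tau(1)=1$, $\tau(\lambda_g)=\mathbf 1_{\{g=e\}}$; $\|x\|_q=\tau(|x|^q)^{1/q}$ for $1\le q<\infty$. Fourier coefficients are $\widehat f(g)=\tau(\lambda_g^*f)$. *)

theory Defs
  imports "HOL-Analysis.Analysis" "HOL-Computational_Algebra.Polynomial"
begin

section \<open>Free groups, as groups of reduced words\<close>

text \<open>A letter \<open>(x, True)\<close> is the generator \<open>x\<close>, and \<open>(x, False)\<close> is its inverse.\<close>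

type_synonym 'a letter = "'a \<times> bool"

definition inv_letter :: "'a letter \<Rightarrow> 'a letter" where
  "inv_letter a = (fst a, \<not> snd a)"

lemma inv_letter_inv_letter [simp]: "inv_letter (inv_letter a) = a"
  by (simp add: inv_letter_def)

definition reduced :: "'a letter list \<Rightarrow> bool" where
  "reduced w \<longleftrightarrow> successively (\<lambda>a b. b \<noteq> inv_letter a) w"

fun red_cons :: "'a letter \<Rightarrow> 'a letter list \<Rightarrow> 'a letter list" where
  "red_cons a [] = [a]"
| "red_cons a (b # w) = (if b = inv_letter a then w else a # b # w)"

text \<open>For reduced \<open>v\<close>, this is the reduced form of the concatenation \<open>u @ v\<close>.\<close>

definition red_append :: "'a letter list \<Rightarrow> 'a letter list \<Rightarrow> 'a letter list" where
  "red_append u v = foldr red_cons u v"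

lemma reduced_Nil [simp]: "reduced []"
  by (simp add: reduced_def)

lemma reduced_tl: "reduced (a # w) \<Longrightarrow> reduced w"
  by (cases w) (auto simp: reduced_def)

lemma reduced_red_cons: "reduced w \<Longrightarrow> reduced (red_cons a w)"
  by (cases w) (auto simp: reduced_def intro: reduced_tl[unfolded reduced_def])

lemma reduced_red_append: "reduced v \<Longrightarrow> reduced (red_append u v)"
  by (induction u) (auto simp: red_append_def reduced_red_cons)

lemma red_cons_cancel:
  assumes "reduced w" shows "red_cons a (red_cons (inv_letter a) w) = w"
proof (cases w)
  case (Cons b v)
  then show ?thesis using assms
    by (cases v) (auto simp: reduced_def)
qed simp

lemma red_append_red_cons:
  assumes "reduced w" "reduced v"
  shows "red_append (red_cons a v) w = red_cons a (red_append v w)"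
proof (cases v)
  case (Cons b v')
  show ?thesis
  proof (cases "b = inv_letter a")
    case True
    have "red_cons a (red_cons (inv_letter a) (red_append v' w)) = red_append v' w"
      using assms by (intro red_cons_cancel reduced_red_append)
    then show ?thesis using True Cons by (simp add: red_append_def)
  qed (simp add: Cons red_append_def)
qed (simp add: red_append_def)

lemma red_append_assoc:
  assumes "reduced v" "reduced w"
  shows "red_append (red_append u v) w = red_append u (red_append v w)"
proof (induction u)
  case (Cons a u)
  have "red_append (red_append (a # u) v) w = red_append (red_cons a (red_append u v)) w"
    by (simp add: red_append_def)
  also have "\<dots> = red_cons a (red_append (red_append u v) w)"
    by (intro red_append_red_cons reduced_red_append assms)
  also have "\<dots> = red_append (a # u) (red_append v w)"
    using Cons by (simp add: red_append_def)
  finally show ?case .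
qed (simp add: red_append_def)

lemma red_append_Nil: "reduced u \<Longrightarrow> red_append u [] = u"
proof (induction u)
  case (Cons a u)
  then have "red_append (a # u) [] = red_cons a u"
    using reduced_tl by (fastforce simp: red_append_def)
  then show ?case using Cons.prems by (cases u) (auto simp: reduced_def)
qed (simp add: red_append_def)

definition inv_word :: "'a letter list \<Rightarrow> 'a letter list" where
  "inv_word w = rev (map inv_letter w)"

lemma reduced_inv_word:
  assumes "reduced w" shows "reduced (inv_word w)"
proof -
  have "successively (\<lambda>a b. inv_letter a \<noteq> inv_letter (inv_letter b)) w"
    using assms unfolding reduced_def
    by (rule successively_mono) (metis inv_letter_inv_letter)
  then show ?thesis
    by (simp add: reduced_def inv_word_def successively_rev successively_map)
qed

lemma red_append_inv_word:
  assumes "reduced v" shows "red_append (inv_word w) (red_append w v) = v"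
  using assms
proof (induction w arbitrary: v)
  case (Cons a w)
  have "red_append (inv_word (a # w)) (red_append (a # w) v)
      = red_append (inv_word w) (red_cons (inv_letter a) (red_cons a (red_append w v)))"
    by (simp add: red_append_def inv_word_def)
  also have "\<dots> = v"
    using Cons red_cons_cancel[of "red_append w v" "inv_letter a"]
    by (simp add: reduced_red_append)
  finally show ?case .
qed (simp add: red_append_def inv_word_def)

typedef 'a free_group = "{w :: 'a letter list. reduced w}"
  morphisms word_of free_group_of
  by (rule exI[of _ "[]"]) simp

setup_lifting type_definition_free_group

instantiation free_group :: (type) "{monoid_mult, inverse}"
begin

lift_definition one_free_group :: "'a free_group" is "[]" by simp

lift_definition times_free_group :: "'a free_group \<Rightarrow> 'a free_group \<Rightarrow> 'a free_group"
  is red_append by (rule reduced_red_append)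

lift_definition inverse_free_group :: "'a free_group \<Rightarrow> 'a free_group"
  is inv_word by (rule reduced_inv_word)

definition divide_free_group :: "'a free_group \<Rightarrow> 'a free_group \<Rightarrow> 'a free_group" where
  "divide_free_group g h = g * inverse h"

instance
proof
  fix g h k :: "'a free_group"
  show "g * h * k = g * (h * k)" by transfer (rule red_append_assoc)
  show "1 * g = g" by transfer (simp add: red_append_def)
  show "g * 1 = g" by transfer (rule red_append_Nil)
qed

end

lemma free_group_left_inverse: "inverse g * g = (1 :: 'a free_group)"
proof transfer
  fix g :: "'a letter list" assume "reduced g"
  then show "red_append (inv_word g) g = []"
    using red_append_inv_word[of "[]" g] by (simp add: red_append_Nil)
qed

lemma free_group_right_inverse: "g * inverse g = (1 :: 'a free_group)"
  by (metis free_group_left_inverse mult.assoc mult_1_left)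

definition word_length :: "'a free_group \<Rightarrow> nat" where
  "word_length g = length (word_of g)"

type_synonym F2 = "bool free_group"


section \<open>The Hilbert space of square-summable complex functions\<close>

typedef 'g ell2 = "{x :: 'g \<Rightarrow> complex. (\<lambda>g. (cmod (x g))\<^sup>2) summable_on UNIV}"
  morphisms coord ell2_of
  by (rule exI[of _ "\<lambda>_. 0"]) simp

setup_lifting type_definition_ell2

lemma ell2_mult_summable:
  fixes x y :: "'g \<Rightarrow> complex"
  assumes "(\<lambda>g. (cmod (x g))\<^sup>2) summable_on UNIV" "(\<lambda>g. (cmod (y g))\<^sup>2) summable_on UNIV"
  shows "(\<lambda>g. cnj (x g) * y g) summable_on UNIV"
proof -
  have "(\<lambda>g. (cmod (x g))\<^sup>2 + (cmod (y g))\<^sup>2) summable_on UNIV"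
    using assms by (rule summable_on_add)
  then have "(\<lambda>g. norm (cnj (x g) * y g)) summable_on UNIV"
  proof (rule summable_on_comparison_test)
    fix g
    have "2 * (cmod (x g) * cmod (y g)) \<le> (cmod (x g))\<^sup>2 + (cmod (y g))\<^sup>2"
      using sum_squares_bound[of "cmod (x g)" "cmod (y g)"] by (simp add: mult.assoc)
    moreover have "0 \<le> cmod (x g) * cmod (y g)" by simp
    ultimately have "cmod (x g) * cmod (y g) \<le> (cmod (x g))\<^sup>2 + (cmod (y g))\<^sup>2"
      by linarith
    then show "norm (cnj (x g) * y g) \<le> (cmod (x g))\<^sup>2 + (cmod (y g))\<^sup>2"
      by (simp add: norm_mult)
  qed simp
  then show ?thesis by (rule abs_summable_summable)
qed

lemma ell2_add_summable:
  fixes x y :: "'g \<Rightarrow> complex"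
  assumes "(\<lambda>g. (cmod (x g))\<^sup>2) summable_on UNIV" "(\<lambda>g. (cmod (y g))\<^sup>2) summable_on UNIV"
  shows "(\<lambda>g. (cmod (x g + y g))\<^sup>2) summable_on UNIV"
proof (rule summable_on_comparison_test)
  show "(\<lambda>g. 2 * (cmod (x g))\<^sup>2 + 2 * (cmod (y g))\<^sup>2) summable_on UNIV"
    using assms by (intro summable_on_add summable_on_cmult_right)
  show "(cmod (x g + y g))\<^sup>2 \<le> 2 * (cmod (x g))\<^sup>2 + 2 * (cmod (y g))\<^sup>2" for g
  proof -
    have "(cmod (x g + y g))\<^sup>2 \<le> (cmod (x g) + cmod (y g))\<^sup>2"
      by (intro power_mono norm_triangle_ineq) simp
    also have "\<dots> \<le> 2 * (cmod (x g))\<^sup>2 + 2 * (cmod (y g))\<^sup>2"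
      using sum_squares_bound[of "cmod (x g)" "cmod (y g)"] by (simp add: power2_sum)
    finally show ?thesis .
  qed
qed auto

lift_definition scaleC :: "complex \<Rightarrow> 'g ell2 \<Rightarrow> 'g ell2" is "\<lambda>c x g. c * x g"
  by (simp add: norm_mult power_mult_distrib summable_on_cmult_right)

lift_definition cinner :: "'g ell2 \<Rightarrow> 'g ell2 \<Rightarrow> complex"
  is "\<lambda>x y. \<Sum>\<^sub>\<infinity>g. cnj (x g) * y g" .

instantiation ell2 :: (type) real_vector
begin

lift_definition zero_ell2 :: "'g ell2" is "\<lambda>_. 0" by simp

lift_definition plus_ell2 :: "'g ell2 \<Rightarrow> 'g ell2 \<Rightarrow> 'g ell2" is "\<lambda>x y g. x g + y g"
  by (rule ell2_add_summable)

lift_definition uminus_ell2 :: "'g ell2 \<Rightarrow> 'g ell2" is "\<lambda>x g. - x g" by simp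

lift_definition minus_ell2 :: "'g ell2 \<Rightarrow> 'g ell2 \<Rightarrow> 'g ell2" is "\<lambda>x y g. x g - y g"
proof -
  fix x y :: "'g \<Rightarrow> complex"
  assume "(\<lambda>g. (cmod (x g))\<^sup>2) summable_on UNIV" "(\<lambda>g. (cmod (y g))\<^sup>2) summable_on UNIV"
  then show "(\<lambda>g. (cmod (x g - y g))\<^sup>2) summable_on UNIV"
    using ell2_add_summable[of x "\<lambda>g. - y g"] by simp
qed

lift_definition scaleR_ell2 :: "real \<Rightarrow> 'g ell2 \<Rightarrow> 'g ell2" is "\<lambda>r x g. complex_of_real r * x g"
  by (simp add: norm_mult power_mult_distrib summable_on_cmult_right)

instance
  by standard (transfer; simp add: fun_eq_iff algebra_simps)+

end

lemma cinner_add_left: "cinner (x + y) z = cinner x z + cinner y z"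
  by transfer (simp add: distrib_right infsum_add ell2_mult_summable)

lemma cinner_scaleC_left: "cinner (scaleC c x) y = cnj c * cinner x y"
  by transfer (simp add: mult.assoc infsum_cmult_right')

lemma cinner_commute: "cinner x y = cnj (cinner y x)"
  by transfer (simp flip: infsum_cnj add: mult.commute)

lemma cinner_self: "cinner x x = of_real (\<Sum>\<^sub>\<infinity>g. (cmod (coord x g))\<^sup>2)"
proof -
  have "(\<lambda>g. (cmod (coord x g))\<^sup>2) summable_on UNIV" using coord[of x] by simp
  then have "((\<lambda>g. complex_of_real ((cmod (coord x g))\<^sup>2)) has_sum
      of_real (\<Sum>\<^sub>\<infinity>g. (cmod (coord x g))\<^sup>2)) UNIV"
    by (intro has_sum_of_real_iff[THEN iffD2] has_sum_infsum)
  then show ?thesis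
    by (simp add: infsumI cinner.rep_eq complex_norm_square mult.commute flip: of_real_power)
qed

lemma scaleR_eq_scaleC: "r *\<^sub>R x = scaleC (of_real r) x" for x :: "'g ell2"
  by transfer simp

text \<open>The real inner product that induces the \<open>\<ell>\<^sup>2\<close> norm is the real part of \<^const>\<open>cinner\<close>.\<close>

instantiation ell2 :: (type) real_inner
begin

definition inner_ell2 :: "'g ell2 \<Rightarrow> 'g ell2 \<Rightarrow> real" where
  "inner_ell2 x y = Re (cinner x y)"

definition norm_ell2 :: "'g ell2 \<Rightarrow> real" where
  "norm_ell2 x = sqrt (\<Sum>\<^sub>\<infinity>g. (cmod (coord x g))\<^sup>2)"

definition sgn_ell2 :: "'g ell2 \<Rightarrow> 'g ell2" where
  "sgn_ell2 x = x /\<^sub>R norm x"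

definition dist_ell2 :: "'g ell2 \<Rightarrow> 'g ell2 \<Rightarrow> real" where
  "dist_ell2 x y = norm (x - y)"

definition uniformity_ell2 :: "('g ell2 \<times> 'g ell2) filter" where
  "uniformity_ell2 = (INF e\<in>{0<..}. principal {(x, y). dist x y < e})"

definition open_ell2 :: "'g ell2 set \<Rightarrow> bool" where
  "open_ell2 U \<longleftrightarrow> (\<forall>x\<in>U. eventually (\<lambda>(x', y). x' = x \<longrightarrow> y \<in> U) uniformity)"

instance
proof
  fix x y z :: "'g ell2" and r :: real
  show "inner x y = inner y x"
    unfolding inner_ell2_def by (subst cinner_commute) simp
  show "inner (x + y) z = inner x z + inner y z"
    by (simp add: inner_ell2_def cinner_add_left)
  show "inner (r *\<^sub>R x) y = r * inner x y"
    by (simp add: inner_ell2_def scaleR_eq_scaleC cinner_scaleC_left)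
  show "0 \<le> inner x x"
    by (simp add: inner_ell2_def cinner_self infsum_nonneg)
  show "inner x x = 0 \<longleftrightarrow> x = 0"
  proof
    assume "inner x x = 0"
    then have "(\<Sum>\<^sub>\<infinity>g. (cmod (coord x g))\<^sup>2) = 0"
      by (simp add: inner_ell2_def cinner_self)
    then have "(cmod (coord x g))\<^sup>2 = 0" for g
      using nonneg_infsum_le_0D[of "\<lambda>g. (cmod (coord x g))\<^sup>2" UNIV g] coord[of x] by simp
    then show "x = 0" by (simp add: coord_inject[symmetric] zero_ell2.rep_eq fun_eq_iff)
  qed (simp add: inner_ell2_def cinner_self zero_ell2.rep_eq)
  show "norm x = sqrt (inner x x)"
    by (simp add: inner_ell2_def cinner_self norm_ell2_def)
qed (fact sgn_ell2_def dist_ell2_def uniformity_ell2_def open_ell2_def)+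

end

lemma norm_scaleC: "norm (scaleC c x) = cmod c * norm x"
proof -
  have "(\<Sum>\<^sub>\<infinity>g. (cmod (c * coord x g))\<^sup>2) = (cmod c)\<^sup>2 * (\<Sum>\<^sub>\<infinity>g. (cmod (coord x g))\<^sup>2)"
    by (simp add: norm_mult power_mult_distrib infsum_cmult_right')
  then show ?thesis by (simp add: norm_ell2_def scaleC.rep_eq real_sqrt_mult)
qed

lift_definition ket :: "'g \<Rightarrow> 'g ell2" is "\<lambda>g h. if h = g then 1 else 0"
proof -
  fix g :: 'g
  have "(\<lambda>h. (cmod (if h = g then 1 else 0))\<^sup>2) summable_on {g}" by simp
  then show "(\<lambda>h. (cmod (if h = g then 1 else 0))\<^sup>2) summable_on UNIV"
    by (rule summable_on_cong_neutral[THEN iffD1, rotated -1]) auto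
qed


section \<open>Operators\<close>

text \<open>
  Operators have the library type of bounded real-linear maps, whose norm is the operator norm.
  All operators occurring below are in fact complex-linear.
\<close>

type_synonym 'g op = "'g ell2 \<Rightarrow>\<^sub>L 'g ell2"

lemma bounded_linear_scaleC: "bounded_linear (scaleC c :: 'g ell2 \<Rightarrow> 'g ell2)"
proof (rule bounded_linear_intro[where K = "cmod c"])
  fix x y :: "'g ell2" and r :: real
  show "scaleC c (x + y) = scaleC c x + scaleC c y"
    by transfer (simp add: algebra_simps)
  show "scaleC c (r *\<^sub>R x) = r *\<^sub>R scaleC c x"
    by transfer (simp add: algebra_simps)
qed (simp add: norm_scaleC mult.commute)

definition scaleC_op :: "complex \<Rightarrow> 'g op \<Rightarrow> 'g op" where
  "scaleC_op c T = Blinfun (\<lambda>x. scaleC c (T x))"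

lemma scaleC_op_apply: "scaleC_op c T x = scaleC c (T x)"
  unfolding scaleC_op_def
  by (simp add: bounded_linear_Blinfun_apply
      bounded_linear_compose[OF bounded_linear_scaleC blinfun.bounded_linear_right])

definition adj :: "'g op \<Rightarrow> 'g op" where
  "adj T = (THE S :: 'g op. \<forall>x y. cinner (S x) y = cinner x (T y))"

definition poly_op :: "real poly \<Rightarrow> 'g op \<Rightarrow> 'g op" where
  "poly_op p T = (\<Sum>i\<le>degree p. coeff p i *\<^sub>R (((o\<^sub>L) T ^^ i) id_blinfun))"

text \<open>
  Continuous functional calculus of a positive operator \<open>T\<close>: as the spectrum of \<open>T\<close> lies in
  \<open>[0, \<parallel>T\<parallel>]\<close>, \<open>h(T)\<close> is the norm limit of \<open>p\<^sub>n(T)\<close> for any real polynomials \<open>p\<^sub>n\<close> that converge to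
  \<open>h\<close> uniformly on this interval.
\<close>

definition cfc :: "'g op \<Rightarrow> (real \<Rightarrow> real) \<Rightarrow> 'g op" where
  "cfc T h = (THE S. \<forall>p. uniform_limit {0..norm T} (\<lambda>n. poly (p n)) h sequentially
     \<longrightarrow> (\<lambda>n. poly_op (p n) T) \<longlonglongrightarrow> S)"

definition op_abs :: "'g op \<Rightarrow> 'g op" where
  "op_abs T = cfc (adj T o\<^sub>L T) sqrt"


section \<open>The reduced group C*-algebra\<close>

lemma inverse_mult_cancel: "inverse g * (g * h) = (h :: 'a free_group)"
  by (simp flip: mult.assoc add: free_group_left_inverse)

lemma mult_inverse_cancel: "g * (inverse g * h) = (h :: 'a free_group)"
  by (simp flip: mult.assoc add: free_group_right_inverse)

lemma bij_left_mult: "bij ((*) (g :: 'a free_group))"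
  by (rule bij_betw_byWitness[where f' = "(*) (inverse g)"])
    (auto simp: inverse_mult_cancel mult_inverse_cancel)

definition left_translate :: "F2 \<Rightarrow> F2 ell2 \<Rightarrow> F2 ell2" where
  "left_translate g x = ell2_of (\<lambda>h. coord x (inverse g * h))"

lemma coord_left_translate: "coord (left_translate g x) h = coord x (inverse g * h)"
proof -
  have "(\<lambda>h. (cmod (coord x (inverse g * h)))\<^sup>2) summable_on UNIV"
    using coord[of x] summable_on_reindex_bij_betw[OF bij_left_mult,
        of "\<lambda>h. (cmod (coord x h))\<^sup>2" "inverse g"] by simp
  then show ?thesis by (simp add: left_translate_def ell2_of_inverse)
qed

lemma norm_left_translate: "norm (left_translate g x) = norm x"
  using infsum_reindex_bij_betw[OF bij_left_mult, of "\<lambda>h. (cmod (coord x h))\<^sup>2" "inverse g"]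
  by (simp add: norm_ell2_def coord_left_translate)

lift_definition lam :: "F2 \<Rightarrow> F2 op" is left_translate
proof (rule bounded_linear_intro[where K = 1])
  fix g :: F2 and x y :: "F2 ell2" and r :: real
  show "left_translate g (x + y) = left_translate g x + left_translate g y"
    by (simp add: coord_inject[symmetric] fun_eq_iff coord_left_translate plus_ell2.rep_eq)
  show "left_translate g (r *\<^sub>R x) = r *\<^sub>R left_translate g x"
    by (simp add: coord_inject[symmetric] fun_eq_iff coord_left_translate scaleR_ell2.rep_eq)
qed (simp add: norm_left_translate)

lemma lam_ket: "lam g (ket h) = ket (g * h)"
proof -
  have "inverse g * k = h \<longleftrightarrow> k = g * h" for k
    by (metis inverse_mult_cancel mult_inverse_cancel)
  then show ?thesis
    by (simp add: lam.rep_eq coord_inject[symmetric] fun_eq_iff coord_left_translate ket.rep_eq)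
qed

definition reduced_cstar :: "F2 op set" where
  "reduced_cstar = closure {\<Sum>g\<in>S. scaleC_op (c g) (lam g) | S c. finite S}"

text \<open>
  The canonical trace \<open>\<tau>(x) = \<langle>\<delta>\<^sub>e, x \<delta>\<^sub>e\<rangle>\<close> of the group von Neumann algebra.  Its formula makes
  sense for every operator, and so do those for the Fourier coefficients and the \<open>q\<close>-norms.
\<close>

definition trace :: "F2 op \<Rightarrow> complex" where
  "trace T = cinner (ket 1) (T (ket 1))"

definition fourier :: "F2 op \<Rightarrow> F2 \<Rightarrow> complex" where
  "fourier f g = trace (adj (lam g) o\<^sub>L f)"

definition Lq_norm :: "real \<Rightarrow> F2 op \<Rightarrow> real" where
  "Lq_norm q T = Re (trace (cfc (op_abs T) (\<lambda>t. t powr q))) powr (1 / q)"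

end

theory Submission
  imports Defs "HOL-Computational_Algebra.Fundamental_Theorem_Algebra"
begin

text \<open>
  The idea is Revesz's rearrangement argument for Fourier series, carried over to the free group.
  For \<open>n = 2\<^sup>p\<close> there is a radial multiplier of norm at most 8 that is 1 on the ball of radius \<open>n\<close>,
  vanishes off the ball of radius \<open>2n\<close> and has dyadic values in \<open>[0, 1]\<close>; applied to \<open>f\<close> it is close to
  \<open>f\<close> once \<open>n\<close> is large.  Its values are rounded to 0 or 1, one binary digit at a time, each time
  with a good choice of signs.  Averaging over all signs bounds a trace moment of order about \<open>p\<close>
  by the scalar Khintchine moment, and Haagerup's inequality, which loses only a factor polynomial
  in \<open>n\<close>, makes a moment of order \<open>p \<approx> log n\<close> as good as the operator norm.  Hence the rounding error
  is at most a constant times \<open>sqrt (p \<beta>\<^sub>p)\<close>, where \<open>\<beta>\<^sub>p\<close> is the sum of \<open>|fourier f g|\<^sup>2\<close> over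
  \<open>2\<^sup>p < |g| \<le> 2\<^sup>p\<^sup>+\<^sup>1\<close>.  As \<open>\<beta>\<close> is summable and the harmonic series diverges, \<open>p \<beta>\<^sub>p\<close> is
  arbitrarily small for arbitrarily large \<open>p\<close>.  Convergence in \<open>q\<close>-norm follows because the operator
  norm dominates the \<open>q\<close>-norm.
\<close>

section \<open>The Hilbert space\<close>

text \<open>Restricting f to a ball is not bounded uniformly in the radius: on the powers of one
  generator it is the symmetric partial sum of a Fourier series, with norm of order log n. Hence the
  smooth cut-off, and hence the need to turn its weights into 0 and 1 afterwards. The weights are
  dyadic so that each binary digit halves the cost: the errors of all digits form a geometric series
  although the number of digits grows with p, provided that one bound holds for the signs on every
  subset of the annulus. The factor sqrt p of the Khintchine moment cannot be absorbed at every
  scale, and this is why only a sparse subsequence of partial sums is controlled. The enumeration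
  comes last: the sets are found first, and any order inside their successive differences will
  do.\<close>

lemmas coord_simps = zero_ell2.rep_eq plus_ell2.rep_eq minus_ell2.rep_eq uminus_ell2.rep_eq
  scaleR_ell2.rep_eq scaleC.rep_eq ket.rep_eq

lemma ell2_eqI: "(\<And>g. coord x g = coord y g) \<Longrightarrow> x = y"
  by (simp add: coord_inject[symmetric] fun_eq_iff)

lemma coord_sum: "coord (\<Sum>i\<in>A. f i) g = (\<Sum>i\<in>A. coord (f i) g)"
  by (induction A rule: infinite_finite_induct) (auto simp: coord_simps)

lemma scaleC_add: "scaleC c (x + y) = scaleC c x + scaleC c y"
  and scaleC_diff: "scaleC c (x - y) = scaleC c x - scaleC c y"
  and scaleC_zero [simp]: "scaleC c 0 = 0"
  by (rule ell2_eqI; simp add: coord_simps algebra_simps)+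

lemma summable_coord: "(\<lambda>g. (cmod (coord x g))\<^sup>2) summable_on UNIV"
  using coord[of x] by simp

lemma norm_ell2_sq: "(norm x)\<^sup>2 = (\<Sum>\<^sub>\<infinity>g. (cmod (coord x g))\<^sup>2)"
  by (simp add: norm_ell2_def infsum_nonneg)

lemma sum_coord_le_norm:
  assumes "finite F" shows "(\<Sum>g\<in>F. (cmod (coord x g))\<^sup>2) \<le> (norm x)\<^sup>2"
  unfolding norm_ell2_sq using assms
  by (intro finite_sum_le_infsum summable_coord) auto

lemma norm_coord_le: "cmod (coord x g) \<le> norm x"
  using sum_coord_le_norm[of "{g}" x] by (simp add: power2_le_iff_abs_le)

text \<open>Norm bounds are reduced to finite sets of coordinates, because finite sums pass to
  coordinatewise limits.\<close>

lemma norm_ell2_le: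
  assumes "\<And>F. finite F \<Longrightarrow> (\<Sum>g\<in>F. (cmod (coord x g))\<^sup>2) \<le> K\<^sup>2" "K \<ge> 0"
  shows "norm x \<le> K"
proof -
  have "(norm x)\<^sup>2 \<le> K\<^sup>2"
    unfolding norm_ell2_sq
    by (rule infsum_le_finite_sums[OF summable_coord]) (use assms in auto)
  then show ?thesis using assms(2) by (simp add: power2_le_iff_abs_le)
qed

lemma summable_onI_finite_bound:
  assumes "\<And>F. finite F \<Longrightarrow> (\<Sum>g\<in>F. (cmod (x g))\<^sup>2) \<le> K"
  shows "(\<lambda>g. (cmod (x g))\<^sup>2) summable_on UNIV"
  by (rule nonneg_bdd_above_summable_on) (use assms in \<open>auto simp: bdd_above_def\<close>)

lemma coord_ell2_of:
  assumes "(\<lambda>g. (cmod (x g))\<^sup>2) summable_on UNIV"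
  shows "coord (ell2_of x) = x"
  using assms by (simp add: ell2_of_inverse)

text \<open>Completeness of the vectors makes the operators complete; the functional calculus and
  the adjoints of limits are obtained from Cauchy sequences of operators.\<close>

instance ell2 :: (type) banach
proof
  fix X :: "nat \<Rightarrow> 'a ell2"
  assume C: "Cauchy X"
  have "Cauchy (\<lambda>n. coord (X n) g)" for g
  proof (rule CauchyI)
    fix e :: real assume "e > 0"
    then obtain M where M: "\<And>m n. m \<ge> M \<Longrightarrow> n \<ge> M \<Longrightarrow> norm (X m - X n) < e"
      using CauchyD[OF C] by blast
    have "cmod (coord (X m) g - coord (X n) g) \<le> norm (X m - X n)" for m n
      using norm_coord_le[of "X m - X n" g] by (simp add: coord_simps)
    then show "\<exists>M. \<forall>m\<ge>M. \<forall>n\<ge>M. norm (coord (X m) g - coord (X n) g) < e"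
      using M by (meson le_less_trans)
  qed
  then obtain l where l: "\<And>g. (\<lambda>n. coord (X n) g) \<longlonglongrightarrow> l g"
    unfolding Cauchy_convergent_iff convergent_def by metis
  obtain K where K: "K > 0" "\<And>n. norm (X n) \<le> K"
    using Cauchy_Bseq[OF C] unfolding Bseq_def by blast
  have "(\<Sum>g\<in>F. (cmod (l g))\<^sup>2) \<le> K\<^sup>2" if "finite F" for F
  proof (rule LIMSEQ_le_const2)
    show "(\<lambda>n. \<Sum>g\<in>F. (cmod (coord (X n) g))\<^sup>2) \<longlonglongrightarrow> (\<Sum>g\<in>F. (cmod (l g))\<^sup>2)"
      by (intro tendsto_intros l)
    have "(\<Sum>g\<in>F. (cmod (coord (X n) g))\<^sup>2) \<le> K\<^sup>2" for n
      using sum_coord_le_norm[OF that] power_mono[OF K(2)] by (meson norm_ge_zero order_trans)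
    then show "\<exists>N. \<forall>n\<ge>N. (\<Sum>g\<in>F. (cmod (coord (X n) g))\<^sup>2) \<le> K\<^sup>2" by blast
  qed
  then have cl: "coord (ell2_of l) = l"
    by (intro coord_ell2_of summable_onI_finite_bound)
  have "X \<longlonglongrightarrow> ell2_of l"
  proof (rule LIMSEQ_I)
    fix e :: real assume "e > 0"
    then obtain M where M: "\<And>m n. m \<ge> M \<Longrightarrow> n \<ge> M \<Longrightarrow> norm (X m - X n) < e / 2"
      using CauchyD[OF C, of "e / 2"] by auto
    have "norm (X m - ell2_of l) < e" if "m \<ge> M" for m
    proof -
      have "norm (X m - ell2_of l) \<le> e / 2"
      proof (rule norm_ell2_le)
        fix F :: "'a set" assume F: "finite F"
        show "(\<Sum>g\<in>F. (cmod (coord (X m - ell2_of l) g))\<^sup>2) \<le> (e / 2)\<^sup>2"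
        \<comment> \<open>With m fixed, the Cauchy estimate for \<open>X m - X n\<close> on a finite
          set is passed to the limit in n; e / 2 leaves room for the strict inequality.\<close>
        proof (rule LIMSEQ_le_const2)
          show "(\<lambda>n. \<Sum>g\<in>F. (cmod (coord (X m) g - coord (X n) g))\<^sup>2)
              \<longlonglongrightarrow> (\<Sum>g\<in>F. (cmod (coord (X m - ell2_of l) g))\<^sup>2)"
            unfolding coord_simps cl by (intro tendsto_intros l)
          have "(\<Sum>g\<in>F. (cmod (coord (X m) g - coord (X n) g))\<^sup>2) \<le> (e / 2)\<^sup>2" if "n \<ge> M" for n
          proof -
            have "(\<Sum>g\<in>F. (cmod (coord (X m - X n) g))\<^sup>2) \<le> (norm (X m - X n))\<^sup>2"
              by (rule sum_coord_le_norm[OF F])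
            also have "\<dots> \<le> (e / 2)\<^sup>2"
              using M[OF \<open>m \<ge> M\<close> that] by (intro power_mono) auto
            finally show ?thesis by (simp add: coord_simps)
          qed
          then show "\<exists>N. \<forall>n\<ge>N. (\<Sum>g\<in>F. (cmod (coord (X m) g - coord (X n) g))\<^sup>2) \<le> (e / 2)\<^sup>2"
            by blast
        qed
      qed (use \<open>e > 0\<close> in simp)
      then show ?thesis using \<open>e > 0\<close> by linarith
    qed
    then show "\<exists>no. \<forall>n\<ge>no. norm (X n - ell2_of l) < e" by blast
  qed
  then show "convergent X" unfolding convergent_def by blast
qed

lemma cinner_ket: "cinner (ket g) x = coord x g"
proof -
  have "cinner (ket g) x = (\<Sum>\<^sub>\<infinity>h. cnj (if h = g then 1 else 0) * coord x h)"
    by (simp add: cinner.rep_eq ket.rep_eq)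
  also have "\<dots> = (\<Sum>\<^sub>\<infinity>h\<in>{g}. coord x h)"
    by (rule infsum_cong_neutral) auto
  finally show ?thesis by simp
qed

lemma cinner_add_right: "cinner z (x + y) = cinner z x + cinner z y"
  using cinner_add_left[of x y z] by (metis cinner_commute complex_cnj_add)

lemma cinner_scaleC_right: "cinner x (scaleC c y) = c * cinner x y"
  using cinner_scaleC_left[of c y x] by (metis cinner_commute complex_cnj_cnj complex_cnj_mult)

lemma cinner_diff_left: "cinner (x - y) z = cinner x z - cinner y z"
  by (metis cinner_add_left add_diff_cancel diff_add_cancel)

lemma cinner_diff_right: "cinner z (x - y) = cinner z x - cinner z y"
  by (metis cinner_add_right add_diff_cancel diff_add_cancel)

lemma cinner_zero [simp]: "cinner 0 x = 0" "cinner x 0 = 0"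
  using cinner_diff_left[of 0 0 x] cinner_diff_right[of x 0 0] by auto

lemma cinner_sum_left: "cinner (\<Sum>i\<in>A. f i) x = (\<Sum>i\<in>A. cinner (f i) x)"
  by (induction A rule: infinite_finite_induct) (auto simp: cinner_add_left)

lemma cinner_sum_right: "cinner x (\<Sum>i\<in>A. f i) = (\<Sum>i\<in>A. cinner x (f i))"
  by (induction A rule: infinite_finite_induct) (auto simp: cinner_add_right)

text \<open>Multiplying y by the phase \<open>u\<close> makes the inner product real and
  nonnegative, and then the Cauchy-Schwarz inequality for the real inner product applies.\<close>

lemma norm_cinner_le: "cmod (cinner x y) \<le> norm x * norm y"
proof (cases "cinner x y = 0")
  case False
  define u where "u = cnj (sgn (cinner x y))"
  have "cinner x y * cnj (cinner x y) = of_real (cmod (cinner x y) * cmod (cinner x y))"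
    using complex_norm_square[of "cinner x y"] by (simp add: power2_eq_square)
  then have "u * cinner x y = of_real (cmod (cinner x y))"
    using False by (simp add: u_def sgn_div_norm scaleR_conv_of_real field_simps)
  then have "cmod (cinner x y) = inner x (scaleC u y)"
    by (simp add: inner_ell2_def cinner_scaleC_right)
  also have "\<dots> \<le> norm x * norm (scaleC u y)" by (rule norm_cauchy_schwarz)
  also have "norm (scaleC u y) = norm y"
    using False by (simp add: norm_scaleC u_def norm_sgn)
  finally show ?thesis .
qed simp

lemma bounded_linear_cinner_right: "bounded_linear (cinner x)"
  by (rule bounded_linear_intro[where K = "norm x"])
    (auto simp: cinner_add_right scaleR_eq_scaleC cinner_scaleC_right scaleR_conv_of_real
      norm_cinner_le mult.commute intro: order_trans[OF norm_cinner_le])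

lemma cinner_ext_left: "(\<And>y. cinner x y = cinner x' y) \<Longrightarrow> x = x'"
  by (rule ell2_eqI) (metis cinner_commute cinner_ket)

lemma tendsto_cinner_right: "(X \<longlongrightarrow> x) F \<Longrightarrow> ((\<lambda>n. cinner y (X n)) \<longlongrightarrow> cinner y x) F"
  by (rule bounded_linear.tendsto[OF bounded_linear_cinner_right])

lemma tendsto_cinner_left: "(X \<longlongrightarrow> x) F \<Longrightarrow> ((\<lambda>n. cinner (X n) y) \<longlongrightarrow> cinner x y) F"
  using tendsto_cnj[OF tendsto_cinner_right[of X x F y]] by (metis (mono_tags, lifting) cinner_commute tendsto_cong eventually_mono always_eventually)

lemma norm_ket [simp]: "norm (ket g) = 1"
proof -
  have "cinner (ket g) (ket g) = 1" by (simp add: cinner_ket ket.rep_eq)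
  then show ?thesis by (simp add: norm_eq_sqrt_inner inner_ell2_def)
qed

section \<open>Finitely supported vectors and matrix forms\<close>

definition fin_vec :: "'g set \<Rightarrow> ('g \<Rightarrow> complex) \<Rightarrow> 'g ell2" where
  "fin_vec F a = (\<Sum>h\<in>F. scaleC (a h) (ket h))"

lemma coord_fin_vec: "finite F \<Longrightarrow> coord (fin_vec F a) g = (if g \<in> F then a g else 0)"
  by (simp add: fin_vec_def coord_sum coord_simps if_distrib sum.delta cong: if_cong)

lemma norm_fin_vec:
  assumes "finite F" shows "norm (fin_vec F a) = sqrt (\<Sum>g\<in>F. (cmod (a g))\<^sup>2)"
proof -
  have "(\<Sum>\<^sub>\<infinity>g. (cmod (coord (fin_vec F a) g))\<^sup>2) = (\<Sum>\<^sub>\<infinity>g\<in>F. (cmod (a g))\<^sup>2)"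
    by (rule infsum_cong_neutral) (auto simp: coord_fin_vec assms)
  then show ?thesis using assms by (simp add: norm_ell2_def)
qed

lemma fin_vec_approx:
  assumes "e > 0"
  shows "\<exists>F. finite F \<and> norm (x - fin_vec F (coord x)) < e"
proof -
  have "((\<lambda>g. (cmod (coord x g))\<^sup>2) has_sum (norm x)\<^sup>2) UNIV"
    unfolding norm_ell2_sq by (rule has_sum_infsum[OF summable_coord])
  then have "((\<lambda>F. \<Sum>g\<in>F. (cmod (coord x g))\<^sup>2) \<longlongrightarrow> (norm x)\<^sup>2) (finite_subsets_at_top UNIV)"
    by (simp add: has_sum_def)
  then have "\<forall>\<^sub>F F in finite_subsets_at_top UNIV.
      dist (\<Sum>g\<in>F. (cmod (coord x g))\<^sup>2) ((norm x)\<^sup>2) < (e / 2)\<^sup>2"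
    by (rule tendstoD) (use assms in simp)
  then obtain F where F: "finite F" "dist (\<Sum>g\<in>F. (cmod (coord x g))\<^sup>2) ((norm x)\<^sup>2) < (e / 2)\<^sup>2"
    unfolding eventually_finite_subsets_at_top by blast
  have "norm (x - fin_vec F (coord x)) \<le> e / 2"
  proof (rule norm_ell2_le)
    fix G :: "'a set" assume G: "finite G"
    have "(\<Sum>g\<in>G. (cmod (coord (x - fin_vec F (coord x)) g))\<^sup>2) = (\<Sum>g\<in>G - F. (cmod (coord x g))\<^sup>2)"
      using F G by (intro sum.mono_neutral_cong_right) (auto simp: coord_simps coord_fin_vec)
    also have "\<dots> = (\<Sum>g\<in>G \<union> F. (cmod (coord x g))\<^sup>2) - (\<Sum>g\<in>F. (cmod (coord x g))\<^sup>2)"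
      using F G sum.union_disjoint[of "G - F" F "\<lambda>g. (cmod (coord x g))\<^sup>2"]
      by (simp add: Un_Diff_cancel2 Diff_Int_distrib2)
    also have "\<dots> \<le> (norm x)\<^sup>2 - (\<Sum>g\<in>F. (cmod (coord x g))\<^sup>2)"
      using sum_coord_le_norm[of "G \<union> F" x] F G by simp
    also have "\<dots> \<le> (e / 2)\<^sup>2"
      using F(2) by (simp add: dist_real_def)
    finally show "(\<Sum>g\<in>G. (cmod (coord (x - fin_vec F (coord x)) g))\<^sup>2) \<le> (e / 2)\<^sup>2" .
  qed (use assms in simp)
  then show ?thesis using F(1) assms by (intro exI[of _ F]) auto
qed

text \<open>Operators are only real-linear by type. Complex linearity is what makes the matrix
  entries \<open>coord (T (ket y)) x\<close> determine T on finitely supported vectors.\<close>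

definition clin :: "'g op \<Rightarrow> bool" where
  "clin T \<longleftrightarrow> (\<forall>c x. T (scaleC c x) = scaleC c (T x))"

lemma clin_fin_vec: "clin T \<Longrightarrow> T (fin_vec F a) = (\<Sum>h\<in>F. scaleC (a h) (T (ket h)))"
  by (simp add: fin_vec_def blinfun.sum_right clin_def)

lemma cinner_fin_vec_op:
  assumes "clin T"
  shows "cinner (fin_vec F b) (T (fin_vec F a)) = (\<Sum>x\<in>F. \<Sum>y\<in>F. cnj (b x) * coord (T (ket y)) x * a y)"
  unfolding clin_fin_vec[OF assms]
  by (subst sum.swap) (simp add: fin_vec_def cinner_sum_left cinner_sum_right cinner_scaleC_left
      cinner_scaleC_right cinner_ket sum_distrib_left mult_ac)

lemma matrix_form_le_norm:
  assumes "clin T" "finite F"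
  shows "cmod (\<Sum>x\<in>F. \<Sum>y\<in>F. cnj (b x) * coord (T (ket y)) x * a y)
    \<le> norm T * sqrt (\<Sum>x\<in>F. (cmod (b x))\<^sup>2) * sqrt (\<Sum>x\<in>F. (cmod (a x))\<^sup>2)"
proof -
  have "cmod (cinner (fin_vec F b) (T (fin_vec F a))) \<le> norm (fin_vec F b) * norm (T (fin_vec F a))"
    by (rule norm_cinner_le)
  also have "\<dots> \<le> norm (fin_vec F b) * (norm T * norm (fin_vec F a))"
    by (intro mult_left_mono norm_blinfun) auto
  finally show ?thesis
    by (simp add: cinner_fin_vec_op[OF assms(1)] norm_fin_vec[OF assms(2)] mult_ac)
qed

text \<open>Together with \<open>matrix_form_le_norm\<close> this describes the operator norm by
  finite matrix sums, the form in which both Haagerup's inequality and the bound for radial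
  multipliers are proved.\<close>

lemma norm_le_matrix_form:
  assumes T: "clin T" and K: "K \<ge> 0"
    and bound: "\<And>F a b. finite F \<Longrightarrow> cmod (\<Sum>x\<in>F. \<Sum>y\<in>F. cnj (b x) * coord (T (ket y)) x * a y)
      \<le> K * sqrt (\<Sum>x\<in>F. (cmod (b x))\<^sup>2) * sqrt (\<Sum>x\<in>F. (cmod (a x))\<^sup>2)"
  shows "norm T \<le> K"
proof (rule norm_blinfun_bound[OF K])
  fix x :: "'a ell2"
  have fin: "norm (T (fin_vec F a)) \<le> K * norm (fin_vec F a)" if F: "finite F" for F a
  proof (rule norm_ell2_le)
    fix G :: "'a set" assume G: "finite G"
    \<comment> \<open>One index set has to carry both the argument, supported on F, and the tested
      coordinates of the image, those in G.\<close>
    define H where "H = F \<union> G"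
    have H: "finite H" using F G by (simp add: H_def)
    define a' where "a' = (\<lambda>g. if g \<in> F then a g else 0)"
    have a': "fin_vec H a' = fin_vec F a"
      by (rule ell2_eqI) (use F H in \<open>auto simp: coord_fin_vec H_def a'_def\<close>)
    define v where "v = T (fin_vec H a')"
    have "complex_of_real (\<Sum>g\<in>H. (cmod (coord v g))\<^sup>2) = cinner (fin_vec H (coord v)) v"
      by (simp add: fin_vec_def cinner_sum_left cinner_scaleC_left cinner_ket
          complex_norm_square mult.commute flip: of_real_power)
    then have "(\<Sum>g\<in>H. (cmod (coord v g))\<^sup>2) = cmod (cinner (fin_vec H (coord v)) v)"
      by (metis (mono_tags, lifting) abs_of_nonneg norm_of_real sum_nonneg zero_le_power2)
    \<comment> \<open>The form is tested against the image itself, so that one factor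
      \<open>sqrt s\<close> cancels below.\<close>
    also have "\<dots> \<le> K * sqrt (\<Sum>x\<in>H. (cmod (coord v x))\<^sup>2) * sqrt (\<Sum>x\<in>H. (cmod (a' x))\<^sup>2)"
      using bound[OF H] by (subst (1) v_def, subst cinner_fin_vec_op[OF T])
    finally have *: "(\<Sum>g\<in>H. (cmod (coord v g))\<^sup>2)
        \<le> K * sqrt (\<Sum>x\<in>H. (cmod (coord v x))\<^sup>2) * norm (fin_vec F a)"
      by (simp flip: a' add: norm_fin_vec[OF H])
    have "sqrt (\<Sum>g\<in>H. (cmod (coord v g))\<^sup>2) \<le> K * norm (fin_vec F a)"
    proof (cases "(\<Sum>g\<in>H. (cmod (coord v g))\<^sup>2) = 0")
      case False
      define s where "s = (\<Sum>g\<in>H. (cmod (coord v g))\<^sup>2)"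
      have "s > 0" using False by (simp add: s_def sum_nonneg order_less_le)
      then have "sqrt s * sqrt s \<le> (K * norm (fin_vec F a)) * sqrt s"
        using * by (simp add: s_def[symmetric] mult_ac)
      then show ?thesis using \<open>s > 0\<close> unfolding s_def[symmetric]
        by (meson mult_right_le_imp_le real_sqrt_gt_zero)
    next
      case True
      then show ?thesis using K by simp
    qed
    then have "(\<Sum>g\<in>H. (cmod (coord v g))\<^sup>2) \<le> (K * norm (fin_vec F a))\<^sup>2"
      by (rule sqrt_le_D)
    moreover have "(\<Sum>g\<in>G. (cmod (coord v g))\<^sup>2) \<le> (\<Sum>g\<in>H. (cmod (coord v g))\<^sup>2)"
      using H by (intro sum_mono2) (auto simp: H_def)
    ultimately show "(\<Sum>g\<in>G. (cmod (coord (T (fin_vec F a)) g))\<^sup>2) \<le> (K * norm (fin_vec F a))\<^sup>2"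
      by (simp add: v_def a')
  qed (use K in simp)
  have "\<exists>F. \<forall>n. finite (F n) \<and> norm (x - fin_vec (F n) (coord x)) < inverse (real (Suc n))"
    using fin_vec_approx[of "inverse (real (Suc _))" x] by (intro choice) auto
  then obtain F where F: "\<And>n. finite (F n)"
      "\<And>n. norm (x - fin_vec (F n) (coord x)) < inverse (real (Suc n))" by blast
  have "(\<lambda>n. x - fin_vec (F n) (coord x)) \<longlonglongrightarrow> 0"
    by (rule Lim_null_comparison[OF _ LIMSEQ_inverse_real_of_nat])
      (use F(2) in \<open>auto intro!: always_eventually less_imp_le\<close>)
  then have lim: "(\<lambda>n. fin_vec (F n) (coord x)) \<longlonglongrightarrow> x"
    using tendsto_diff[OF tendsto_const[of x]] by fastforce
  have "(\<lambda>n. norm (T (fin_vec (F n) (coord x)))) \<longlonglongrightarrow> norm (T x)"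
    by (intro tendsto_intros lim)
  moreover have "(\<lambda>n. K * norm (fin_vec (F n) (coord x))) \<longlonglongrightarrow> K * norm x"
    by (intro tendsto_intros lim)
  ultimately show "norm (T x) \<le> K * norm x"
    by (rule LIMSEQ_le) (use fin F(1) in auto)
qed

section \<open>Functional calculus\<close>

text \<open>The calculus uses real polynomials only, so it is carried out in the real Hilbert space
  with \<open>inner\<close>.\<close>

definition self_adj :: "'g op \<Rightarrow> bool" where
  "self_adj T \<longleftrightarrow> (\<forall>x y. inner (T x) y = inner x (T y))"

lemma power_op_apply:
  fixes T :: "'a::real_normed_vector \<Rightarrow>\<^sub>L 'a"
  shows "(((o\<^sub>L) T ^^ i) id_blinfun) x = (blinfun_apply T ^^ i) x"
  by (induction i) auto

lemma poly_op_apply: "poly_op p T x = (\<Sum>i\<le>degree p. coeff p i *\<^sub>R (blinfun_apply T ^^ i) x)"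
  by (simp add: poly_op_def blinfun.sum_left blinfun.scaleR_left power_op_apply)

lemma poly_op_apply_ge:
  assumes "degree p \<le> n"
  shows "poly_op p T x = (\<Sum>i\<le>n. coeff p i *\<^sub>R (blinfun_apply T ^^ i) x)"
  unfolding poly_op_apply
  by (rule sum.mono_neutral_left) (use assms in \<open>auto simp: coeff_eq_0\<close>)

lemma poly_op_0 [simp]: "poly_op 0 T = 0"
  by (rule blinfun_eqI) (simp add: poly_op_apply)

lemma poly_op_pCons: "poly_op (pCons a p) T x = a *\<^sub>R x + T (poly_op p T x)"
proof -
  have "poly_op (pCons a p) T x = (\<Sum>i\<le>Suc (degree p). coeff (pCons a p) i *\<^sub>R (blinfun_apply T ^^ i) x)"
    by (rule poly_op_apply_ge) (rule degree_pCons_le)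
  also have "\<dots> = a *\<^sub>R x + (\<Sum>i\<le>degree p. coeff p i *\<^sub>R (blinfun_apply T ^^ Suc i) x)"
    by (subst sum.atMost_Suc_shift) simp
  also have "(\<Sum>i\<le>degree p. coeff p i *\<^sub>R (blinfun_apply T ^^ Suc i) x) = T (poly_op p T x)"
    by (simp add: poly_op_apply blinfun.sum_right blinfun.scaleR_right)
  finally show ?thesis .
qed

lemma poly_op_add: "poly_op (p + q) T = poly_op p T + poly_op q T"
proof (rule blinfun_eqI)
  fix x
  define n where "n = max (degree p) (degree q)"
  have "degree (p + q) \<le> n" unfolding n_def by (rule degree_add_le_max)
  then show "poly_op (p + q) T x = (poly_op p T + poly_op q T) x"
    using poly_op_apply_ge[of "p + q" n T x] poly_op_apply_ge[of p n T x] poly_op_apply_ge[of q n T x]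
    by (simp add: n_def blinfun.add_left scaleR_add_left sum.distrib)
qed

lemma poly_op_smult: "poly_op (smult c p) T = c *\<^sub>R poly_op p T"
proof (rule blinfun_eqI)
  fix x
  show "poly_op (smult c p) T x = (c *\<^sub>R poly_op p T) x"
    using poly_op_apply_ge[of "smult c p" "degree p" T x] poly_op_apply[of p T x]
    by (simp add: degree_smult_le blinfun.scaleR_left scaleR_sum_right)
qed

lemma poly_op_diff: "poly_op (p - q) T = poly_op p T - poly_op q T"
  using poly_op_add[of p "smult (-1) q" T] poly_op_smult[of "-1" q T] by simp

lemma poly_op_mult: "poly_op (p * q) T x = poly_op p T (poly_op q T x)"
proof (induction p arbitrary: x)
  case (pCons a p)
  have "poly_op (pCons a p * q) T x = a *\<^sub>R poly_op q T x + T (poly_op p T (poly_op q T x))"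
    by (simp add: poly_op_add poly_op_smult poly_op_pCons blinfun.add_left blinfun.scaleR_left pCons)
  then show ?case by (simp add: poly_op_pCons)
qed simp

lemma self_adj_poly_op:
  fixes T :: "'g op"
  assumes "self_adj T" shows "self_adj (poly_op p T)"
  unfolding self_adj_def
proof (induction p)
  case (pCons a p)
  have comm: "poly_op p T (T x) = T (poly_op p T x)" for x
    using poly_op_mult[of p "[:0, 1:]" T x] poly_op_mult[of "[:0, 1:]" p T x]
    by (simp add: poly_op_pCons mult.commute)
  show ?case
    using assms pCons by (simp add: poly_op_pCons inner_add_left inner_add_right self_adj_def flip: comm)
qed simp

section \<open>Spectral bounds for polynomials of a positive operator\<close>

definition bounded_below :: "'g op \<Rightarrow> bool" where
  "bounded_below T \<longleftrightarrow> (\<exists>c>0. \<forall>x. norm (T x) \<ge> c * norm x)"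

lemma bounded_belowI_inner:
  fixes T :: "'g op"
  assumes "c > 0" "\<And>x. inner (T x) x \<ge> c * (norm x)\<^sup>2"
  shows "bounded_below T"
  unfolding bounded_below_def
proof (intro exI[of _ c] conjI allI)
  fix x
  have "c * norm x * norm x \<le> norm (T x) * norm x"
    using assms(2)[of x] norm_cauchy_schwarz[of "T x" x] by (simp add: power2_eq_square)
  then show "norm (T x) \<ge> c * norm x"
    by (cases "norm x = 0") auto
qed (use assms in auto)

lemma bounded_below_mult:
  assumes "bounded_below (poly_op p T)" "bounded_below (poly_op q T)"
  shows "bounded_below (poly_op (p * q) T)"
proof -
  obtain c d where c: "c > 0" "\<And>x. norm (poly_op p T x) \<ge> c * norm x"
    and d: "d > 0" "\<And>x. norm (poly_op q T x) \<ge> d * norm x"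
    using assms unfolding bounded_below_def by blast
  have "(c * d) * norm x \<le> norm (poly_op (p * q) T x)" for x
  proof -
    have "c * (d * norm x) \<le> c * norm (poly_op q T x)"
      using c d by (intro mult_left_mono) auto
    also have "\<dots> \<le> norm (poly_op (p * q) T x)"
      unfolding poly_op_mult by (rule c)
    finally show ?thesis by (simp add: mult_ac)
  qed
  then show ?thesis unfolding bounded_below_def using c d by (intro exI[of _ "c * d"]) auto
qed

abbreviation cpoly :: "real poly \<Rightarrow> complex \<Rightarrow> complex" where
  "cpoly p z \<equiv> poly (map_poly of_real p) z"

lemma cpoly_add: "cpoly (p + q) z = cpoly p z + cpoly q z"
  by (induction p q rule: poly_induct2) (auto simp: map_poly_pCons algebra_simps)

lemma cpoly_smult: "cpoly (smult c p) z = of_real c * cpoly p z"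
  by (induction p) (auto simp: map_poly_pCons algebra_simps)

lemma cpoly_mult: "cpoly (p * q) z = cpoly p z * cpoly q z"
  by (induction p) (auto simp: cpoly_add cpoly_smult map_poly_pCons algebra_simps)

lemma cpoly_of_real: "cpoly p (of_real x) = of_real (poly p x)"
  by (induction p) (auto simp: map_poly_pCons)

text \<open>Half of the spectral mapping theorem without spectra: over the reals p splits into
  linear factors with roots outside [0, R] and quadratic factors without real roots. Each factor is
  bounded below at T, hence so is the product. The induction removes one factor at a time, with
  roots supplied by the fundamental theorem of algebra.\<close>

lemma bounded_below_poly_op:
  fixes T :: "'g op"
  assumes T: "self_adj T" and pos: "\<And>x. inner (T x) x \<ge> 0" and R: "norm T \<le> R"
    and p: "\<And>t. 0 \<le> t \<Longrightarrow> t \<le> R \<Longrightarrow> poly p t \<noteq> 0"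
  shows "bounded_below (poly_op p T)"
  using p
proof (induction "degree p" arbitrary: p rule: less_induct)
  case less
  have R0: "R \<ge> 0" using R norm_ge_zero[of T] by linarith
  show ?case
  proof (cases "degree p = 0")
    case True
    then obtain c where c: "p = [:c:]" by (rule degree_eq_zeroE)
    have "c \<noteq> 0" using less.prems[of 0] R0 c by auto
    then show ?thesis
      unfolding bounded_below_def c by (intro exI[of _ "\<bar>c\<bar>"]) (auto simp: poly_op_pCons)
  next
    case False
    have dm: "degree (map_poly complex_of_real p) = degree p"
      by (rule degree_map_poly) auto
    have "\<not> constant (poly (map_poly complex_of_real p))"
      using False by (simp add: constant_degree dm)
    then obtain z where z: "cpoly p z = 0"
      using fundamental_theorem_of_algebra by blast
    have factor: "bounded_below (poly_op p T)"
      if "p = q * r" "bounded_below (poly_op q T)" "degree q > 0" for q r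
    proof -
      have "r \<noteq> 0" "q \<noteq> 0" using False that(1) by auto
      then have "degree r < degree p"
        using that by (simp add: degree_mult_eq)
      moreover have "poly r t \<noteq> 0" if "0 \<le> t" "t \<le> R" for t
        using less.prems[OF that] \<open>p = q * r\<close> by auto
      ultimately have "bounded_below (poly_op r T)" by (intro less.hyps)
      then show ?thesis using that bounded_below_mult by blast
    qed
    show ?thesis
    proof (cases "Im z = 0")
      case True
      define a where "a = Re z"
      have za: "z = of_real a" using True by (simp add: a_def complex_eq_iff)
      then have pa: "poly p a = 0" using z by (simp add: cpoly_of_real)
      then obtain r where r: "p = [:-a, 1:] * r" by (auto simp: poly_eq_0_iff_dvd)
      have app: "poly_op [:-a, 1:] T x = T x - a *\<^sub>R x" for x
        by (simp add: poly_op_pCons)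
      \<comment> \<open>Left of the interval, positivity of T gives the lower bound -a; right of it,
        the norm bound gives a - R.\<close>
      consider "a < 0" | "a > R" using less.prems[of a] pa by force
      then have "bounded_below (poly_op [:-a, 1:] T)"
      proof cases
        case 1
        show ?thesis
        proof (rule bounded_belowI_inner[of "-a"])
          show "inner (poly_op [:-a, 1:] T x) x \<ge> - a * (norm x)\<^sup>2" for x
            using pos[of x] by (simp add: app inner_diff_left power2_norm_eq_inner)
        qed (use 1 in simp)
      next
        case 2
        have "norm (poly_op [:-a, 1:] T x) \<ge> (a - R) * norm x" for x
        proof -
          have "norm (T x) \<le> R * norm x"
            using norm_blinfun[of T x] mult_right_mono[OF R norm_ge_zero[of x]] by linarith
          moreover have "a * norm x \<le> norm (T x) + norm (T x - a *\<^sub>R x)"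
            using norm_triangle_ineq4[of "T x" "T x - a *\<^sub>R x"] 2 R0 by simp
          ultimately show ?thesis by (simp add: app algebra_simps)
        qed
        then show ?thesis unfolding bounded_below_def using 2 by (intro exI[of _ "a - R"]) auto
      qed
      then show ?thesis by (intro factor[OF r]) auto
    next
      case False
      define a b where "a = Re z" and "b = Im z"
      \<comment> \<open>q is (X - a)^2 + b^2, the real polynomial whose roots are z and its
        conjugate.\<close>
      define q where "q = [:a\<^sup>2 + b\<^sup>2, -2 * a, 1:]"
      have q0: "cpoly q z = 0"
        by (simp add: q_def map_poly_pCons complex_eq_iff a_def b_def power2_eq_square algebra_simps)
      have qn: "q \<noteq> 0" "degree q = 2" by (auto simp: q_def)
      define m where "m = p mod q"
      have pq: "p = q * (p div q) + m" unfolding m_def by simp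
      have mz: "cpoly m z = 0" using z q0 pq by (metis add_0 cpoly_add cpoly_mult mult_zero_left)
      have dm2: "degree m < 2" using degree_mod_less'[of q p] qn
        by (cases "m = 0") (auto simp: m_def)
      have "m = [:coeff m 0, coeff m 1:]"
        using dm2 by (intro poly_eqI) (auto simp: coeff_pCons coeff_eq_0 split: nat.split)
      then obtain c d where m: "m = [:d, c:]" by blast
      \<comment> \<open>A real polynomial of degree below 2 that vanishes at the non-real z is
        zero.\<close>
      have "c = 0 \<and> d = 0"
        using False mz unfolding m by (auto simp: map_poly_pCons complex_eq_iff)
      then have p': "p = q * (p div q)" using pq m by simp
      have "bounded_below (poly_op q T)"
      proof (rule bounded_belowI_inner[of "b\<^sup>2"])
        fix x
        \<comment> \<open>Completing the square: apart from the last term this is the square of the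
          self-adjoint operator T - a.\<close>
        have qx: "poly_op q T x = T (T x - a *\<^sub>R x) - a *\<^sub>R (T x - a *\<^sub>R x) + b\<^sup>2 *\<^sub>R x"
          by (simp add: q_def poly_op_pCons algebra_simps blinfun.add_right blinfun.diff_right
              blinfun.scaleR_right power2_eq_square scaleR_2[symmetric])
        have Tx: "inner (T (T x - a *\<^sub>R x)) x = inner (T x - a *\<^sub>R x) (T x)"
          using T by (simp add: self_adj_def)
        have "inner (poly_op q T x) x = inner (T x - a *\<^sub>R x) (T x - a *\<^sub>R x) + b\<^sup>2 * inner x x"
          unfolding qx inner_add_left inner_diff_left[of "T (T x - a *\<^sub>R x)"] Tx
          by (simp add: inner_diff_left inner_diff_right inner_commute algebra_simps)
        then show "inner (poly_op q T x) x \<ge> b\<^sup>2 * (norm x)\<^sup>2"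
          by (simp add: power2_norm_eq_inner)
      qed (use False in \<open>simp add: b_def\<close>)
      then show ?thesis by (intro factor[OF p']) (auto simp: qn)
    qed
  qed
qed

text \<open>If the norm M of B = p(T) exceeded K, then M^2 - p^2 would have no zero on [0, R], so
  M^2 - B^2 would be bounded below. That pushes the norm of B strictly under M, a
  contradiction.\<close>

lemma norm_poly_op_le:
  fixes T :: "'g op"
  assumes T: "self_adj T" and pos: "\<And>x. inner (T x) x \<ge> 0" and R: "norm T \<le> R"
    and p: "\<And>t. 0 \<le> t \<Longrightarrow> t \<le> R \<Longrightarrow> \<bar>poly p t\<bar> \<le> K"
  shows "norm (poly_op p T) \<le> K"
proof (rule ccontr)
  define B where "B = poly_op p T"
  define M where "M = norm B"
  assume "\<not> norm (poly_op p T) \<le> K"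
  then have MK: "M > K" by (simp add: M_def B_def)
  have R0: "R \<ge> 0" using R norm_ge_zero[of T] by linarith
  then have K0: "K \<ge> 0" using p[of 0] by (meson abs_ge_zero order_refl order_trans)
  have B: "inner (B x) y = inner x (B y)" for x y
    using self_adj_poly_op[OF T, of p] by (simp add: self_adj_def B_def)
  define q where "q = [:M\<^sup>2:] - p * p"
  have "poly q t \<noteq> 0" if "0 \<le> t" "t \<le> R" for t
  proof -
    have "(poly p t)\<^sup>2 < M\<^sup>2"
      using p[OF that] MK K0 by (intro power2_strict_mono) auto
    then show ?thesis by (simp add: q_def power2_eq_square)
  qed
  then have "bounded_below (poly_op q T)"
    by (intro bounded_below_poly_op[OF T pos R])
  then obtain c where c: "c > 0" "\<And>x. norm (poly_op q T x) \<ge> c * norm x"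
    unfolding bounded_below_def by blast
  have qx: "poly_op q T x = M\<^sup>2 *\<^sub>R x - B (B x)" for x
    by (simp add: q_def poly_op_diff poly_op_pCons poly_op_mult blinfun.diff_left B_def)
  have M0: "M > 0" using MK K0 by linarith
  \<comment> \<open>The square of the norm of \<open>M\<^sup>2 *\<^sub>R x - B (B x)\<close> is
    expanded; since \<open>B (B x)\<close> has norm at most M times that of \<open>B x\<close>, a
    definite gap remains between the norm of \<open>B x\<close> and M times that of x.\<close>
  have low: "c\<^sup>2 * (norm x)\<^sup>2 \<le> M\<^sup>2 * (M\<^sup>2 * (norm x)\<^sup>2 - (norm (B x))\<^sup>2)" for x
  proof -
    have "c\<^sup>2 * (norm x)\<^sup>2 \<le> (norm (poly_op q T x))\<^sup>2"
      using power_mono[OF c(2)[of x], of 2] c(1) by (simp add: power_mult_distrib)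
    also have "\<dots> = M^4 * (norm x)\<^sup>2 - 2 * M\<^sup>2 * (norm (B x))\<^sup>2 + (norm (B (B x)))\<^sup>2"
      unfolding qx power2_norm_eq_inner
      by (simp add: inner_diff_left inner_diff_right B inner_commute power2_eq_square power4_eq_xxxx algebra_simps)
    also have "(norm (B (B x)))\<^sup>2 \<le> M\<^sup>2 * (norm (B x))\<^sup>2"
      using power_mono[OF norm_blinfun[of B "B x"], of 2] by (simp add: power_mult_distrib M_def)
    finally show ?thesis by (simp add: algebra_simps power2_eq_square power4_eq_xxxx)
  qed
  \<comment> \<open>The maximum with 0 covers a negative bound, which would force B to
    vanish.\<close>
  define M' where "M' = sqrt (max 0 (M\<^sup>2 - c\<^sup>2 / M\<^sup>2))"
  have "norm B \<le> M'"
  proof (rule norm_blinfun_bound)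
    fix x
    have "(norm (B x))\<^sup>2 \<le> (M\<^sup>2 - c\<^sup>2 / M\<^sup>2) * (norm x)\<^sup>2"
      using low[of x] M0 by (simp add: field_simps power2_eq_square)
    also have "\<dots> \<le> (M' * norm x)\<^sup>2"
      by (simp add: M'_def power_mult_distrib mult_right_mono)
    finally show "norm (B x) \<le> M' * norm x"
      by (rule power2_le_imp_le) (simp add: M'_def)
  qed (simp add: M'_def)
  then have "M\<^sup>2 \<le> M'\<^sup>2" using M0 by (intro power_mono) (auto simp: M_def)
  also have "\<dots> = max 0 (M\<^sup>2 - c\<^sup>2 / M\<^sup>2)" by (simp add: M'_def)
  finally have "M\<^sup>2 \<le> max 0 (M\<^sup>2 - c\<^sup>2 / M\<^sup>2)" .
  moreover have "M\<^sup>2 > 0" "c\<^sup>2 / M\<^sup>2 > 0" using M0 c(1) by auto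
  ultimately show False by linarith
qed

section \<open>From polynomials to continuous functions\<close>

lemma real_poly_approx:
  fixes h :: "real \<Rightarrow> real"
  assumes "continuous_on {0..R} h" "e > 0"
  shows "\<exists>p. \<forall>t\<in>{0..R}. \<bar>h t - poly p t\<bar> < e"
proof -
  obtain g where g: "real_polynomial_function g" "\<And>x. x \<in> {0..R} \<Longrightarrow> \<bar>h x - g x\<bar> < e"
    using Stone_Weierstrass_real_polynomial_function[OF _ assms] by blast
  then obtain a n where a: "g = (\<lambda>x. \<Sum>i\<le>n. a i * x ^ i)"
    unfolding real_polynomial_function_iff_sum by blast
  have "poly (\<Sum>i\<le>n. monom (a i) i) t = g t" for t
    by (simp add: a poly_sum poly_monom)
  then show ?thesis using g(2) by (intro exI[of _ "\<Sum>i\<le>n. monom (a i) i"]) auto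
qed

lemma poly_approx_sequence:
  fixes h :: "real \<Rightarrow> real"
  assumes "continuous_on {0..R} h"
  obtains p where "uniform_limit {0..R} (\<lambda>n. poly (p n)) h sequentially"
proof -
  have "\<forall>n. \<exists>p. \<forall>t\<in>{0..R}. \<bar>h t - poly p t\<bar> < inverse (real (Suc n))"
    using real_poly_approx[OF assms] by auto
  then obtain p where p: "\<And>n t. t \<in> {0..R} \<Longrightarrow> \<bar>h t - poly (p n) t\<bar> < inverse (real (Suc n))"
    by metis
  have "uniform_limit {0..R} (\<lambda>n. poly (p n)) h sequentially"
  proof (rule uniform_limitI)
    fix e :: real assume "e > 0"
    then have "\<forall>\<^sub>F n in sequentially. inverse (real (Suc n)) < e"
      using LIMSEQ_inverse_real_of_nat by (rule order_tendstoD(2)[rotated])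
    then show "\<forall>\<^sub>F n in sequentially. \<forall>x\<in>{0..R}. dist (poly (p n) x) (h x) < e"
    proof eventually_elim
      case (elim n)
      then show ?case using p[of _ n] by (force simp: dist_real_def abs_minus_commute)
    qed
  qed
  then show ?thesis by (rule that)
qed

text \<open>Two sequences are compared at once: equal ones give the Cauchy property, different ones
  show that the limit does not depend on the approximation.\<close>

lemma poly_op_Cauchy:
  fixes T :: "'g op"
  assumes T: "self_adj T" and pos: "\<And>x. inner (T x) x \<ge> 0"
    and lim: "uniform_limit {0..norm T} (\<lambda>n. poly (p n)) h sequentially"
    and lim': "uniform_limit {0..norm T} (\<lambda>n. poly (q n)) h sequentially"
    and e: "e > 0"
  shows "\<exists>N. \<forall>m\<ge>N. \<forall>n\<ge>N. norm (poly_op (p m) T - poly_op (q n) T) < e"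
proof -
  have e3: "e / 3 > 0" using e by simp
  obtain N where N: "\<And>n x. n \<ge> N \<Longrightarrow> x \<in> {0..norm T} \<Longrightarrow> dist (poly (p n) x) (h x) < e / 3"
    using uniform_limitD[OF lim e3] unfolding eventually_sequentially by blast
  obtain N' where N': "\<And>n x. n \<ge> N' \<Longrightarrow> x \<in> {0..norm T} \<Longrightarrow> dist (poly (q n) x) (h x) < e / 3"
    using uniform_limitD[OF lim' e3] unfolding eventually_sequentially by blast
  have "norm (poly_op (p m) T - poly_op (q n) T) < e" if "m \<ge> max N N'" "n \<ge> max N N'" for m n
  proof -
    have "norm (poly_op (p m - q n) T) \<le> 2 * e / 3"
    proof (rule norm_poly_op_le[OF T pos order_refl])
      fix t assume "0 \<le> t" "t \<le> norm T"
      then have t: "t \<in> {0..norm T}" by simp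
      have mn: "m \<ge> N" "n \<ge> N'" using that by auto
      show "\<bar>poly (p m - q n) t\<bar> \<le> 2 * e / 3"
        using N[OF mn(1) t] N'[OF mn(2) t] by (simp add: dist_real_def abs_if split: if_splits)
    qed
    then show ?thesis using e by (simp add: poly_op_diff)
  qed
  then show ?thesis by blast
qed

text \<open>The description in \<open>cfc\<close> quantifies over all approximating sequences.
  Completeness yields an operator that satisfies it, and the given sequence pins this operator
  down.\<close>

lemma cfc_limit:
  fixes T :: "'g op"
  assumes T: "self_adj T" and pos: "\<And>x. inner (T x) x \<ge> 0" and h: "continuous_on {0..norm T} h"
    and lim: "uniform_limit {0..norm T} (\<lambda>n. poly (p n)) h sequentially"
  shows "(\<lambda>n. poly_op (p n) T) \<longlonglongrightarrow> cfc T h"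
proof -
  have "Cauchy (\<lambda>n. poly_op (p n) T)"
    by (rule CauchyI) (rule poly_op_Cauchy[OF T pos lim lim])
  then obtain S where S: "(\<lambda>n. poly_op (p n) T) \<longlonglongrightarrow> S"
    using Cauchy_convergent_iff convergent_def by blast
  have all: "(\<lambda>n. poly_op (q n) T) \<longlonglongrightarrow> S"
    if "uniform_limit {0..norm T} (\<lambda>n. poly (q n)) h sequentially" for q
  proof -
    have "(\<lambda>n. poly_op (q n) T - poly_op (p n) T) \<longlonglongrightarrow> 0"
      by (rule LIMSEQ_I) (use poly_op_Cauchy[OF T pos that lim] in fastforce)
    from tendsto_add[OF this S] show ?thesis by simp
  qed
  have "cfc T h = S"
    unfolding cfc_def
  proof (rule the_equality)
    show "\<forall>p. uniform_limit {0..norm T} (\<lambda>n. poly (p n)) h sequentially \<longrightarrow> (\<lambda>n. poly_op (p n) T) \<longlonglongrightarrow> S"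
      using all by blast
  next
    fix S' assume "\<forall>p. uniform_limit {0..norm T} (\<lambda>n. poly (p n)) h sequentially \<longrightarrow> (\<lambda>n. poly_op (p n) T) \<longlonglongrightarrow> S'"
    then have "(\<lambda>n. poly_op (p n) T) \<longlonglongrightarrow> S'" using lim by blast
    then show "S' = S" using S LIMSEQ_unique by blast
  qed
  then show ?thesis using S by simp
qed

text \<open>The constant r serves two purposes: r = 0 gives the norm bound, and r = K gives
  positivity in \<open>cfc_positive\<close>.\<close>

lemma norm_cfc_diff_le:
  fixes T :: "'g op"
  assumes T: "self_adj T" and pos: "\<And>x. inner (T x) x \<ge> 0" and h: "continuous_on {0..norm T} h"
    and K: "\<And>t. 0 \<le> t \<Longrightarrow> t \<le> norm T \<Longrightarrow> \<bar>r - h t\<bar> \<le> K"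
  shows "norm (r *\<^sub>R id_blinfun - cfc T h) \<le> K"
proof -
  obtain p where p: "uniform_limit {0..norm T} (\<lambda>n. poly (p n)) h sequentially"
    using poly_approx_sequence[OF h] .
  have lim: "(\<lambda>n. norm (r *\<^sub>R id_blinfun - poly_op (p n) T)) \<longlonglongrightarrow> norm (r *\<^sub>R id_blinfun - cfc T h)"
    by (intro tendsto_intros cfc_limit[OF T pos h p])
  show ?thesis
  proof (rule field_le_epsilon)
    fix e :: real assume e: "e > 0"
    have "\<forall>\<^sub>F n in sequentially. norm (r *\<^sub>R id_blinfun - poly_op (p n) T) \<le> K + e"
      using uniform_limitD[OF p e]
    proof eventually_elim
      case (elim n)
      have "poly_op ([:r:] - p n) T = r *\<^sub>R id_blinfun - poly_op (p n) T"
        by (rule blinfun_eqI) (simp add: poly_op_diff poly_op_pCons blinfun.diff_left blinfun.scaleR_left)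
      moreover have "norm (poly_op ([:r:] - p n) T) \<le> K + e"
      proof (rule norm_poly_op_le[OF T pos order_refl])
        fix t assume t: "0 \<le> t" "t \<le> norm T"
        then have "dist (poly (p n) t) (h t) < e" using elim by simp
        then show "\<bar>poly ([:r:] - p n) t\<bar> \<le> K + e"
          using K[OF t] by (simp add: dist_real_def abs_if split: if_splits)
      qed
      ultimately show ?case by simp
    qed
    then show "norm (r *\<^sub>R id_blinfun - cfc T h) \<le> K + e"
      by (rule tendsto_upperbound[OF lim]) simp
  qed
qed

lemma norm_cfc_le:
  fixes T :: "'g op"
  assumes T: "self_adj T" and pos: "\<And>x. inner (T x) x \<ge> 0" and h: "continuous_on {0..norm T} h"
    and K: "\<And>t. 0 \<le> t \<Longrightarrow> t \<le> norm T \<Longrightarrow> \<bar>h t\<bar> \<le> K"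
  shows "norm (cfc T h) \<le> K"
  using norm_cfc_diff_le[OF T pos h, of 0 K] K by simp

lemma self_adj_cfc:
  fixes T :: "'g op"
  assumes T: "self_adj T" and pos: "\<And>x. inner (T x) x \<ge> 0" and h: "continuous_on {0..norm T} h"
  shows "self_adj (cfc T h)"
  unfolding self_adj_def
proof (intro allI)
  fix x y
  obtain p where p: "uniform_limit {0..norm T} (\<lambda>n. poly (p n)) h sequentially"
    using poly_approx_sequence[OF h] .
  have "(\<lambda>n. inner (poly_op (p n) T x) y) \<longlonglongrightarrow> inner (cfc T h x) y"
    by (intro tendsto_intros blinfun.tendsto cfc_limit[OF T pos h p])
  moreover have "(\<lambda>n. inner x (poly_op (p n) T y)) \<longlonglongrightarrow> inner x (cfc T h y)"
    by (intro tendsto_intros blinfun.tendsto cfc_limit[OF T pos h p])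
  moreover have "inner (poly_op (p n) T x) y = inner x (poly_op (p n) T y)" for n
    using self_adj_poly_op[OF T] by (simp add: self_adj_def)
  ultimately show "inner (cfc T h x) y = inner x (cfc T h y)"
    by (simp add: LIMSEQ_unique)
qed

lemma cfc_positive:
  fixes T :: "'g op"
  assumes T: "self_adj T" and pos: "\<And>x. inner (T x) x \<ge> 0" and h: "continuous_on {0..norm T} h"
    and K: "\<And>t. 0 \<le> t \<Longrightarrow> t \<le> norm T \<Longrightarrow> 0 \<le> h t \<and> h t \<le> K"
  shows "inner (cfc T h x) x \<ge> 0"
proof -
  \<comment> \<open>Values in [0, K] lie within K of K, and an operator within K of
    \<open>K *\<^sub>R id_blinfun\<close> has a nonnegative quadratic form.\<close>
  have "norm (K *\<^sub>R id_blinfun - cfc T h) \<le> K"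
    by (rule norm_cfc_diff_le[OF T pos h]) (use K in force)
  then have "norm ((K *\<^sub>R id_blinfun - cfc T h) x) \<le> K * norm x"
    by (meson mult_right_mono norm_blinfun norm_ge_zero order_trans)
  then have "inner ((K *\<^sub>R id_blinfun - cfc T h) x) x \<le> K * norm x * norm x"
    by (meson mult_right_mono norm_cauchy_schwarz norm_ge_zero order_trans)
  then show ?thesis
    by (simp add: blinfun.diff_left blinfun.scaleR_left inner_diff_left dot_square_norm power2_eq_square)
qed

section \<open>Adjoints and q-norms\<close>

definition adj_pair :: "'g op \<Rightarrow> 'g op \<Rightarrow> bool" where
  "adj_pair S T \<longleftrightarrow> (\<forall>x y. cinner (S x) y = cinner x (T y))"

lemma adj_pair_unique:
  assumes "adj_pair S T" "adj_pair S' T" shows "S = S'"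
  by (rule blinfun_eqI, rule cinner_ext_left) (use assms in \<open>simp add: adj_pair_def\<close>)

text \<open>\<open>adj\<close> is a definite description. Instead of a general existence theorem,
  adjoints are exhibited explicitly and carried along as pairs.\<close>

lemma adj_eqI:
  assumes "adj_pair S T" shows "adj T = S"
  unfolding adj_def using assms adj_pair_unique unfolding adj_pair_def by (intro the_equality) blast+

lemma adj_pair_sym: "adj_pair S T \<Longrightarrow> adj_pair T S"
  unfolding adj_pair_def by (metis cinner_commute)

lemma adj_pair_inner: "adj_pair S T \<Longrightarrow> inner (S x) y = inner x (T y)"
  by (simp add: adj_pair_def inner_ell2_def)

lemma adj_pair_norm_le:
  assumes "adj_pair S T" shows "norm S \<le> norm T"
proof (rule norm_blinfun_bound)
  fix x
  have "norm (S x) * norm (S x) = inner x (T (S x))"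
    using adj_pair_inner[OF assms, of x "S x"] by (simp add: dot_square_norm power2_eq_square)
  also have "\<dots> \<le> norm x * norm (T (S x))" by (rule norm_cauchy_schwarz)
  also have "\<dots> \<le> norm x * (norm T * norm (S x))" by (intro mult_left_mono norm_blinfun) auto
  finally have "norm (S x) * norm (S x) \<le> (norm T * norm x) * norm (S x)" by (simp add: mult_ac)
  then show "norm (S x) \<le> norm T * norm x"
    by (cases "norm (S x) = 0") auto
qed simp

text \<open>The trace is evaluated at a unit vector, so it is bounded by the norm; the calculus
  bounds the norm of the absolute value by that of T, and the norm of its q-th power
  accordingly.\<close>

lemma Lq_norm_le:
  assumes "adj_pair S T" "q \<ge> 1"
  shows "0 \<le> Lq_norm q T" "Lq_norm q T \<le> norm T"
proof -
  define A where "A = adj T o\<^sub>L T"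
  have adjT: "adj T = S" by (rule adj_eqI[OF assms(1)])
  have Ain: "inner (A x) y = inner (T x) (T y)" for x y
    by (simp add: A_def adjT adj_pair_inner[OF assms(1)])
  have A: "self_adj A" unfolding self_adj_def by (metis Ain inner_commute)
  have Apos: "inner (A x) x \<ge> 0" for x by (simp add: Ain)
  have "norm A \<le> norm S * norm T" unfolding A_def adjT by (rule norm_blinfun_compose)
  also have "\<dots> \<le> norm T * norm T" by (intro mult_right_mono adj_pair_norm_le assms) auto
  finally have nA: "sqrt (norm A) \<le> norm T" by (simp add: real_le_lsqrt power2_eq_square)
  define B where "B = op_abs T"
  have B_cfc: "B = cfc A sqrt" by (simp add: B_def op_abs_def A_def)
  have sq: "continuous_on {0..norm A} sqrt" by (intro continuous_intros)
  have B: "self_adj B" unfolding B_cfc by (rule self_adj_cfc[OF A Apos sq])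
  have Bpos: "inner (B x) x \<ge> 0" for x
    unfolding B_cfc by (rule cfc_positive[OF A Apos sq, of "sqrt (norm A)"]) auto
  have nB: "norm B \<le> norm T"
    unfolding B_cfc
  proof (rule norm_cfc_le[OF A Apos sq])
    fix t assume "0 \<le> t" "t \<le> norm A"
    then have "sqrt t \<le> sqrt (norm A)" by (intro real_sqrt_le_mono)
    then show "\<bar>sqrt t\<bar> \<le> norm T" using nA \<open>0 \<le> t\<close> by (simp add: abs_of_nonneg del: real_sqrt_le_iff)
  qed
  have q: "continuous_on {0..norm B} (\<lambda>t. t powr q)"
    using assms(2) by (intro continuous_on_powr') (auto intro!: continuous_intros)
  have "norm (cfc B (\<lambda>t. t powr q)) \<le> norm T powr q"
    by (rule norm_cfc_le[OF B Bpos q]) (use nB assms(2) in \<open>auto intro!: powr_mono2\<close>)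
  moreover have "cmod (trace (cfc B (\<lambda>t. t powr q))) \<le> norm (cfc B (\<lambda>t. t powr q))"
    unfolding trace_def using norm_cinner_le[of "ket 1" "cfc B (\<lambda>t. t powr q) (ket 1)"]
      norm_blinfun[of "cfc B (\<lambda>t. t powr q)" "ket 1"] by simp
  ultimately have le: "\<bar>Re (trace (cfc B (\<lambda>t. t powr q)))\<bar> \<le> norm T powr q"
    using abs_Re_le_cmod order_trans by meson
  \<comment> \<open>\<open>ln\<close> takes the same value at x and -x, so \<open>powr\<close> sees
    the trace only through its absolute value.\<close>
  have "Lq_norm q T = \<bar>Re (trace (cfc B (\<lambda>t. t powr q)))\<bar> powr (1 / q)"
    by (simp add: Lq_norm_def B_def powr_def ln_minus abs_if)
  moreover have "\<dots> \<le> (norm T powr q) powr (1 / q)"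
    using le assms(2) by (intro powr_mono2) auto
  moreover have "\<dots> = norm T" using assms(2) by (simp add: powr_powr)
  ultimately show "0 \<le> Lq_norm q T" "Lq_norm q T \<le> norm T" by simp_all
qed

section \<open>Cancellation in the free group\<close>

lemma reduced_word_of [simp]: "reduced (word_of g)"
  using word_of[of g] by simp

lemma word_of_mult: "word_of (g * h) = red_append (word_of g) (word_of h)"
  by (rule times_free_group.rep_eq)

lemma word_of_inverse: "word_of (inverse g) = inv_word (word_of g)"
  by (rule inverse_free_group.rep_eq)

lemma word_of_one: "word_of 1 = []"
  by (rule one_free_group.rep_eq)

lemma reduced_appendD:
  assumes "reduced (u @ v)" shows "reduced u" "reduced v"
  using assms by (auto simp: reduced_def successively_append_iff)

lemma red_append_reduced: "reduced (u @ v) \<Longrightarrow> red_append u v = u @ v"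
proof (induction u)
  case (Cons a u)
  then have "reduced (u @ v)" using reduced_tl by fastforce
  then have "red_append (a # u) v = red_cons a (u @ v)"
    using Cons.IH by (simp add: red_append_def)
  then show ?case using Cons.prems by (cases "u @ v") (auto simp: reduced_def)
qed (simp add: red_append_def)

lemma length_inv_word [simp]: "length (inv_word w) = length w"
  by (simp add: inv_word_def)

lemma inv_word_inv_word [simp]: "inv_word (inv_word w) = w"
  by (simp add: inv_word_def rev_map comp_def)

text \<open>Cancellation removes equal last letters of x and y, one pair after another, and stops as
  soon as the last letters differ or a word is used up.\<close>

lemma common_suffix:
  assumes "reduced x" "reduced y"
  shows "\<exists>s t r. x = s @ r \<and> y = t @ r \<and> (s = [] \<or> t = [] \<or> last s \<noteq> last t)
    \<and> red_append x (inv_word y) = s @ inv_word t"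
  using assms
proof (induction y arbitrary: x rule: rev_induct)
  case Nil
  then show ?case
    by (intro exI[of _ x] exI[of _ "[]"]) (simp add: inv_word_def red_append_Nil)
next
  case (snoc b y)
  show ?case
  proof (cases x rule: rev_cases)
    case Nil
    then show ?thesis
      by (intro exI[of _ "[]"] exI[of _ "y @ [b]"]) (simp add: red_append_def)
  next
    case x: (snoc x' a)
    have red: "reduced x'" "reduced y"
      using snoc.prems x reduced_appendD by blast+
    show ?thesis
    proof (cases "a = b")
      case True
      obtain s t r where str: "x' = s @ r" "y = t @ r" "s = [] \<or> t = [] \<or> last s \<noteq> last t"
          "red_append x' (inv_word y) = s @ inv_word t"
        using snoc.IH[OF red] by blast
      have "red_append x (inv_word (y @ [b])) = red_append x' (inv_word y)"
        by (simp add: x True inv_word_def red_append_def)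
      then show ?thesis
        using str x True by (intro exI[of _ s] exI[of _ t] exI[of _ "r @ [a]"]) auto
    next
      case False
      have "inv_letter b \<noteq> inv_letter a"
        using False by (metis inv_letter_inv_letter)
      \<comment> \<open>Different last letters do not cancel, so the concatenation is already
        reduced.\<close>
      then have "reduced (x @ inv_word (y @ [b]))"
        using snoc.prems(1) reduced_inv_word[OF snoc.prems(2)]
        by (auto simp: x reduced_def successively_append_iff inv_word_def)
      then have "red_append x (inv_word (y @ [b])) = x @ inv_word (y @ [b])"
        by (rule red_append_reduced)
      then show ?thesis
        using False x by (intro exI[of _ x] exI[of _ "y @ [b]"] exI[of _ "[]"]) auto
    qed
  qed
qed

text \<open>In the tree where a step towards the root removes the first letter, r is the vertex at
  which the geodesics from x and y to the root meet, and the length of the product is the distance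
  between x and y.\<close>

lemma mult_inverse_cancellation:
  fixes x y :: "'a free_group"
  obtains s t r where "word_of x = s @ r" "word_of y = t @ r"
    "s = [] \<or> t = [] \<or> last s \<noteq> last t" "word_of (x * inverse y) = s @ inv_word t"
    "word_length (x * inverse y) = length s + length t"
proof -
  obtain s t r where *: "word_of x = s @ r" "word_of y = t @ r"
    "s = [] \<or> t = [] \<or> last s \<noteq> last t" "word_of (x * inverse y) = s @ inv_word t"
    using common_suffix[OF reduced_word_of[of x] reduced_word_of[of y]]
    unfolding word_of_mult word_of_inverse by blast
  then show ?thesis using that by (simp add: word_length_def)
qed

definition ball_word :: "nat \<Rightarrow> F2 set" where
  "ball_word m = {g. word_length g \<le> m}"

lemma finite_ball_word [simp]: "finite (ball_word m)"
proof -
  have "word_of ` ball_word m \<subseteq> {w. set w \<subseteq> UNIV \<and> length w \<le> m}"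
    by (auto simp: ball_word_def word_length_def)
  then have "finite (word_of ` ball_word m)"
    by (rule finite_subset) (rule finite_lists_length_le, simp)
  moreover have "inj_on word_of (ball_word m)"
    by (meson injI inj_on_subset subset_UNIV word_of_inject)
  ultimately show ?thesis by (rule finite_imageD)
qed

lemma ball_word_mono: "m \<le> m' \<Longrightarrow> ball_word m \<subseteq> ball_word m'"
  by (auto simp: ball_word_def)

lemma word_length_inverse [simp]: "word_length (inverse g) = word_length g"
  by (simp add: word_length_def word_of_inverse)

lemma inverse_inverse_free_group [simp]: "inverse (inverse g) = (g :: 'a free_group)"
  by (simp add: word_of_inject[symmetric] word_of_inverse)

lemma word_length_one [simp]: "word_length 1 = 0"
  by (simp add: word_length_def word_of_one)

lemma word_length_mult: "word_length (g * h) \<le> word_length g + word_length h"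
proof -
  obtain s t r where "word_of g = s @ r" "word_of (inverse h) = t @ r"
    "word_length (g * inverse (inverse h)) = length s + length t"
    by (rule mult_inverse_cancellation[of g "inverse h"])
  then have "word_length (g * h) \<le> word_length g + word_length (inverse h)"
    unfolding word_length_def by simp
  then show ?thesis by simp
qed

lemma ex_word_length: "\<exists>g :: F2. word_length g = m"
proof -
  have "reduced (replicate m (True, True))"
    by (auto simp: reduced_def successively_conv_nth inv_letter_def)
  then show ?thesis
    by (intro exI[of _ "free_group_of (replicate m (True, True))"])
      (simp add: word_length_def free_group_of_inverse)
qed

section \<open>Convolution operators and Haagerup's inequality\<close>

lemma sum_fibre_le:
  fixes h :: "'b \<Rightarrow> real"
  assumes "finite F" "finite R" "\<And>x. x \<in> F \<Longrightarrow> h x \<ge> 0"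
  shows "(\<Sum>r\<in>R. \<Sum>x\<in>{x\<in>F. \<rho> x = r}. h x) \<le> (\<Sum>x\<in>F. h x)"
proof -
  have "(\<Sum>r\<in>R. \<Sum>x\<in>{x\<in>F. \<rho> x = r}. h x) \<le> (\<Sum>r\<in>R \<union> \<rho> ` F. \<Sum>x\<in>{x\<in>F. \<rho> x = r}. h x)"
    using assms by (intro sum_mono2 sum_nonneg) auto
  also have "\<dots> = (\<Sum>x\<in>F. h x)"
    using assms by (intro sum.group) auto
  finally show ?thesis .
qed

text \<open>Pairs (x, y) are sorted by the lengths (A, B) of their uncancelled parts, which gives at
  most (m + 1)^2 types. For one type and one common suffix r the product determines the pair, so
  Cauchy-Schwarz separates c from \<alpha> and \<beta>; a second Cauchy-Schwarz sums over r.\<close>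

lemma haagerup_form_le:
  fixes \<alpha> \<beta> c :: "F2 \<Rightarrow> real"
  assumes F: "finite F" and pos: "\<And>g. \<alpha> g \<ge> 0" "\<And>g. \<beta> g \<ge> 0" "\<And>g. c g \<ge> 0"
    and supp: "\<And>g. word_length g > m \<Longrightarrow> c g = 0"
  shows "(\<Sum>x\<in>F. \<Sum>y\<in>F. \<beta> x * c (x * inverse y) * \<alpha> y)
    \<le> (real m + 1)\<^sup>2 * L2_set c (ball_word m) * L2_set \<beta> F * L2_set \<alpha> F"
proof -
  define P where "P = (\<lambda>(A, B). {(x, y). x \<in> F \<and> y \<in> F \<and> (\<exists>s t r. word_of x = s @ r \<and> word_of y = t @ r
     \<and> length s = A \<and> length t = B \<and> word_of (x * inverse y) = s @ inv_word t
     \<and> word_length (x * inverse y) \<le> m)})"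
  define tm where "tm = (\<lambda>(x, y). \<beta> x * \<alpha> y * c (x * inverse y))"
  have tm0: "tm z \<ge> 0" for z
    using pos by (auto simp: tm_def split: prod.split)
  have finP: "finite (P AB)" for AB
    by (rule finite_subset[of _ "F \<times> F"]) (use F in \<open>auto simp: P_def\<close>)
  define I where "I = {..m} \<times> {..m}"
  have finI: "finite I" "card I = (m + 1)\<^sup>2" by (auto simp: I_def power2_eq_square)
  have one: "sum tm (P AB) \<le> L2_set c (ball_word m) * L2_set \<beta> F * L2_set \<alpha> F" for AB
  proof (cases AB)
    case (Pair A B)
    define \<rho> where "\<rho> = (\<lambda>A x. drop A (word_of (x :: F2)))"
    \<comment> \<open>For pairs of type (A, B) the common suffix can be read off from x
      alone.\<close>
    define R where "R = \<rho> A ` F"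
    define Pr where "Pr = (\<lambda>r. {z \<in> P AB. \<rho> A (fst z) = r})"
    define b where "b = (\<lambda>r. {x \<in> F. \<rho> A x = r})"
    define a where "a = (\<lambda>r. {y \<in> F. \<rho> B y = r})"
    have "sum tm (P AB) = (\<Sum>r\<in>R. sum tm (Pr r))"
      unfolding Pr_def using F by (intro sum.group[symmetric] finP) (auto simp: R_def P_def Pair)
    also have "\<dots> \<le> (\<Sum>r\<in>R. L2_set c (ball_word m) * (L2_set \<beta> (b r) * L2_set \<alpha> (a r)))"
    proof (rule sum_mono)
      fix r
      have finr: "finite (Pr r)" unfolding Pr_def using finP by simp
      \<comment> \<open>Cutting the product after A letters recovers s and t, and together with r
        they give back x and y.\<close>
      have inj: "inj_on (\<lambda>(x, y). x * inverse y) (Pr r)"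
      proof (rule inj_onI, clarify)
        fix x y x' y' assume z: "(x, y) \<in> Pr r" "(x', y') \<in> Pr r" "x * inverse y = x' * inverse y'"
        have dec: "\<exists>s t. word_of x = s @ r \<and> word_of y = t @ r \<and> length s = A
            \<and> word_of (x * inverse y) = s @ inv_word t" if xy: "(x, y) \<in> Pr r" for x y
        proof -
          obtain s t r' where "word_of x = s @ r'" "word_of y = t @ r'" "length s = A"
              "word_of (x * inverse y) = s @ inv_word t"
            using xy unfolding Pr_def P_def Pair by blast
          moreover have "drop A (word_of x) = r" using xy by (simp add: Pr_def \<rho>_def)
          ultimately show ?thesis by auto
        qed
        obtain s t where st: "word_of x = s @ r" "word_of y = t @ r" "length s = A"
            "word_of (x * inverse y) = s @ inv_word t"
          using dec[OF z(1)] by blast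
        obtain s' t' where st': "word_of x' = s' @ r" "word_of y' = t' @ r" "length s' = A"
            "word_of (x' * inverse y') = s' @ inv_word t'"
          using dec[OF z(2)] by blast
        have "s = s' \<and> inv_word t = inv_word t'"
          using st(3,4) st'(3,4) z(3) by simp
        then have "s = s'" "t = t'" by (metis inv_word_inv_word)+
        then show "x = x' \<and> y = y'"
          using st st' by (simp add: word_of_inject[symmetric])
      qed
      have "sum tm (Pr r) = (\<Sum>(x, y)\<in>Pr r. \<bar>\<beta> x * \<alpha> y\<bar> * \<bar>c (x * inverse y)\<bar>)"
        using pos by (intro sum.cong) (auto simp: tm_def)
      also have "\<dots> = (\<Sum>z\<in>Pr r. \<bar>\<beta> (fst z) * \<alpha> (snd z)\<bar> * \<bar>c (fst z * inverse (snd z))\<bar>)"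
        by (simp add: case_prod_beta)
      also have "\<dots> \<le> L2_set (\<lambda>z. \<beta> (fst z) * \<alpha> (snd z)) (Pr r) * L2_set (\<lambda>z. c (fst z * inverse (snd z))) (Pr r)"
        by (rule L2_set_mult_ineq)
      also have "\<dots> \<le> (L2_set \<beta> (b r) * L2_set \<alpha> (a r)) * L2_set c (ball_word m)"
      proof (rule mult_mono)
        have "(\<Sum>z\<in>Pr r. (\<beta> (fst z) * \<alpha> (snd z))\<^sup>2) \<le> (\<Sum>z\<in>b r \<times> a r. (\<beta> (fst z) * \<alpha> (snd z))\<^sup>2)"
          using F by (intro sum_mono2) (auto simp: Pr_def P_def Pair b_def a_def \<rho>_def)
        also have "\<dots> = (\<Sum>x\<in>b r. (\<beta> x)\<^sup>2) * (\<Sum>y\<in>a r. (\<alpha> y)\<^sup>2)"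
          by (simp add: sum_product sum.cartesian_product power_mult_distrib case_prod_beta)
        finally show "L2_set (\<lambda>z. \<beta> (fst z) * \<alpha> (snd z)) (Pr r) \<le> L2_set \<beta> (b r) * L2_set \<alpha> (a r)"
          by (simp add: L2_set_def real_sqrt_mult[symmetric])
        have "(\<Sum>z\<in>Pr r. (c (fst z * inverse (snd z)))\<^sup>2) = (\<Sum>g\<in>(\<lambda>(x, y). x * inverse y) ` Pr r. (c g)\<^sup>2)"
          by (subst sum.reindex[OF inj]) (simp add: case_prod_beta)
        also have "\<dots> \<le> (\<Sum>g\<in>ball_word m. (c g)\<^sup>2)"
          using finite_ball_word[of m] by (intro sum_mono2) (auto simp: Pr_def P_def Pair ball_word_def)
        finally show "L2_set (\<lambda>z. c (fst z * inverse (snd z))) (Pr r) \<le> L2_set c (ball_word m)"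
          by (simp add: L2_set_def)
      qed (auto intro!: mult_nonneg_nonneg)
      finally show "sum tm (Pr r) \<le> L2_set c (ball_word m) * (L2_set \<beta> (b r) * L2_set \<alpha> (a r))"
        by (simp add: mult.commute)
    qed
    also have "\<dots> = L2_set c (ball_word m) * (\<Sum>r\<in>R. \<bar>L2_set \<beta> (b r)\<bar> * \<bar>L2_set \<alpha> (a r)\<bar>)"
      by (simp add: sum_distrib_left)
    also have "\<dots> \<le> L2_set c (ball_word m) * (L2_set (\<lambda>r. L2_set \<beta> (b r)) R * L2_set (\<lambda>r. L2_set \<alpha> (a r)) R)"
      by (intro mult_left_mono L2_set_mult_ineq) auto
    also have "\<dots> \<le> L2_set c (ball_word m) * (L2_set \<beta> F * L2_set \<alpha> F)"
    proof (intro mult_left_mono mult_mono)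
      \<comment> \<open>Fibres over different r are disjoint, so their squared norms add up to at
        most that of F. The inequality also covers \<open>\<rho> B\<close>, some of whose fibres R
        may miss.\<close>
      have *: "L2_set (\<lambda>r. L2_set \<gamma> {x \<in> F. \<rho> D x = r}) R \<le> L2_set \<gamma> F" for \<gamma> D
        using sum_fibre_le[of F R "\<lambda>x. (\<gamma> x)\<^sup>2" "\<rho> D"] F
        by (simp add: L2_set_def sum_nonneg R_def)
      show "L2_set (\<lambda>r. L2_set \<beta> (b r)) R \<le> L2_set \<beta> F"
        and "L2_set (\<lambda>r. L2_set \<alpha> (a r)) R \<le> L2_set \<alpha> F"
        unfolding a_def b_def by (rule *)+
    qed auto
    finally show ?thesis by (simp add: mult.assoc)
  qed
  have "(\<Sum>x\<in>F. \<Sum>y\<in>F. \<beta> x * c (x * inverse y) * \<alpha> y) = sum tm (F \<times> F)"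
    by (simp add: sum.cartesian_product tm_def mult_ac)
  also have "\<dots> \<le> (\<Sum>z\<in>F \<times> F. \<Sum>AB\<in>I. if z \<in> P AB then tm z else 0)"
  proof (rule sum_mono)
    fix z assume z: "z \<in> F \<times> F"
    obtain x y where xy: "z = (x, y)" by (cases z)
    show "tm z \<le> (\<Sum>AB\<in>I. if z \<in> P AB then tm z else 0)"
    proof (cases "word_length (x * inverse y) \<le> m")
      case True
      obtain s t r where str: "word_of x = s @ r" "word_of y = t @ r"
          "word_of (x * inverse y) = s @ inv_word t" "word_length (x * inverse y) = length s + length t"
        by (rule mult_inverse_cancellation[of x y])
      define AB where "AB = (length s, length t)"
      have "AB \<in> I" "z \<in> P AB"
        using True str z unfolding AB_def I_def P_def xy by auto
      then show ?thesis
        using member_le_sum[of AB I "\<lambda>AB. if z \<in> P AB then tm z else 0"] tm0 finI by auto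
    next
      case False
      then have "tm z = 0" using supp by (simp add: xy tm_def)
      then show ?thesis using tm0 by (simp add: sum_nonneg)
    qed
  qed
  also have "\<dots> = (\<Sum>AB\<in>I. \<Sum>z\<in>F \<times> F. if z \<in> P AB then tm z else 0)"
    by (rule sum.swap)
  also have "\<dots> = (\<Sum>AB\<in>I. sum tm (P AB))"
  proof (rule sum.cong[OF refl])
    fix AB
    have "F \<times> F \<inter> P AB = P AB" by (auto simp: P_def)
    then show "(\<Sum>z\<in>F \<times> F. if z \<in> P AB then tm z else 0) = sum tm (P AB)"
      using sum.inter_restrict[of "F \<times> F" tm "P AB"] F by simp
  qed
  also have "\<dots> \<le> (\<Sum>AB\<in>I. L2_set c (ball_word m) * L2_set \<beta> F * L2_set \<alpha> F)"
    by (intro sum_mono one)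
  also have "\<dots> = (real m + 1)\<^sup>2 * L2_set c (ball_word m) * L2_set \<beta> F * L2_set \<alpha> F"
    using finI by (simp add: add.commute)
  finally show ?thesis .
qed

section \<open>Convolution operators\<close>

lemma scaleC_op_simps:
  "scaleC_op (c + d) T = scaleC_op c T + scaleC_op d T"
  "scaleC_op c (T + S) = scaleC_op c T + scaleC_op c S"
  "scaleC_op 0 T = 0" "scaleC_op c 0 = 0" "scaleC_op 1 T = T"
  "scaleC_op c (scaleC_op d T) = scaleC_op (c * d) T"
  "r *\<^sub>R scaleC_op c T = scaleC_op (of_real r * c) T"
  by (rule blinfun_eqI, rule ell2_eqI, simp add: scaleC_op_apply blinfun.add_left blinfun.scaleR_left
      coord_simps algebra_simps)+

definition symbol :: "F2 op \<Rightarrow> F2 \<Rightarrow> complex" where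
  "symbol T g = coord (T (ket 1)) g"

text \<open>These are the left convolution operators, that is, the operators commuting with right
  translations. Unlike a finite expansion, this property survives norm limits.\<close>

definition toeplitz :: "F2 op \<Rightarrow> bool" where
  "toeplitz T \<longleftrightarrow> clin T \<and> (\<forall>x y. coord (T (ket y)) x = symbol T (x * inverse y))"

text \<open>The square of \<open>norm (T (ket 1))\<close> is the trace of the adjoint of T composed
  with T, so this is what converts a trace moment into an operator norm bound.\<close>

lemma haagerup_norm_le:
  assumes T: "toeplitz T" and supp: "\<And>g. word_length g > m \<Longrightarrow> symbol T g = 0"
  shows "norm T \<le> (real m + 1)\<^sup>2 * norm (T (ket 1))"
proof (rule norm_le_matrix_form)
  show "clin T" using T by (simp add: toeplitz_def)
  fix F :: "F2 set" and a b :: "F2 \<Rightarrow> complex"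
  assume F: "finite F"
  have "cmod (\<Sum>x\<in>F. \<Sum>y\<in>F. cnj (b x) * coord (T (ket y)) x * a y)
      \<le> (\<Sum>x\<in>F. \<Sum>y\<in>F. cmod (b x) * cmod (symbol T (x * inverse y)) * cmod (a y))"
    using T unfolding toeplitz_def
    by (auto intro!: sum_norm_le simp: norm_mult)
  also have "\<dots> \<le> (real m + 1)\<^sup>2 * L2_set (\<lambda>g. cmod (symbol T g)) (ball_word m)
      * L2_set (\<lambda>x. cmod (b x)) F * L2_set (\<lambda>y. cmod (a y)) F"
    by (rule haagerup_form_le[OF F]) (auto simp: supp)
  also have "L2_set (\<lambda>g. cmod (symbol T g)) (ball_word m) \<le> norm (T (ket 1))"
    unfolding L2_set_def symbol_def
    by (rule real_le_lsqrt) (auto simp: sum_coord_le_norm sum_nonneg)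
  finally show "cmod (\<Sum>x\<in>F. \<Sum>y\<in>F. cnj (b x) * coord (T (ket y)) x * a y)
      \<le> (real m + 1)\<^sup>2 * norm (T (ket 1)) * sqrt (\<Sum>x\<in>F. (cmod (b x))\<^sup>2) * sqrt (\<Sum>x\<in>F. (cmod (a x))\<^sup>2)"
    by (simp add: L2_set_def mult_right_mono mult_left_mono sum_nonneg)
qed simp

definition lincomb :: "F2 set \<Rightarrow> (F2 \<Rightarrow> complex) \<Rightarrow> F2 op" where
  "lincomb S c = (\<Sum>g\<in>S. scaleC_op (c g) (lam g))"

lemma coord_lam: "coord (lam g x) h = coord x (inverse g * h)"
  by (simp add: lam.rep_eq coord_left_translate)

lemma coord_lincomb: "coord (lincomb S c x) h = (\<Sum>g\<in>S. c g * coord x (inverse g * h))"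
  by (simp add: lincomb_def blinfun.sum_left coord_sum scaleC_op_apply coord_simps coord_lam)

lemma symbol_lincomb:
  assumes "finite S" shows "symbol (lincomb S c) h = (if h \<in> S then c h else 0)"
proof -
  have "inverse g * h = 1 \<longleftrightarrow> h = g" for g
    by (metis free_group_left_inverse mult.right_neutral mult_inverse_cancel)
  then show ?thesis
    using assms by (simp add: symbol_def coord_lincomb ket.rep_eq if_distrib cong: if_cong)
qed

lemma toeplitz_lincomb: "toeplitz (lincomb S c)"
proof -
  have clin: "clin (lincomb S c)"
    unfolding clin_def
    by (intro allI ell2_eqI) (simp add: coord_lincomb coord_simps sum_distrib_left mult.left_commute)
  have iff: "inverse g * x = y \<longleftrightarrow> inverse g * (x * inverse y) = 1" for g x y :: F2
  proof
    assume "inverse g * (x * inverse y) = 1"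
    then have "inverse g * x * (inverse y * y) = y" by (metis mult.assoc mult_1_left)
    then show "inverse g * x = y" by (simp add: free_group_left_inverse)
  qed (simp add: free_group_right_inverse flip: mult.assoc)
  have "coord (lincomb S c (ket y)) x = symbol (lincomb S c) (x * inverse y)" for x y
    unfolding symbol_def coord_lincomb ket.rep_eq iff[of _ x y] ..
  then show ?thesis using clin by (simp add: toeplitz_def)
qed

lemma toeplitz_add: "toeplitz S \<Longrightarrow> toeplitz T \<Longrightarrow> toeplitz (S + T)"
  by (auto simp: toeplitz_def clin_def symbol_def blinfun.add_left coord_simps scaleC_add)

lemma toeplitz_diff: "toeplitz S \<Longrightarrow> toeplitz T \<Longrightarrow> toeplitz (S - T)"
  by (auto simp: toeplitz_def clin_def symbol_def blinfun.diff_left coord_simps scaleC_diff)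

lemma symbol_diff: "symbol (S - T) g = symbol S g - symbol T g"
  by (simp add: symbol_def blinfun.diff_left coord_simps)

lemma tendsto_coord: "(X \<longlongrightarrow> x) F \<Longrightarrow> ((\<lambda>n. coord (X n) g) \<longlongrightarrow> coord x g) F"
  using tendsto_cinner_right[of X x F "ket g"] by (simp add: cinner_ket)

lemma toeplitz_limit:
  assumes "\<And>n. toeplitz (X n)" "X \<longlonglongrightarrow> T"
  shows "toeplitz T"
proof -
  have lim: "(\<lambda>n. X n x) \<longlonglongrightarrow> T x" for x
    by (intro blinfun.tendsto assms(2) tendsto_const)
  have "clin T"
    unfolding clin_def
  proof (intro allI)
    fix c x
    have "(\<lambda>n. scaleC c (X n x)) \<longlonglongrightarrow> scaleC c (T x)"
      by (rule bounded_linear.tendsto[OF bounded_linear_scaleC lim])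
    moreover have "(\<lambda>n. X n (scaleC c x)) \<longlonglongrightarrow> T (scaleC c x)" by (rule lim)
    ultimately show "T (scaleC c x) = scaleC c (T x)"
      using assms(1) by (simp add: toeplitz_def clin_def LIMSEQ_unique)
  qed
  moreover have "coord (T (ket y)) x = symbol T (x * inverse y)" for x y
  proof -
    have "(\<lambda>n. coord (X n (ket y)) x) \<longlonglongrightarrow> coord (T (ket y)) x"
      by (intro tendsto_coord lim)
    moreover have "(\<lambda>n. symbol (X n) (x * inverse y)) \<longlonglongrightarrow> symbol T (x * inverse y)"
      unfolding symbol_def by (intro tendsto_coord lim)
    ultimately show ?thesis
      using assms(1) by (simp add: toeplitz_def LIMSEQ_unique)
  qed
  ultimately show ?thesis by (simp add: toeplitz_def)
qed

section \<open>Adjoints and Fourier coefficients\<close>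

lemma adj_pair_lam: "adj_pair (lam (inverse g)) (lam g)"
  unfolding adj_pair_def
proof (intro allI)
  fix x y
  have "cinner (lam (inverse g) x) y = (\<Sum>\<^sub>\<infinity>h. cnj (coord x (g * h)) * coord y h)"
    by (simp add: cinner.rep_eq coord_lam)
  also have "\<dots> = (\<Sum>\<^sub>\<infinity>h. cnj (coord x (g * h)) * coord y (inverse g * (g * h)))"
    by (simp add: inverse_mult_cancel)
  also have "\<dots> = (\<Sum>\<^sub>\<infinity>k. cnj (coord x k) * coord y (inverse g * k))"
    by (rule infsum_reindex_bij_betw[OF bij_left_mult])
  finally show "cinner (lam (inverse g) x) y = cinner x (lam g y)"
    by (simp add: cinner.rep_eq coord_lam)
qed

text \<open>All Fourier coefficients are thus coordinates of the single vector
  \<open>f (ket 1)\<close>, which gives their square summability.\<close>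

lemma fourier_eq_symbol: "fourier f g = symbol f g"
  by (simp add: fourier_def trace_def adj_eqI[OF adj_pair_lam] cinner_ket coord_lam symbol_def)

lemma adj_pair_lincomb:
  "adj_pair (\<Sum>g\<in>S. scaleC_op (cnj (c g)) (lam (inverse g))) (lincomb S c)"
  using adj_pair_lam
  by (simp add: adj_pair_def lincomb_def blinfun.sum_left cinner_sum_left cinner_sum_right
      scaleC_op_apply cinner_scaleC_left cinner_scaleC_right)

lemma adj_pair_diff: "adj_pair S T \<Longrightarrow> adj_pair S' T' \<Longrightarrow> adj_pair (S - S') (T - T')"
  by (simp add: adj_pair_def blinfun.diff_left cinner_diff_left cinner_diff_right)

text \<open>Passing to the adjoint does not increase norms, so the adjoints of a convergent sequence
  form a Cauchy sequence.\<close>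

lemma adj_pair_limit:
  assumes "\<And>n. adj_pair (S n) (X n)" "X \<longlonglongrightarrow> T"
  shows "\<exists>S'. adj_pair S' T"
proof -
  have "Cauchy S"
  proof (rule CauchyI)
    fix e :: real assume "e > 0"
    then obtain M where M: "\<And>m n. m \<ge> M \<Longrightarrow> n \<ge> M \<Longrightarrow> norm (X m - X n) < e"
      using CauchyD[OF LIMSEQ_imp_Cauchy[OF assms(2)]] by blast
    have "norm (S m - S n) \<le> norm (X m - X n)" for m n
      by (intro adj_pair_norm_le adj_pair_diff assms)
    then show "\<exists>M. \<forall>m\<ge>M. \<forall>n\<ge>M. norm (S m - S n) < e" using M le_less_trans by blast
  qed
  then obtain S' where S': "S \<longlonglongrightarrow> S'" using Cauchy_convergent_iff convergent_def by blast
  have "cinner (S' x) y = cinner x (T y)" for x y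
  proof -
    have "(\<lambda>n. cinner (S n x) y) \<longlonglongrightarrow> cinner (S' x) y"
      by (intro tendsto_cinner_left blinfun.tendsto S' tendsto_const)
    moreover have "(\<lambda>n. cinner x (X n y)) \<longlonglongrightarrow> cinner x (T y)"
      by (intro tendsto_cinner_right blinfun.tendsto assms tendsto_const)
    ultimately show ?thesis
      using assms(1) by (simp add: adj_pair_def LIMSEQ_unique)
  qed
  then show ?thesis unfolding adj_pair_def by blast
qed

section \<open>Approximation in the reduced C*-algebra\<close>

lemma lincomb_extend:
  assumes "finite S" "finite S'" "S \<subseteq> S'"
  shows "lincomb S c = lincomb S' (\<lambda>g. if g \<in> S then c g else 0)"
  unfolding lincomb_def
  by (rule sum.mono_neutral_cong_left) (use assms in \<open>auto simp: scaleC_op_simps\<close>)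

text \<open>Balls are used because the smooth cut-off reproduces every combination supported in a
  small enough ball.\<close>

lemma reduced_cstar_approx:
  assumes "f \<in> reduced_cstar" "e > 0"
  obtains R c where "norm (f - lincomb (ball_word R) c) < e"
proof -
  obtain S c where S: "finite S" "norm (f - lincomb S c) < e"
    using assms unfolding reduced_cstar_def closure_approachable lincomb_def dist_norm
    by (auto simp: norm_minus_commute)
  define R where "R = (\<Sum>g\<in>S. word_length g)"
  have "S \<subseteq> ball_word R"
    using S(1) by (auto simp: ball_word_def R_def intro: member_le_sum)
  then show ?thesis
    using that S lincomb_extend[of S "ball_word R" c] by simp
qed

lemma reduced_cstar_toeplitz:
  assumes "f \<in> reduced_cstar"
  shows "toeplitz f" "\<exists>S. adj_pair S f"
proof -
  obtain X where X: "\<And>n. X n \<in> {\<Sum>g\<in>S. scaleC_op (c g) (lam g) | S c. finite S}" "X \<longlonglongrightarrow> f"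
    using assms unfolding reduced_cstar_def closure_sequential by blast
  have "\<exists>S c. X n = lincomb S c" for n using X(1)[of n] by (auto simp: lincomb_def)
  then obtain S c where Sc: "\<And>n. X n = lincomb (S n) (c n)" by metis
  show "toeplitz f" by (rule toeplitz_limit[OF _ X(2)]) (simp add: Sc toeplitz_lincomb)
  show "\<exists>S. adj_pair S f"
    by (rule adj_pair_limit[OF _ X(2)]) (simp add: Sc, rule adj_pair_lincomb)
qed

section \<open>Bounded radial multipliers\<close>

text \<open>
  The vertices of the geodesic from \<open>x\<close> to the root \<open>1\<close> of the Cayley tree, prolonged by an infinite
  ray attached to the root.  For \<open>i > word_length x\<close> the first component is empty and the second,
  a truncated difference, is the position on the ray.
\<close>

definition node :: "F2 \<Rightarrow> nat \<Rightarrow> bool letter list \<times> nat" where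
  "node x i = (drop i (word_of x), i - word_length x)"

text \<open>Two prolonged geodesics are disjoint before their meeting point and run together from
  there on, so positions of common vertices differ by a constant offset.\<close>

lemma node_eq_iff:
  assumes x: "word_of x = s @ r" and y: "word_of y = t @ r"
    and st: "s = [] \<or> t = [] \<or> last s \<noteq> last t"
  shows "node x i = node y j \<longleftrightarrow> (\<exists>k. i = length s + k \<and> j = length t + k)"
proof
  assume "\<exists>k. i = length s + k \<and> j = length t + k"
  then show "node x i = node y j"
    by (auto simp: node_def word_length_def x y)
next
  assume eq: "node x i = node y j"
  have lx: "word_length x = length s + length r" and ly: "word_length y = length t + length r"
    by (simp_all add: word_length_def x y)
  have d: "drop i (s @ r) = drop j (t @ r)" and m: "i - (length s + length r) = j - (length t + length r)"
    using eq by (auto simp: node_def x y lx ly)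
  have len: "length s + length r - i = length t + length r - j"
    using arg_cong[OF d, of length] by simp
  \<comment> \<open>Truncated differences in both directions together fix the integer
    difference.\<close>
  have ij: "int i - int (length s) = int j - int (length t)" using len m by linarith
  have "i \<ge> length s"
  proof (rule ccontr)
    assume "\<not> i \<ge> length s"
    then have i: "i < length s" and j: "j < length t" using ij by auto
    then have "drop i s = drop j t" using d by simp
    then have "last s = last t" using i j by (metis last_drop)
    then show False using st i j by auto
  qed
  then show "\<exists>k. i = length s + k \<and> j = length t + k"
    using ij by (intro exI[of _ "i - length s"]) auto
qed

lemma inj_node: "inj (node x)"
  using node_eq_iff[of x "[]" "word_of x" x "[]"] by (auto simp: inj_def)

text \<open>
  The windows \<open>[\<sigma>, \<sigma> + w)\<close> on the geodesic from \<open>x\<close> and \<open>[N - \<sigma>, N - \<sigma> + w)\<close> on that from \<open>y\<close> are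
  compared for all \<open>\<sigma>\<close>.  Since the geodesics merge, the total number of common vertices depends only
  on \<open>d = |x y\<^sup>-\<^sup>1|\<close>; with \<open>u\<close> and \<open>v\<close> the offsets inside the two windows it is the following count, which
  is constant for \<open>d \<le> N\<close> and 0 for \<open>d \<ge> N + 2 w\<close>.
\<close>

definition radial_count :: "nat \<Rightarrow> nat \<Rightarrow> nat \<Rightarrow> nat" where
  "radial_count N w d = card {(u, v). u < w \<and> v < w \<and> d \<le> u + v + N \<and> even (u + v + N + d)}"

text \<open>The start \<sigma> may be negative; indices below 0 are cut off.\<close>

definition window :: "nat \<Rightarrow> int \<Rightarrow> nat set" where
  "window w \<sigma> = {i. \<sigma> \<le> int i \<and> int i < \<sigma> + int w}"

lemma finite_window [simp]: "finite (window w \<sigma>)"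
  and card_window_le: "card (window w \<sigma>) \<le> w"
proof -
  have sub: "window w \<sigma> \<subseteq> nat ` {\<sigma>..<\<sigma> + int w}"
  proof
    fix i assume "i \<in> window w \<sigma>"
    then have "i = nat (int i)" "int i \<in> {\<sigma>..<\<sigma> + int w}" by (auto simp: window_def)
    then show "i \<in> nat ` {\<sigma>..<\<sigma> + int w}" by blast
  qed
  show "finite (window w \<sigma>)" by (rule finite_subset[OF sub]) simp
  have "card (window w \<sigma>) \<le> card (nat ` {\<sigma>..<\<sigma> + int w})"
    by (rule card_mono[OF _ sub]) simp
  also have "\<dots> \<le> w"
    using card_image_le[of "{\<sigma>..<\<sigma> + int w}" nat] by simp
  finally show "card (window w \<sigma>) \<le> w" .
qed

text \<open>A common vertex k steps beyond the meeting point has window offsets u, v with A + k =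
  \<sigma> + u and B + k = N - \<sigma> + v. Adding gives A + B + 2k = N + u + v, so (u, v)
  determines k and then \<sigma>; that k is a natural number is exactly the inequality and the
  parity condition in the count.\<close>

lemma radial_count_windows:
  "(\<Sum>\<sigma>\<in>{1 - int w..<int N + int w}. card (node x ` window w \<sigma> \<inter> node y ` window w (int N - \<sigma>)))
    = radial_count N w (word_length (x * inverse y))" (is "?lhs = _")
proof -
  obtain s t r where str: "word_of x = s @ r" "word_of y = t @ r"
    "s = [] \<or> t = [] \<or> last s \<noteq> last t"
    and d: "word_length (x * inverse y) = length s + length t"
    by (rule mult_inverse_cancellation[of x y])
  note iff = node_eq_iff[OF str]
  define A B where "A = length s" and "B = length t"
  \<comment> \<open>Outside this range of \<sigma> one of the two windows lies entirely below
    0.\<close>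
  define S where "S = {1 - int w..<int N + int w}"
  define C where "C = (\<lambda>\<sigma>. node x ` window w \<sigma> \<inter> node y ` window w (int N - \<sigma>))"
  define U where "U = {(u, v). u < w \<and> v < w \<and> A + B \<le> u + v + N \<and> even (u + v + N + (A + B))}"
  define k where "k = (\<lambda>(u, v). (u + v + N - (A + B)) div 2)"
  define f where "f = (\<lambda>(u, v). (int A + int (k (u, v)) - int u, node x (A + k (u, v))))"
  have kU: "A + B + 2 * k (u, v) = u + v + N" if "(u, v) \<in> U" for u v
  proof -
    have "even (u + v + N - (A + B))" using that by (auto simp: U_def)
    then show ?thesis using that by (auto simp: U_def k_def)
  qed
  have "bij_betw f U (Sigma S C)"
    unfolding bij_betw_def
  proof
    show "inj_on f U"
    proof (rule inj_onI, clarify)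
      fix u v u' v' assume uv: "(u, v) \<in> U" "(u', v') \<in> U" "f (u, v) = f (u', v')"
      then have kk: "k (u, v) = k (u', v')"
        using injD[OF inj_node] by (fastforce simp: f_def)
      then have "u = u'" using uv(3) by (simp add: f_def)
      moreover have "u + v = u' + v'"
        using kU[OF uv(1)] kU[OF uv(2)] unfolding kk by linarith
      ultimately show "u = u' \<and> v = v'" by simp
    qed
    show "f ` U = Sigma S C"
    proof (intro equalityI subsetI)
      fix z assume "z \<in> f ` U"
      then obtain u v where uv: "(u, v) \<in> U" and z: "z = f (u, v)" by auto
      define K where "K = k (u, v)"
      have K: "A + B + 2 * K = u + v + N" using kU[OF uv] by (simp add: K_def)
      have uw: "u < w" "v < w" using uv by (auto simp: U_def)
      define \<sigma> where "\<sigma> = int A + int K - int u"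
      have "\<sigma> \<in> S" using K uw by (auto simp: S_def \<sigma>_def)
      moreover have "A + K \<in> window w \<sigma>" using uw by (auto simp: window_def \<sigma>_def)
      moreover have "B + K \<in> window w (int N - \<sigma>)" using uw K by (auto simp: window_def \<sigma>_def)
      moreover have "node x (A + K) = node y (B + K)"
        unfolding iff A_def B_def by blast
      ultimately have "\<sigma> \<in> S \<and> node x (A + K) \<in> C \<sigma>" unfolding C_def by (metis IntI imageI)
      then show "z \<in> Sigma S C"
        unfolding z f_def by (simp flip: K_def \<sigma>_def)
    next
      fix z assume "z \<in> Sigma S C"
      then obtain \<sigma> i j where z: "z = (\<sigma>, node x i)" "node x i = node y j" "\<sigma> \<in> S"
          "i \<in> window w \<sigma>" "j \<in> window w (int N - \<sigma>)"
      proof -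
        obtain \<sigma> \<nu> where z: "z = (\<sigma>, \<nu>)" "\<sigma> \<in> S" "\<nu> \<in> C \<sigma>" using \<open>z \<in> Sigma S C\<close> by (rule SigmaE)
        then obtain i j where "\<nu> = node x i" "i \<in> window w \<sigma>" "\<nu> = node y j" "j \<in> window w (int N - \<sigma>)"
          unfolding C_def by (elim IntE imageE)
        then show thesis using that[of \<sigma> i j] z by metis
      qed
      then obtain K where K: "i = A + K" "j = B + K" unfolding iff A_def B_def by blast
      define u v where "u = nat (int i - \<sigma>)" and "v = nat (int j - (int N - \<sigma>))"
      have u: "int u = int i - \<sigma>" "u < w" and v: "int v = int j - (int N - \<sigma>)" "v < w"
        using z(4,5) by (auto simp: u_def v_def window_def)
      have sum: "u + v + N = A + B + 2 * K" using u v K by linarith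
      then have "even (u + v + N + (A + B))" by presburger
      then have "(u, v) \<in> U" unfolding U_def using u(2) v(2) sum by (simp del: even_add)
      moreover have "k (u, v) = K" using sum by (simp add: k_def)
      then have "f (u, v) = z" using u K by (simp add: f_def z)
      ultimately show "z \<in> f ` U" by (metis imageI)
    qed
  qed
  then have "card (Sigma S C) = card U" by (simp add: bij_betw_same_card)
  moreover have "card (Sigma S C) = ?lhs"
    by (subst card_SigmaI) (auto simp: S_def C_def)
  ultimately show ?thesis by (simp add: U_def radial_count_def d A_def B_def)
qed

text \<open>The count is a sum over \<sigma> of inner products of indicator vectors with at most w
  ones. Multiplying matrix entries by one such inner product costs at most a factor w, because the
  indicators can be absorbed into the test vectors, and at most N + 2w values of \<sigma>
  occur.\<close>

lemma schur_form_le: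
  fixes T :: "F2 op"
  assumes T: "clin T" and F: "finite F"
  shows "cmod (\<Sum>x\<in>F. \<Sum>y\<in>F. cnj (b x) * (of_nat (radial_count N w (word_length (x * inverse y))) * coord (T (ket y)) x) * a y)
    \<le> norm T * (real (N + 2 * w) * real w) * sqrt (\<Sum>x\<in>F. (cmod (b x))\<^sup>2) * sqrt (\<Sum>x\<in>F. (cmod (a x))\<^sup>2)"
    (is "cmod ?form \<le> _")
proof -
  define S where "S = {1 - int w..<int N + int w}"
  define V where "V = (\<Union>x\<in>F. \<Union>\<sigma>\<in>S. node x ` window w \<sigma>)"
  have V: "finite V" using F by (simp add: V_def S_def)
  define p where "p = (\<lambda>\<sigma> x \<nu>. if \<nu> \<in> node x ` window w \<sigma> then 1 else 0 :: complex)"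
  have cnt: "of_nat (radial_count N w (word_length (x * inverse y)))
      = (\<Sum>\<sigma>\<in>S. \<Sum>\<nu>\<in>V. p \<sigma> x \<nu> * p (int N - \<sigma>) y \<nu>)" if "x \<in> F" for x y
  proof -
    have "of_nat (card (node x ` window w \<sigma> \<inter> node y ` window w (int N - \<sigma>)))
        = (\<Sum>\<nu>\<in>V. p \<sigma> x \<nu> * p (int N - \<sigma>) y \<nu>)" if "\<sigma> \<in> S" for \<sigma>
    proof -
      have "node x ` window w \<sigma> \<inter> node y ` window w (int N - \<sigma>)
          = {\<nu> \<in> V. \<nu> \<in> node x ` window w \<sigma> \<and> \<nu> \<in> node y ` window w (int N - \<sigma>)}"
        using that \<open>x \<in> F\<close> by (auto simp: V_def)
      then have "of_nat (card (node x ` window w \<sigma> \<inter> node y ` window w (int N - \<sigma>)))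
          = (\<Sum>\<nu>\<in>V. if \<nu> \<in> node x ` window w \<sigma> \<and> \<nu> \<in> node y ` window w (int N - \<sigma>) then 1 else 0 :: complex)"
        using V by (simp add: sum.If_cases Int_def)
      also have "\<dots> = (\<Sum>\<nu>\<in>V. p \<sigma> x \<nu> * p (int N - \<sigma>) y \<nu>)"
        by (rule sum.cong) (auto simp: p_def)
      finally show ?thesis .
    qed
    then show ?thesis
      unfolding radial_count_windows[symmetric] S_def[symmetric] of_nat_sum by (intro sum.cong) auto
  qed
  define q where "q = (\<lambda>\<sigma> \<nu>. \<Sum>x\<in>F. \<Sum>y\<in>F. cnj (p \<sigma> x \<nu> * b x) * coord (T (ket y)) x * (p (int N - \<sigma>) y \<nu> * a y))"
  have "?form = (\<Sum>x\<in>F. \<Sum>y\<in>F. \<Sum>\<sigma>\<in>S. \<Sum>\<nu>\<in>V.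
      cnj (p \<sigma> x \<nu> * b x) * coord (T (ket y)) x * (p (int N - \<sigma>) y \<nu> * a y))"
  proof (intro sum.cong refl)
    fix x y assume x: "x \<in> F"
    have "cnj (p \<sigma> x \<nu>) = p \<sigma> x \<nu>" for \<sigma> \<nu> by (simp add: p_def)
    then show "cnj (b x) * (of_nat (radial_count N w (word_length (x * inverse y))) * coord (T (ket y)) x) * a y
      = (\<Sum>\<sigma>\<in>S. \<Sum>\<nu>\<in>V. cnj (p \<sigma> x \<nu> * b x) * coord (T (ket y)) x * (p (int N - \<sigma>) y \<nu> * a y))"
      unfolding cnt[OF x] by (simp add: sum_distrib_left sum_distrib_right mult_ac)
  qed
  also have "\<dots> = (\<Sum>x\<in>F. \<Sum>\<sigma>\<in>S. \<Sum>y\<in>F. \<Sum>\<nu>\<in>V.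
      cnj (p \<sigma> x \<nu> * b x) * coord (T (ket y)) x * (p (int N - \<sigma>) y \<nu> * a y))"
    by (intro sum.cong refl sum.swap)
  also have "\<dots> = (\<Sum>\<sigma>\<in>S. \<Sum>x\<in>F. \<Sum>y\<in>F. \<Sum>\<nu>\<in>V.
      cnj (p \<sigma> x \<nu> * b x) * coord (T (ket y)) x * (p (int N - \<sigma>) y \<nu> * a y))"
    by (rule sum.swap)
  also have "\<dots> = (\<Sum>\<sigma>\<in>S. \<Sum>x\<in>F. \<Sum>\<nu>\<in>V. \<Sum>y\<in>F.
      cnj (p \<sigma> x \<nu> * b x) * coord (T (ket y)) x * (p (int N - \<sigma>) y \<nu> * a y))"
    by (intro sum.cong refl sum.swap)
  also have "\<dots> = (\<Sum>\<sigma>\<in>S. \<Sum>\<nu>\<in>V. q \<sigma> \<nu>)"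
    unfolding q_def by (intro sum.cong refl sum.swap)
  finally have form: "?form = (\<Sum>\<sigma>\<in>S. \<Sum>\<nu>\<in>V. q \<sigma> \<nu>)" .
  define e where "e = (\<lambda>(c :: F2 \<Rightarrow> complex) \<sigma> \<nu>. sqrt (\<Sum>x\<in>F. (cmod (p \<sigma> x \<nu> * c x))\<^sup>2))"
  have q_le: "cmod (q \<sigma> \<nu>) \<le> norm T * (e b \<sigma> \<nu> * e a (int N - \<sigma>) \<nu>)" for \<sigma> \<nu>
    using matrix_form_le_norm[OF T F, of "\<lambda>x. p \<sigma> x \<nu> * b x" "\<lambda>y. p (int N - \<sigma>) y \<nu> * a y"]
    by (simp add: q_def e_def mult.assoc)
  have e0: "e c \<sigma> \<nu> \<ge> 0" for c \<sigma> \<nu> by (simp add: e_def sum_nonneg)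
  \<comment> \<open>Each x meets at most w vertices \<nu> in its window, so the sum over \<nu> of
    the squares costs a factor w.\<close>
  have e_le: "L2_set (e c \<sigma>) V \<le> sqrt (real w) * sqrt (\<Sum>x\<in>F. (cmod (c x))\<^sup>2)" for c \<sigma>
  proof -
    have "(\<Sum>\<nu>\<in>V. (e c \<sigma> \<nu>)\<^sup>2) = (\<Sum>\<nu>\<in>V. \<Sum>x\<in>F. (cmod (p \<sigma> x \<nu> * c x))\<^sup>2)"
      by (simp add: e_def sum_nonneg)
    also have "\<dots> = (\<Sum>x\<in>F. \<Sum>\<nu>\<in>V. (cmod (p \<sigma> x \<nu> * c x))\<^sup>2)" by (rule sum.swap)
    also have "\<dots> \<le> (\<Sum>x\<in>F. real w * (cmod (c x))\<^sup>2)"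
    proof (rule sum_mono)
      fix x
      have "(\<Sum>\<nu>\<in>V. (cmod (p \<sigma> x \<nu> * c x))\<^sup>2)
          = (\<Sum>\<nu>\<in>V. if \<nu> \<in> node x ` window w \<sigma> then (cmod (c x))\<^sup>2 else 0)"
        by (rule sum.cong) (auto simp: p_def)
      also have "\<dots> = real (card (V \<inter> node x ` window w \<sigma>)) * (cmod (c x))\<^sup>2"
        using V by (simp add: sum.If_cases)
      also have "card (V \<inter> node x ` window w \<sigma>) \<le> card (node x ` window w \<sigma>)"
        by (intro card_mono) auto
      also have "\<dots> \<le> w"
        using card_image_le[OF finite_window] card_window_le order_trans by blast
      finally show "(\<Sum>\<nu>\<in>V. (cmod (p \<sigma> x \<nu> * c x))\<^sup>2) \<le> real w * (cmod (c x))\<^sup>2"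
        by (simp add: mult_right_mono)
    qed
    finally show ?thesis
      by (simp add: L2_set_def real_sqrt_mult[symmetric] sum_distrib_left)
  qed
  define M where "M = norm T * (real w * (sqrt (\<Sum>x\<in>F. (cmod (b x))\<^sup>2) * sqrt (\<Sum>x\<in>F. (cmod (a x))\<^sup>2)))"
  have M0: "M \<ge> 0" by (simp add: M_def sum_nonneg)
  have "cmod (\<Sum>\<nu>\<in>V. q \<sigma> \<nu>) \<le> M" for \<sigma>
  proof -
    have "cmod (\<Sum>\<nu>\<in>V. q \<sigma> \<nu>) \<le> (\<Sum>\<nu>\<in>V. norm T * (e b \<sigma> \<nu> * e a (int N - \<sigma>) \<nu>))"
      by (rule sum_norm_le) (rule q_le)
    also have "\<dots> = norm T * (\<Sum>\<nu>\<in>V. \<bar>e b \<sigma> \<nu>\<bar> * \<bar>e a (int N - \<sigma>) \<nu>\<bar>)"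
      using e0 by (simp add: sum_distrib_left)
    also have "\<dots> \<le> norm T * (L2_set (e b \<sigma>) V * L2_set (e a (int N - \<sigma>)) V)"
      by (intro mult_left_mono L2_set_mult_ineq) auto
    also have "\<dots> \<le> norm T * ((sqrt (real w) * sqrt (\<Sum>x\<in>F. (cmod (b x))\<^sup>2)) * (sqrt (real w) * sqrt (\<Sum>x\<in>F. (cmod (a x))\<^sup>2)))"
      by (intro mult_left_mono mult_mono e_le) (auto simp: sum_nonneg)
    also have "\<dots> = M" by (simp add: M_def mult_ac)
    finally show ?thesis .
  qed
  then have "cmod ?form \<le> (\<Sum>\<sigma>\<in>S. M)"
    unfolding form by (intro sum_norm_le)
  also have "\<dots> = real (card S) * M" by simp
  also have "\<dots> \<le> real (N + 2 * w) * M"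
    using M0 by (intro mult_right_mono) (auto simp: S_def)
  also have "\<dots> = norm T * (real (N + 2 * w) * real w) * sqrt (\<Sum>x\<in>F. (cmod (b x))\<^sup>2) * sqrt (\<Sum>x\<in>F. (cmod (a x))\<^sup>2)"
    by (simp add: M_def mult_ac)
  finally show ?thesis .
qed

section \<open>Values of the radial weights\<close>

lemma card_even_shift: "card {v. v < 2 * m \<and> even (v + c)} = m"
proof (induction m)
  case (Suc m)
  have lt: "v < 2 * Suc m \<longleftrightarrow> v < 2 * m \<or> v = 2 * m \<or> v = 2 * m + 1" for v by auto
  define v0 where "v0 = (if even c then 2 * m else 2 * m + 1)"
  have "{v. v < 2 * Suc m \<and> even (v + c)} = insert v0 {v. v < 2 * m \<and> even (v + c)}"
    unfolding lt v0_def by (cases "even c") auto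
  then show ?case using Suc by (simp add: v0_def)
qed simp

lemma card_even_square: "card {(u, v). u < 2 * m \<and> v < 2 * m \<and> even (u + v + c)} = 2 * m * m"
proof -
  have "{(u, v). u < 2 * m \<and> v < 2 * m \<and> even (u + v + c)}
      = Sigma {..<2 * m} (\<lambda>u. {v. v < 2 * m \<and> even (v + (u + c))})"
    by (auto simp: ac_simps)
  then show ?thesis by (simp only: card_SigmaI finite_lessThan card_even_shift) (simp add: card_even_shift del: even_add)
qed

text \<open>An even window width makes both parities occur equally often, so the count is the same
  for even and odd d.\<close>

lemma radial_count_inside: "d \<le> N \<Longrightarrow> radial_count N (2 * m) d = 2 * m * m"
proof -
  assume "d \<le> N"
  then have "{(u, v). u < 2 * m \<and> v < 2 * m \<and> d \<le> u + v + N \<and> even (u + v + N + d)}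
      = {(u, v). u < 2 * m \<and> v < 2 * m \<and> even (u + v + (N + d))}"
    by (auto simp: add.assoc)
  then show ?thesis unfolding radial_count_def by (simp only: card_even_square)
qed

lemma radial_count_le: "radial_count N (2 * m) d \<le> 2 * m * m"
proof -
  have "radial_count N (2 * m) d \<le> card {(u, v). u < 2 * m \<and> v < 2 * m \<and> even (u + v + (N + d))}"
    unfolding radial_count_def
    by (rule card_mono, rule finite_subset[of _ "{..<2*m} \<times> {..<2*m}"]) (auto simp: add.assoc)
  then show ?thesis by (simp only: card_even_square)
qed

lemma radial_count_outside:
  assumes "d \<ge> N + 2 * w" shows "radial_count N w d = 0"
proof -
  have "{(u, v). u < w \<and> v < w \<and> d \<le> u + v + N \<and> even (u + v + N + d)} = {}"
    using assms by auto
  then show ?thesis unfolding radial_count_def by (simp only: card.empty)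
qed

text \<open>An analogue of the de la Vallee Poussin kernel. Here N = 2^p and w = 2^(p-1), so N + 2w
  = 2^(p+1), and the full value 2^(2p-3) is a power of two, which makes the normalised weights
  dyadic.\<close>

definition vp_weight :: "nat \<Rightarrow> nat \<Rightarrow> nat" where
  "vp_weight p d = radial_count (2 ^ p) (2 ^ (p - 1)) d"

definition vp_op :: "nat \<Rightarrow> F2 op \<Rightarrow> F2 op" where
  "vp_op p T = lincomb (ball_word (2 ^ (p + 1)))
     (\<lambda>g. of_real (real (vp_weight p (word_length g)) / 2 ^ (2 * p - 3)) * symbol T g)"

lemma vp_weight:
  assumes "p \<ge> 2"
  shows "d \<le> 2 ^ p \<Longrightarrow> vp_weight p d = 2 ^ (2 * p - 3)"
    and "vp_weight p d \<le> 2 ^ (2 * p - 3)"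
    and "d > 2 ^ (p + 1) \<Longrightarrow> vp_weight p d = 0"
proof -
  \<comment> \<open>The assumption on p makes the window width 2^(p-1) even.\<close>
  obtain k where k: "p = k + 2" using assms by (metis add.commute le_Suc_ex)
  have e: "2 ^ (p - 1) = 2 * 2 ^ k" "2 ^ (2 * p - 3) = 2 * 2 ^ k * (2 ^ k :: nat)"
    by (simp_all add: k power_add[symmetric] mult_2[symmetric] flip: power_Suc)
  show "d \<le> 2 ^ p \<Longrightarrow> vp_weight p d = 2 ^ (2 * p - 3)"
    unfolding vp_weight_def e by (rule radial_count_inside)
  show "vp_weight p d \<le> 2 ^ (2 * p - 3)"
    unfolding vp_weight_def e by (rule radial_count_le)
  show "vp_weight p d = 0" if "d > 2 ^ (p + 1)"
    unfolding vp_weight_def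
  proof (rule radial_count_outside)
    have "(2 :: nat) ^ p + 2 * 2 ^ (p - 1) = 2 ^ (p + 1)" by (simp add: k)
    then show "2 ^ p + 2 * 2 ^ (p - 1) \<le> d" using that by linarith
  qed
qed

lemma norm_vp_op_le:
  assumes p: "p \<ge> 2" and T: "toeplitz T"
  shows "norm (vp_op p T) \<le> 8 * norm T"
proof (rule norm_le_matrix_form)
  show "clin (vp_op p T)"
    using toeplitz_lincomb unfolding vp_op_def toeplitz_def by blast
  fix F :: "F2 set" and a b :: "F2 \<Rightarrow> complex"
  assume F: "finite F"
  define N w :: nat where "N = 2 ^ p" and "w = 2 ^ (p - 1)"
  define D :: real where "D = 2 ^ (2 * p - 3)"
  obtain k where k: "p = k + 2" using p by (metis add.commute le_Suc_ex)
  define q :: real where "q = 2 ^ k"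
  have e: "2 * p - 3 = Suc (k + k)" using k by simp
  have "D = 2 * (q * q)" unfolding D_def q_def e by (simp only: power_Suc power_add)
  moreover have "real N = 4 * q" "real w = 2 * q" "q > 0" by (simp_all add: N_def w_def q_def k)
  ultimately have DNw: "D = 2 * (q * q)" "real N = 4 * q" "real w = 2 * q" "q > 0" by auto
  \<comment> \<open>With q = 2^k the quotient is 8q times 2q, divided by 2 q^2.\<close>
  have D: "D > 0" "real (N + 2 * w) * real w / D = 8"
    using DNw(4) by (simp_all add: DNw(1-3))
  define \<Phi> where "\<Phi> = (\<lambda>x y :: F2. radial_count N w (word_length (x * inverse y)))"
  have coord: "coord (vp_op p T (ket y)) x = of_real (1 / D) * (of_nat (\<Phi> x y) * coord (T (ket y)) x)" for x y
  proof -
    have "coord (vp_op p T (ket y)) x = symbol (vp_op p T) (x * inverse y)"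
      using toeplitz_lincomb unfolding vp_op_def toeplitz_def by blast
    also have "\<dots> = of_real (real (vp_weight p (word_length (x * inverse y))) / 2 ^ (2 * p - 3)) * symbol T (x * inverse y)"
      using vp_weight(3)[OF p, of "word_length (x * inverse y)"]
      unfolding vp_op_def symbol_lincomb[OF finite_ball_word] by (simp add: ball_word_def not_le)
    also have "symbol T (x * inverse y) = coord (T (ket y)) x"
      using T by (simp add: toeplitz_def)
    finally show ?thesis by (simp add: vp_weight_def D_def \<Phi>_def N_def w_def)
  qed
  have "(\<Sum>x\<in>F. \<Sum>y\<in>F. cnj (b x) * coord (vp_op p T (ket y)) x * a y)
      = of_real (1 / D) * (\<Sum>x\<in>F. \<Sum>y\<in>F. cnj (b x) * (of_nat (\<Phi> x y) * coord (T (ket y)) x) * a y)"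
    unfolding coord by (simp add: sum_distrib_left mult_ac)
  then have "cmod (\<Sum>x\<in>F. \<Sum>y\<in>F. cnj (b x) * coord (vp_op p T (ket y)) x * a y)
      = (1 / D) * cmod (\<Sum>x\<in>F. \<Sum>y\<in>F. cnj (b x) * (of_nat (\<Phi> x y) * coord (T (ket y)) x) * a y)"
    using D(1) by (simp add: norm_mult norm_divide)
  also have "\<dots> \<le> (1 / D) * (norm T * (real (N + 2 * w) * real w) * sqrt (\<Sum>x\<in>F. (cmod (b x))\<^sup>2) * sqrt (\<Sum>x\<in>F. (cmod (a x))\<^sup>2))"
    unfolding \<Phi>_def using T F D(1) by (intro mult_left_mono schur_form_le) (auto simp: toeplitz_def)
  also have "\<dots> = (real (N + 2 * w) * real w / D) * norm T * sqrt (\<Sum>x\<in>F. (cmod (b x))\<^sup>2) * sqrt (\<Sum>x\<in>F. (cmod (a x))\<^sup>2)"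
    by simp
  finally show "cmod (\<Sum>x\<in>F. \<Sum>y\<in>F. cnj (b x) * coord (vp_op p T (ket y)) x * a y)
      \<le> 8 * norm T * sqrt (\<Sum>x\<in>F. (cmod (b x))\<^sup>2) * sqrt (\<Sum>x\<in>F. (cmod (a x))\<^sup>2)"
    unfolding D(2) .
qed simp

text \<open>Reproduction on balls together with the uniform norm bound makes the cut-offs of f
  converge to f.\<close>

lemma vp_op_lincomb:
  assumes p: "p \<ge> 2" and R: "R \<le> 2 ^ p"
  shows "vp_op p (lincomb (ball_word R) c) = lincomb (ball_word R) c"
proof -
  have sub: "ball_word R \<subseteq> ball_word (2 ^ (p + 1))" using R by (intro ball_word_mono) simp
  have "vp_op p (lincomb (ball_word R) c) = lincomb (ball_word (2 ^ (p + 1))) (\<lambda>g. if g \<in> ball_word R then c g else 0)"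
    unfolding vp_op_def
  proof (rule arg_cong[where f = "lincomb _"], rule ext)
    fix g
    have "vp_weight p (word_length g) = 2 ^ (2 * p - 3)" if "g \<in> ball_word R"
      using that R by (intro vp_weight(1)[OF p]) (simp add: ball_word_def)
    then show "of_real (real (vp_weight p (word_length g)) / 2 ^ (2 * p - 3)) * symbol (lincomb (ball_word R) c) g
        = (if g \<in> ball_word R then c g else 0)"
      by (simp add: symbol_lincomb)
  qed
  also have "\<dots> = lincomb (ball_word R) c"
    by (rule lincomb_extend[symmetric]) (use sub in auto)
  finally show ?thesis .
qed

lemma vp_op_diff: "vp_op p (S - T) = vp_op p S - vp_op p T"
  by (rule blinfun_eqI, rule ell2_eqI)
    (simp add: vp_op_def coord_lincomb blinfun.diff_left coord_simps symbol_diff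
      right_diff_distrib left_diff_distrib sum_subtractf diff_divide_distrib)

section \<open>Rounding dyadic weights\<close>

text \<open>Signs on the odd numerators clear the last binary digit at a cost of \<open>D / 2\<^sup>K\<close>.\<close>

lemma dyadic_rounding:
  fixes v :: "'i \<Rightarrow> 'a::real_normed_vector"
  assumes A: "finite A"
    and signs: "\<And>B. B \<subseteq> A \<Longrightarrow> \<exists>e. (\<forall>i\<in>B. e i = 1 \<or> e i = -1) \<and> norm (\<Sum>i\<in>B. e i *\<^sub>R v i) \<le> D"
    and m: "\<And>i. i \<in> A \<Longrightarrow> m i \<le> (2::nat) ^ K"
  shows "\<exists>\<xi>. (\<forall>i\<in>A. \<xi> i = 0 \<or> \<xi> i = 1) \<and>
    norm (\<Sum>i\<in>A. (\<xi> i - real (m i) / 2 ^ K) *\<^sub>R v i) \<le> D * (1 - 1 / 2 ^ K)"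
  using m
proof (induction K arbitrary: m)
  case 0
  then have "real (m i) = 0 \<or> real (m i) = 1" if "i \<in> A" for i
    using that by (fastforce simp: le_Suc_eq)
  then show ?case by (intro exI[of _ "\<lambda>i. real (m i)"]) auto
next
  case (Suc K)
  define B where "B = {i \<in> A. odd (m i)}"
  have BA: "B \<subseteq> A" by (auto simp: B_def)
  obtain e where e: "\<And>i. i \<in> B \<Longrightarrow> e i = 1 \<or> e i = -1" and eD: "norm (\<Sum>i\<in>B. e i *\<^sub>R v i) \<le> D"
    using signs[OF BA] by blast
  \<comment> \<open>This is (m + e) / 2 in natural numbers: odd numerators are rounded up or down
    according to the sign, even ones are halved.\<close>
  define m' where "m' = (\<lambda>i. if i \<in> B then (if e i = 1 then (m i + 1) div 2 else (m i - 1) div 2) else m i div 2)"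
  have m': "real (m' i) = (real (m i) + (if i \<in> B then e i else 0)) / 2" if i: "i \<in> A" for i
  proof (cases "odd (m i)")
    case True
    then have "i \<in> B" using i by (simp add: B_def)
    moreover obtain n where "m i = 2 * n + 1" using True by (rule oddE)
    ultimately show ?thesis using e[of i] by (auto simp: m'_def)
  next
    case False
    then have "i \<notin> B" by (simp add: B_def)
    then show ?thesis using False by (auto simp: m'_def elim!: evenE)
  qed
  have "m' i \<le> 2 ^ K" if i: "i \<in> A" for i
  proof -
    have "real (m i) + (if i \<in> B then e i else 0) \<le> 2 ^ Suc K"
    proof (cases "i \<in> B")
      case True
      \<comment> \<open>The bound is even and \<open>m i\<close> is odd, so there is room for
        rounding up.\<close>
      then have "m i \<noteq> 2 ^ Suc K" by (auto simp: B_def)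
      then have "m i + 1 \<le> 2 ^ Suc K" using Suc.prems[OF i] by simp
      then have "real (m i + 1) \<le> real (2 ^ Suc K)" by (simp only: of_nat_le_iff)
      then show ?thesis using e[OF True] True by auto
    next
      case False
      have "real (m i) \<le> real (2 ^ Suc K)" using Suc.prems[OF i] by (simp only: of_nat_le_iff)
      then show ?thesis using False by simp
    qed
    then have "real (m' i) \<le> real (2 ^ K)" by (simp add: m'[OF i])
    then show ?thesis by (simp only: of_nat_le_iff)
  qed
  from Suc.IH[of m', OF this] obtain \<xi> where \<xi>: "\<And>i. i \<in> A \<Longrightarrow> \<xi> i = 0 \<or> \<xi> i = 1"
    and nrm: "norm (\<Sum>i\<in>A. (\<xi> i - real (m' i) / 2 ^ K) *\<^sub>R v i) \<le> D * (1 - 1 / 2 ^ K)" by blast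
  have "(\<Sum>i\<in>A. (\<xi> i - real (m i) / 2 ^ Suc K) *\<^sub>R v i)
      = (\<Sum>i\<in>A. (\<xi> i - real (m' i) / 2 ^ K) *\<^sub>R v i + (if i \<in> B then (1 / 2 ^ Suc K) *\<^sub>R e i *\<^sub>R v i else 0))"
    by (rule sum.cong[OF refl]) (simp add: m' scaleR_add_left[symmetric] field_simps)
  also have "\<dots> = (\<Sum>i\<in>A. (\<xi> i - real (m' i) / 2 ^ K) *\<^sub>R v i) + (1 / 2 ^ Suc K) *\<^sub>R (\<Sum>i\<in>B. e i *\<^sub>R v i)"
    using A BA by (simp add: sum.distrib scaleR_sum_right sum.If_cases Int_absorb1)
  finally have "norm (\<Sum>i\<in>A. (\<xi> i - real (m i) / 2 ^ Suc K) *\<^sub>R v i)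
      \<le> norm (\<Sum>i\<in>A. (\<xi> i - real (m' i) / 2 ^ K) *\<^sub>R v i)
        + norm ((1 / 2 ^ Suc K) *\<^sub>R (\<Sum>i\<in>B. e i *\<^sub>R v i))"
    by (simp only: norm_triangle_ineq)
  also note nrm
  also have "norm ((1 / 2 ^ Suc K) *\<^sub>R (\<Sum>i\<in>B. e i *\<^sub>R v i)) \<le> (1 / 2 ^ Suc K) * D"
    using eD by (simp add: divide_right_mono)
  finally show ?case using \<xi> by (intro exI[of _ \<xi>]) (auto simp: field_simps)
qed

section \<open>Random signs\<close>

definition signs :: "'i set \<Rightarrow> ('i \<Rightarrow> real) set" where
  "signs B = PiE B (\<lambda>_. {-1, 1})"

lemma finite_signs [simp]: "finite B \<Longrightarrow> finite (signs B)"
  by (simp add: signs_def finite_PiE)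

lemma card_signs: "finite B \<Longrightarrow> card (signs B) = 2 ^ card B"
  by (simp add: signs_def card_PiE numeral_2_eq_2)

text \<open>The sum factorises over B, and each factor is 2 for an even exponent and 0 for an odd
  one.\<close>

lemma sum_signs_monomial_nonneg:
  assumes "finite B"
  shows "0 \<le> (\<Sum>\<epsilon>\<in>signs B. \<Prod>g\<in>B. \<epsilon> g ^ k g)"
proof -
  have "(\<Sum>\<epsilon>\<in>signs B. \<Prod>g\<in>B. \<epsilon> g ^ k g) = (\<Prod>g\<in>B. \<Sum>y\<in>{-1, 1}. y ^ k g)"
    unfolding signs_def by (rule prod_sum_PiE[symmetric]) (use assms in auto)
  also have "\<dots> \<ge> 0"
    by (rule prod_nonneg) (auto simp: minus_one_power_iff)
  finally show ?thesis .
qed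

lemma monomial_mult:
  assumes "finite B" "g \<in> B"
  shows "(\<Prod>h\<in>B. \<epsilon> h ^ k h) * \<epsilon> g = (\<Prod>h\<in>B. \<epsilon> h ^ (k(g := Suc (k g))) h :: real)"
proof -
  have "(\<Prod>h\<in>B. \<epsilon> h ^ (k(g := Suc (k g))) h) = (\<Prod>h\<in>B. \<epsilon> h ^ k h * (if h = g then \<epsilon> g else 1))"
    by (rule prod.cong) auto
  then show ?thesis using assms by (simp add: prod.distrib)
qed

text \<open>
  All Walsh coefficients of the coordinates of \<open>Z\<close> are bounded by those of the \<open>L\<close>-th power of the
  scalar Rademacher sum; quantifying over all monomials makes this stable under one more factor.
\<close>

definition dominated :: "F2 set \<Rightarrow> (F2 \<Rightarrow> real) \<Rightarrow> nat \<Rightarrow> ((F2 \<Rightarrow> real) \<Rightarrow> F2 ell2) \<Rightarrow> bool" where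
  "dominated B a L Z \<longleftrightarrow> (\<forall>k x.
     cmod (\<Sum>\<epsilon>\<in>signs B. of_real (\<Prod>g\<in>B. \<epsilon> g ^ k g) * coord (Z \<epsilon>) x)
       \<le> (\<Sum>\<epsilon>\<in>signs B. (\<Prod>g\<in>B. \<epsilon> g ^ k g) * (\<Sum>g\<in>B. \<epsilon> g * a g) ^ L))"

lemma dominated_ket:
  assumes "finite B" shows "dominated B a 0 (\<lambda>_. ket h)"
  unfolding dominated_def
proof (intro allI)
  fix k x
  have "cmod (\<Sum>\<epsilon>\<in>signs B. of_real (\<Prod>g\<in>B. \<epsilon> g ^ k g) * coord (ket h) x)
      = cmod (of_real (\<Sum>\<epsilon>\<in>signs B. \<Prod>g\<in>B. \<epsilon> g ^ k g) * coord (ket h) x)"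
    by (simp only: sum_distrib_right of_real_sum)
  also have "\<dots> \<le> \<bar>\<Sum>\<epsilon>\<in>signs B. \<Prod>g\<in>B. \<epsilon> g ^ k g\<bar>"
    by (simp add: ket.rep_eq norm_mult del: of_real_sum)
  also have "\<dots> = (\<Sum>\<epsilon>\<in>signs B. \<Prod>g\<in>B. \<epsilon> g ^ k g)"
    using sum_signs_monomial_nonneg[OF assms] by simp
  finally show "cmod (\<Sum>\<epsilon>\<in>signs B. of_real (\<Prod>g\<in>B. \<epsilon> g ^ k g) * coord (ket h) x)
      \<le> (\<Sum>\<epsilon>\<in>signs B. (\<Prod>g\<in>B. \<epsilon> g ^ k g) * (\<Sum>g\<in>B. \<epsilon> g * a g) ^ 0)"
    by simp
qed

text \<open>A translation only permutes coordinates, the sign raises one exponent of the monomial,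
  and the coefficient has modulus \<open>a g\<close>. The map \<sigma> is arbitrary so that the step
  covers both an operator and its adjoint.\<close>

lemma dominated_step:
  assumes B: "finite B" and Z: "dominated B a L Z" and d: "\<And>g. g \<in> B \<Longrightarrow> cmod (d g) = a g"
  shows "dominated B a (Suc L) (\<lambda>\<epsilon>. (\<Sum>g\<in>B. scaleC_op (of_real (\<epsilon> g) * d g) (lam (\<sigma> g))) (Z \<epsilon>))"
  unfolding dominated_def
proof (intro allI)
  fix k x
  let ?m = "\<lambda>k \<epsilon>. \<Prod>g\<in>B. \<epsilon> g ^ k g :: real"
  let ?S = "\<lambda>\<epsilon>. \<Sum>g\<in>B. \<epsilon> g * a g"
  have mult: "complex_of_real (?m k \<epsilon>) * (of_real (\<epsilon> g) * w) = of_real (?m (k(g := Suc (k g))) \<epsilon>) * w"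
    if "g \<in> B" for \<epsilon> g w
    using monomial_mult[OF B that, of \<epsilon> k] by (simp only: of_real_mult[symmetric] mult.assoc[symmetric])
  have "(\<Sum>\<epsilon>\<in>signs B. of_real (?m k \<epsilon>) * coord ((\<Sum>g\<in>B. scaleC_op (of_real (\<epsilon> g) * d g) (lam (\<sigma> g))) (Z \<epsilon>)) x)
      = (\<Sum>\<epsilon>\<in>signs B. \<Sum>g\<in>B. of_real (?m k \<epsilon>) * (of_real (\<epsilon> g) * (d g * coord (Z \<epsilon>) (inverse (\<sigma> g) * x))))"
    by (simp add: blinfun.sum_left coord_sum scaleC_op_apply coord_simps coord_lam sum_distrib_left mult.assoc del: of_real_prod)
  also have "\<dots> = (\<Sum>\<epsilon>\<in>signs B. \<Sum>g\<in>B. of_real (?m (k(g := Suc (k g))) \<epsilon>) * (d g * coord (Z \<epsilon>) (inverse (\<sigma> g) * x)))"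
    by (intro sum.cong refl mult)
  also have "\<dots> = (\<Sum>g\<in>B. \<Sum>\<epsilon>\<in>signs B. of_real (?m (k(g := Suc (k g))) \<epsilon>) * (d g * coord (Z \<epsilon>) (inverse (\<sigma> g) * x)))"
    by (rule sum.swap)
  also have "\<dots> = (\<Sum>g\<in>B. d g * (\<Sum>\<epsilon>\<in>signs B. of_real (?m (k(g := Suc (k g))) \<epsilon>) * coord (Z \<epsilon>) (inverse (\<sigma> g) * x)))"
    by (simp only: sum_distrib_left mult.left_commute)
  also have "cmod \<dots> \<le> (\<Sum>g\<in>B. a g * (\<Sum>\<epsilon>\<in>signs B. ?m (k(g := Suc (k g))) \<epsilon> * ?S \<epsilon> ^ L))"
  proof (rule sum_norm_le)
    fix g assume g: "g \<in> B"
    have "cmod (\<Sum>\<epsilon>\<in>signs B. of_real (?m (k(g := Suc (k g))) \<epsilon>) * coord (Z \<epsilon>) (inverse (\<sigma> g) * x))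
        \<le> (\<Sum>\<epsilon>\<in>signs B. ?m (k(g := Suc (k g))) \<epsilon> * ?S \<epsilon> ^ L)"
      using Z unfolding dominated_def by blast
    then show "cmod (d g * (\<Sum>\<epsilon>\<in>signs B. of_real (?m (k(g := Suc (k g))) \<epsilon>) * coord (Z \<epsilon>) (inverse (\<sigma> g) * x)))
        \<le> a g * (\<Sum>\<epsilon>\<in>signs B. ?m (k(g := Suc (k g))) \<epsilon> * ?S \<epsilon> ^ L)"
      unfolding norm_mult d[OF g] by (rule mult_left_mono) (simp flip: d[OF g])
  qed
  also have "\<dots> = (\<Sum>g\<in>B. \<Sum>\<epsilon>\<in>signs B. ?m k \<epsilon> * (\<epsilon> g * a g * ?S \<epsilon> ^ L))"
    unfolding sum_distrib_left
  proof (intro sum.cong refl)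
    fix g \<epsilon> assume "g \<in> B"
    from monomial_mult[OF B this, of \<epsilon> k]
    show "a g * (?m (k(g := Suc (k g))) \<epsilon> * ?S \<epsilon> ^ L) = ?m k \<epsilon> * (\<epsilon> g * a g * ?S \<epsilon> ^ L)"
      by (simp only: mult_ac flip: monomial_mult[OF B \<open>g \<in> B\<close>])
  qed
  also have "\<dots> = (\<Sum>\<epsilon>\<in>signs B. \<Sum>g\<in>B. ?m k \<epsilon> * (\<epsilon> g * a g * ?S \<epsilon> ^ L))"
    by (rule sum.swap)
  also have "\<dots> = (\<Sum>\<epsilon>\<in>signs B. ?m k \<epsilon> * ?S \<epsilon> ^ Suc L)"
    by (simp only: power_Suc sum_distrib_right sum_distrib_left mult.assoc)
  finally show "cmod (\<Sum>\<epsilon>\<in>signs B. of_real (?m k \<epsilon>) * coord ((\<Sum>g\<in>B. scaleC_op (of_real (\<epsilon> g) * d g) (lam (\<sigma> g))) (Z \<epsilon>)) x)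
      \<le> (\<Sum>\<epsilon>\<in>signs B. ?m k \<epsilon> * ?S \<epsilon> ^ Suc L)" .
qed

section \<open>Khintchine's moment inequality\<close>

lemma exp_add_exp_minus_le: "exp x + exp (- x) \<le> 2 * exp (x\<^sup>2)" for x :: real
proof -
  have *: "exp t + exp (- t) \<le> 2 * exp (t\<^sup>2)" if t: "t \<ge> 0" for t :: real
  proof (cases "t \<le> 1")
    case True
    have "exp t \<le> 1 + t + t\<^sup>2" using t True by (rule exp_bound)
    moreover have "exp (- t) \<le> 1 - t + t\<^sup>2"
    proof -
      \<comment> \<open>The product equals 1 + t^3.\<close>
      have "1 \<le> (1 - t + t\<^sup>2) * (1 + t)"
        using t by (simp add: algebra_simps power2_eq_square)
      also have "\<dots> \<le> (1 - t + t\<^sup>2) * exp t"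
        using True t by (intro mult_left_mono exp_ge_add_one_self) auto
      finally show ?thesis by (simp add: exp_minus field_simps)
    qed
    moreover have "1 + t\<^sup>2 \<le> exp (t\<^sup>2)" by (rule exp_ge_add_one_self)
    ultimately show ?thesis by linarith
  next
    case False
    then have "t \<le> t\<^sup>2" "- t \<le> t\<^sup>2" by (auto simp: power2_eq_square intro: order_trans[of _ 0])
    then have "exp t \<le> exp (t\<^sup>2)" "exp (- t) \<le> exp (t\<^sup>2)" by simp_all
    then show ?thesis by linarith
  qed
  show ?thesis using *[of x] *[of "- x"] by (cases "x \<ge> 0") (auto simp: add.commute)
qed

lemma power_le_fact_exp:
  fixes t :: real assumes "t \<ge> 0" shows "t ^ n \<le> fact n * exp t"
proof -
  have "(\<Sum>i\<in>{n}. t ^ i /\<^sub>R fact i) \<le> (\<Sum>i. t ^ i /\<^sub>R fact i)"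
    using assms by (intro sum_le_suminf summable_exp_generic) auto
  then have "t ^ n / fact n \<le> exp t"
    by (simp add: exp_def divide_inverse mult.commute)
  then show ?thesis by (simp add: field_simps)
qed

lemma sum_signs_exp_le:
  assumes "finite B"
  shows "(\<Sum>\<epsilon>\<in>signs B. exp (\<Sum>g\<in>B. \<epsilon> g * a g)) \<le> 2 ^ card B * exp (\<Sum>g\<in>B. (a g)\<^sup>2 :: real)"
proof -
  have "(\<Sum>\<epsilon>\<in>signs B. exp (\<Sum>g\<in>B. \<epsilon> g * a g)) = (\<Sum>\<epsilon>\<in>signs B. \<Prod>g\<in>B. exp (\<epsilon> g * a g))"
    by (simp add: exp_sum assms)
  also have "\<dots> = (\<Prod>g\<in>B. \<Sum>y\<in>{-1, 1}. exp (y * a g))"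
    unfolding signs_def by (rule prod_sum_PiE[symmetric]) (use assms in auto)
  also have "\<dots> \<le> (\<Prod>g\<in>B. 2 * exp ((a g)\<^sup>2))"
    using exp_add_exp_minus_le by (intro prod_mono) (auto simp: add.commute)
  also have "\<dots> = 2 ^ card B * exp (\<Sum>g\<in>B. (a g)\<^sup>2)"
    by (simp add: prod.distrib exp_sum assms)
  finally show ?thesis .
qed

text \<open>Even moments come from exponential ones: a power is at most a factorial times the
  exponential, and the mean of the exponential factorises over the signs.\<close>

lemma khintchine_moment:
  assumes B: "finite B" and s: "(\<Sum>g\<in>B. (a g)\<^sup>2) = s\<^sup>2" "s > 0" and N: "N > 0"
  shows "(\<Sum>\<epsilon>\<in>signs B. (\<Sum>g\<in>B. \<epsilon> g * a g) ^ (4 * N)) \<le> 2 ^ card B * 2 * (36 * real N * s\<^sup>2) ^ (2 * N)"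
proof -
  \<comment> \<open>With z^2 s^2 = 4N the exponential factor is exp (4N), at most 9^(2N), and
    division by z^(4N) leaves (4N)^(2N) of the factorial bound; 36 is 4 times 9.\<close>
  define z where "z = sqrt (4 * real N) / s"
  have z: "z > 0" "z\<^sup>2 * s\<^sup>2 = 4 * real N"
    using s N by (simp_all add: z_def power_divide)
  let ?S = "\<lambda>\<epsilon>. \<Sum>g\<in>B. \<epsilon> g * a g"
  have one: "z ^ (4 * N) * ?S \<epsilon> ^ (4 * N) \<le> fact (4 * N) * (exp (\<Sum>g\<in>B. \<epsilon> g * (z * a g)) + exp (\<Sum>g\<in>B. \<epsilon> g * (- z * a g)))" for \<epsilon>
  proof -
    have "z ^ (4 * N) * ?S \<epsilon> ^ (4 * N) = \<bar>z * ?S \<epsilon>\<bar> ^ (4 * N)"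
      by (subst power_even_abs) (simp_all add: power_mult_distrib)
    also have "\<dots> \<le> fact (4 * N) * exp \<bar>z * ?S \<epsilon>\<bar>" by (rule power_le_fact_exp) simp
    also have "exp \<bar>z * ?S \<epsilon>\<bar> \<le> exp (z * ?S \<epsilon>) + exp (- z * ?S \<epsilon>)"
      by (cases "z * ?S \<epsilon> \<ge> 0") auto
    finally show ?thesis by (simp add: sum_distrib_left mult_ac)
  qed
  have "z ^ (4 * N) * (\<Sum>\<epsilon>\<in>signs B. ?S \<epsilon> ^ (4 * N))
      \<le> fact (4 * N) * ((\<Sum>\<epsilon>\<in>signs B. exp (\<Sum>g\<in>B. \<epsilon> g * (z * a g))) + (\<Sum>\<epsilon>\<in>signs B. exp (\<Sum>g\<in>B. \<epsilon> g * (- z * a g))))"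
    unfolding sum_distrib_left sum.distrib[symmetric]
    by (rule sum_mono) (rule one)
  also have "\<dots> \<le> fact (4 * N) * (2 ^ card B * exp (\<Sum>g\<in>B. (z * a g)\<^sup>2) + 2 ^ card B * exp (\<Sum>g\<in>B. (- z * a g)\<^sup>2))"
    by (intro mult_left_mono add_mono sum_signs_exp_le B) auto
  also have "\<dots> = fact (4 * N) * (2 ^ card B * 2 * exp (4 * real N))"
    by (simp add: power_mult_distrib sum_distrib_left[symmetric] s z)
  also have "\<dots> \<le> (4 * real N) ^ (4 * N) * (2 ^ card B * 2 * 9 ^ (2 * N))"
  proof (intro mult_mono)
    have "fact (4 * N) \<le> real ((4 * N) ^ (4 * N))" by (rule fact_le_power)
    then show "fact (4 * N) \<le> (4 * real N) ^ (4 * N)" by simp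
    have "exp (4 * real N) = (exp 1)\<^sup>2 ^ (2 * N)"
      by (simp flip: power_mult exp_of_nat_mult)
    also have "\<dots> \<le> 9 ^ (2 * N)"
    proof (rule power_mono)
      show "(exp 1)\<^sup>2 \<le> (9::real)"
        using power_mono[OF exp_le, of 2] by simp
    qed simp
    finally show "exp (4 * real N) \<le> 9 ^ (2 * N)" .
  qed auto
  also have "\<dots> = z ^ (4 * N) * (2 ^ card B * 2 * (36 * real N * s\<^sup>2) ^ (2 * N))"
  proof -
    have "z ^ (4 * N) * (s\<^sup>2) ^ (2 * N) = (z\<^sup>2 * s\<^sup>2) ^ (2 * N)"
      by (simp add: power_mult_distrib flip: power_mult)
    also have "\<dots> = (4 * real N) ^ (2 * N)" by (simp only: z)
    finally have *: "z ^ (4 * N) * (s\<^sup>2) ^ (2 * N) = (4 * real N) ^ (2 * N)" .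
    have "(4 * real N) ^ (4 * N) * 9 ^ (2 * N) = (4 * real N) ^ (2 * N) * (36 * real N) ^ (2 * N)"
    proof -
      have "4 * N = 2 * N + 2 * N" "36 * real N = 4 * real N * 9" by simp_all
      then show ?thesis by (simp only: power_add power_mult_distrib mult.assoc)
    qed
    then show ?thesis
      unfolding *[symmetric] by (simp add: power_mult_distrib mult_ac)
  qed
  finally show ?thesis using z by simp
qed

section \<open>Choice of signs in operator norm\<close>

definition supported :: "nat \<Rightarrow> F2 op \<Rightarrow> bool" where
  "supported m T \<longleftrightarrow> toeplitz T \<and> (\<forall>g. word_length g > m \<longrightarrow> symbol T g = 0)"

lemma supported_add: "supported m S \<Longrightarrow> supported m T \<Longrightarrow> supported m (S + T)"
  by (simp add: supported_def toeplitz_add symbol_def blinfun.add_left coord_simps)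

lemma supported_zero: "supported m 0"
  by (simp add: supported_def toeplitz_def clin_def symbol_def coord_simps)

lemma supported_sum: "(\<And>i. i \<in> A \<Longrightarrow> supported m (f i)) \<Longrightarrow> supported m (\<Sum>i\<in>A. f i)"
  by (induction A rule: infinite_finite_induct) (auto simp: supported_add supported_zero)

lemma supported_lam: "word_length g \<le> m \<Longrightarrow> supported m (scaleC_op c (lam g))"
  using toeplitz_lincomb[of "{g}" "\<lambda>_. c"] symbol_lincomb[of "{g}" "\<lambda>_. c"]
  by (auto simp: supported_def lincomb_def)

lemma inverse_mult_free_group: "inverse (g * h) = inverse h * inverse (g :: 'a free_group)"
proof -
  have "inverse (g * h) * (g * h * (inverse h * inverse g)) = inverse h * inverse g"
    by (simp add: inverse_mult_cancel)
  moreover have "g * h * (inverse h * inverse g) = 1"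
    by (simp add: mult.assoc mult_inverse_cancel free_group_right_inverse)
  ultimately show ?thesis by simp
qed

text \<open>Symbols compose by convolution, and word length is subadditive.\<close>

lemma supported_compose:
  assumes T: "supported m T" and S: "supported m' S"
  shows "supported (m + m') (T o\<^sub>L S)"
proof -
  have tT: "toeplitz T" and tS: "toeplitz S" using assms by (auto simp: supported_def)
  have Sket: "S (ket y) = (\<Sum>h\<in>ball_word m'. scaleC (symbol S h) (ket (h * y)))" for y
  proof (rule ell2_eqI)
    fix x
    have eq: "x = h * y \<longleftrightarrow> h = x * inverse y" for h
      by (metis free_group_left_inverse free_group_right_inverse mult.assoc mult.right_neutral)
    have "coord (\<Sum>h\<in>ball_word m'. scaleC (symbol S h) (ket (h * y))) x
        = (if x * inverse y \<in> ball_word m' then symbol S (x * inverse y) else 0)"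
      by (simp add: coord_sum coord_simps eq if_distrib cong: if_cong)
    also have "\<dots> = symbol S (x * inverse y)"
      using S by (auto simp: supported_def ball_word_def)
    finally show "coord (S (ket y)) x = coord (\<Sum>h\<in>ball_word m'. scaleC (symbol S h) (ket (h * y))) x"
      using tS by (simp add: toeplitz_def)
  qed
  have TS: "coord ((T o\<^sub>L S) (ket y)) x = (\<Sum>h\<in>ball_word m'. symbol S h * symbol T (x * inverse y * inverse h))" for x y
  proof -
    have "T (scaleC c v) = scaleC c (T v)" for c v
      using tT by (simp add: toeplitz_def clin_def)
    moreover have "coord (T (ket y)) x = symbol T (x * inverse y)" for x y
      using tT by (simp add: toeplitz_def)
    ultimately show ?thesis
      by (simp add: Sket blinfun.sum_right coord_sum coord_simps inverse_mult_free_group mult.assoc)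
  qed
  have inv1: "inverse 1 = (1 :: F2)" by (metis free_group_left_inverse mult.right_neutral)
  have sym: "symbol (T o\<^sub>L S) g = (\<Sum>h\<in>ball_word m'. symbol S h * symbol T (g * inverse h))" for g
    using TS[of 1 g] by (simp only: symbol_def inv1 mult_1_right)
  show ?thesis
    unfolding supported_def
  proof (intro conjI allI impI)
    show "toeplitz (T o\<^sub>L S)"
      using tT tS unfolding toeplitz_def sym TS by (simp add: clin_def)
    fix g :: F2 assume g: "m + m' < word_length g"
    have "symbol T (g * inverse h) = 0" if "h \<in> ball_word m'" for h
    proof -
      have "word_length g \<le> word_length (g * inverse h) + word_length h"
        using word_length_mult[of "g * inverse h" h]
        by (simp add: mult.assoc free_group_left_inverse)
      then show ?thesis using T g that by (auto simp: supported_def ball_word_def)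
    qed
    then show "symbol (T o\<^sub>L S) g = 0" by (simp add: sym)
  qed
qed

section \<open>Powers of self-adjoint operators\<close>

abbreviation op_power :: "'g op \<Rightarrow> nat \<Rightarrow> 'g op" where
  "op_power T i \<equiv> ((o\<^sub>L) T ^^ i) id_blinfun"

lemma supported_power: "supported m T \<Longrightarrow> supported (i * m) (op_power T i)"
proof (induction i)
  case 0
  have "supported 0 (scaleC_op 1 (lam 1))" by (rule supported_lam) simp
  moreover have "scaleC_op 1 (lam 1) = id_blinfun"
  proof (rule blinfun_eqI, rule ell2_eqI)
    have "inverse 1 = (1 :: F2)" by (metis free_group_left_inverse mult.right_neutral)
    then show "coord (scaleC_op 1 (lam 1) x) g = coord (id_blinfun x) g" for x g
      by (simp add: scaleC_op_simps coord_lam)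
  qed
  ultimately show ?case by simp
next
  case (Suc i)
  then have "supported (m + i * m) (T o\<^sub>L op_power T i)" by (intro supported_compose)
  then show ?case by simp
qed

lemma op_power_add: "op_power T (i + j) = op_power T i o\<^sub>L op_power T j"
  for T :: "'g op"
  by (rule blinfun_eqI)
    (simp only: power_op_apply blinfun_apply_blinfun_compose, simp only: funpow_add o_apply)

lemma self_adj_power:
  fixes T :: "'g op"
  assumes "self_adj T" shows "self_adj (op_power T i)"
proof (induction i)
  case (Suc i)
  have "op_power T i (T x) = T (op_power T i x)" for x
    by (simp add: power_op_apply funpow_swap1)
  then show ?case using Suc assms by (simp add: self_adj_def)
qed (simp add: self_adj_def)

text \<open>Half of the C*-identity, stated for quadratic forms so that S may be the adjoint of T
  composed with T, or the square of a self-adjoint T.\<close>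

lemma norm_square_le:
  fixes S T :: "'g op"
  assumes "\<And>x. inner (T x) (T x) = inner x (S x)" shows "(norm T)\<^sup>2 \<le> norm S"
proof -
  have "norm T \<le> sqrt (norm S)"
  proof (rule norm_blinfun_bound)
    fix x
    have "(norm (T x))\<^sup>2 = inner x (S x)" by (simp add: power2_norm_eq_inner assms)
    also have "\<dots> \<le> norm x * norm (S x)" by (rule norm_cauchy_schwarz)
    also have "\<dots> \<le> norm x * (norm S * norm x)" by (intro mult_left_mono norm_blinfun) auto
    also have "\<dots> = (sqrt (norm S) * norm x)\<^sup>2"
      by (simp add: power_mult_distrib power2_eq_square)
    finally show "norm (T x) \<le> sqrt (norm S) * norm x"
      by (rule power2_le_imp_le) simp
  qed simp
  then show ?thesis using power_mono[of "norm T" "sqrt (norm S)" 2] by simp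
qed

text \<open>For these exponents repeated squaring suffices, which is why the moment order below is
  built from a power of two.\<close>

lemma norm_power_two:
  fixes T :: "'g op"
  assumes "self_adj T" shows "norm T ^ (2 ^ k) \<le> norm (op_power T (2 ^ k))"
proof (induction k)
  case (Suc k)
  have "norm T ^ (2 ^ Suc k) = (norm T ^ (2 ^ k))\<^sup>2"
    by (simp add: power_mult[symmetric] mult.commute)
  also have "\<dots> \<le> (norm (op_power T (2 ^ k)))\<^sup>2" using Suc by (intro power_mono) auto
  also have "\<dots> \<le> norm (op_power T (2 ^ Suc k))"
  proof (rule norm_square_le)
    show "inner (op_power T (2 ^ k) x) (op_power T (2 ^ k) x) = inner x (op_power T (2 ^ Suc k) x)" for x
      using self_adj_power[OF assms, of "2 ^ k"] op_power_add[where T = T and i = "2 ^ k" and j = "2 ^ k"]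
      by (simp add: self_adj_def mult_2)
  qed
  finally show ?case .
next
  case 0
  have "T o\<^sub>L id_blinfun = T" by (rule blinfun_eqI) simp
  then show ?case by simp
qed

text \<open>With Y the adjoint of X composed with X, the norm of X to the power 4N is at most (m +
  1)^4 times the trace of Y^(2N), and the mean of this trace over all signs is bounded by a scalar
  Khintchine moment. Some choice of signs does no worse than the mean, and for N of order p the root
  of order 2N of the Haagerup factor is bounded by a constant.\<close>

lemma ex_signs_norm_le:
  assumes B: "B \<subseteq> ball_word (2 ^ (p + 1))" and p: "p \<ge> 1"
  shows "\<exists>\<epsilon>. (\<forall>g\<in>B. \<epsilon> g = 1 \<or> \<epsilon> g = -1) \<and>
    norm (lincomb B (\<lambda>g. of_real (\<epsilon> g) * c g)) \<le> 2 ^ 9 * sqrt (real p * (\<Sum>g\<in>B. (cmod (c g))\<^sup>2))"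
\<comment> \<open>Vanishing coefficients are treated apart because the Khintchine argument divides
  by s.\<close>
proof (cases "(\<Sum>g\<in>B. (cmod (c g))\<^sup>2) = 0")
  have fB: "finite B" by (rule finite_subset[OF B finite_ball_word])
  case True
  then have "\<forall>g\<in>B. c g = 0" using fB by (simp add: sum_nonneg_eq_0_iff)
  then have "lincomb B (\<lambda>g. of_real 1 * c g) = 0"
    unfolding lincomb_def by (intro sum.neutral) (simp add: scaleC_op_simps)
  then show ?thesis by (intro exI[of _ "\<lambda>_. 1"]) (simp add: sum_nonneg)
next
  case False
  have fB: "finite B" by (rule finite_subset[OF B finite_ball_word])
  define s where "s = sqrt (\<Sum>g\<in>B. (cmod (c g))\<^sup>2)"
  have "(\<Sum>g\<in>B. (cmod (c g))\<^sup>2) > 0" using False by (simp add: sum_nonneg order_less_le)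
  then have s: "(\<Sum>g\<in>B. (cmod (c g))\<^sup>2) = s\<^sup>2" "s > 0" by (simp_all add: s_def)
  obtain k where k: "2 ^ k \<le> p" "p < 2 ^ (k + 1)"
    using ex_power_ivl1[of 2 p] p by auto
  \<comment> \<open>N lies between p and 2p: at least p so that 2^(5N) exceeds the support radius,
    at most 2p so that the final bound is in terms of p, and a power of two for the repeated
    squaring.\<close>
  define N :: nat where "N = 2 ^ (k + 1)"
  have N: "p \<le> N" "N \<le> 2 * p" "N > 0" using k by (auto simp: N_def)
  define X where "X = (\<lambda>\<epsilon>. \<Sum>g\<in>B. scaleC_op (of_real (\<epsilon> g) * c g) (lam g))"
  define X' where "X' = (\<lambda>\<epsilon>. \<Sum>g\<in>B. scaleC_op (of_real (\<epsilon> g) * cnj (c g)) (lam (inverse g)))"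
  define Y where "Y = (\<lambda>\<epsilon>. X' \<epsilon> o\<^sub>L X \<epsilon>)"
  let ?S = "\<lambda>\<epsilon>. \<Sum>g\<in>B. \<epsilon> g * cmod (c g)"
  have Xlin: "X \<epsilon> = lincomb B (\<lambda>g. of_real (\<epsilon> g) * c g)" for \<epsilon> by (simp add: X_def lincomb_def)
  have pair: "adj_pair (X' \<epsilon>) (X \<epsilon>)" for \<epsilon>
    using adj_pair_lincomb[of "\<lambda>g. of_real (\<epsilon> g) * c g" B] by (simp add: X'_def Xlin)
  have YX: "inner (X \<epsilon> x) (X \<epsilon> y) = inner x (Y \<epsilon> y)" for \<epsilon> x y
    using adj_pair_inner[OF adj_pair_sym[OF pair]] by (simp add: Y_def)
  have saY: "self_adj (Y \<epsilon>)" for \<epsilon>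
    unfolding self_adj_def by (metis YX inner_commute)
  \<comment> \<open>Each factor Y contributes two sign sums, one from X and one from its
    adjoint.\<close>
  have dom: "dominated B (\<lambda>g. cmod (c g)) (2 * i) (\<lambda>\<epsilon>. op_power (Y \<epsilon>) i (ket 1))" for i
  proof (induction i)
    case 0
    show ?case using dominated_ket[OF fB] by simp
  next
    case (Suc i)
    have "dominated B (\<lambda>g. cmod (c g)) (Suc (2 * i)) (\<lambda>\<epsilon>. X \<epsilon> (op_power (Y \<epsilon>) i (ket 1)))"
      unfolding X_def by (rule dominated_step[OF fB Suc]) simp
    then have "dominated B (\<lambda>g. cmod (c g)) (Suc (Suc (2 * i))) (\<lambda>\<epsilon>. X' \<epsilon> (X \<epsilon> (op_power (Y \<epsilon>) i (ket 1))))"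
      unfolding X'_def by (rule dominated_step[OF fB]) simp
    then show ?case by (simp add: Y_def)
  qed
  define t where "t = (\<lambda>\<epsilon>. Re (coord (op_power (Y \<epsilon>) (2 * N) (ket 1)) 1))"
  define K where "K = 2 * (36 * real N * s\<^sup>2) ^ (2 * N)"
  have "(\<Sum>\<epsilon>\<in>signs B. t \<epsilon>) \<le> cmod (\<Sum>\<epsilon>\<in>signs B. coord (op_power (Y \<epsilon>) (2 * N) (ket 1)) 1)"
    unfolding t_def Re_sum[symmetric] by (rule complex_Re_le_cmod)
  \<comment> \<open>Domination is used for the constant monomial, at the coordinate of the group
    identity.\<close>
  also have "\<dots> \<le> (\<Sum>\<epsilon>\<in>signs B. ?S \<epsilon> ^ (2 * (2 * N)))"
    using dom[of "2 * N"] unfolding dominated_def by (elim allE[of _ "\<lambda>_. 0"] allE[of _ 1]) simp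
  also have "\<dots> = (\<Sum>\<epsilon>\<in>signs B. ?S \<epsilon> ^ (4 * N))" by simp
  also have "\<dots> \<le> 2 ^ card B * 2 * (36 * real N * s\<^sup>2) ^ (2 * N)"
    by (rule khintchine_moment[OF fB s N(3)])
  also have "\<dots> = (\<Sum>\<epsilon>\<in>signs B. K)" by (simp add: card_signs[OF fB] K_def)
  finally have le: "(\<Sum>\<epsilon>\<in>signs B. t \<epsilon>) \<le> (\<Sum>\<epsilon>\<in>signs B. K)" .
  have ne: "signs B \<noteq> {}" using card_signs[OF fB] by force
  obtain \<epsilon> where \<epsilon>: "\<epsilon> \<in> signs B" "t \<epsilon> \<le> K"
    using sum_strict_mono[OF finite_signs[OF fB] ne, of "\<lambda>_. K" t] le by (meson not_le)
  have supp: "supported (2 ^ (p + 1)) (X \<epsilon>)" "supported (2 ^ (p + 1)) (X' \<epsilon>)"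
    unfolding X_def X'_def using B by (auto intro!: supported_sum supported_lam simp: ball_word_def)
  \<comment> \<open>The support radius of Y^N: each of the N factors contributes the radius 2^(p+1)
    twice.\<close>
  define m where "m = N * (2 ^ (p + 1) + 2 ^ (p + 1))"
  have suppY: "supported m (op_power (Y \<epsilon>) N)"
    unfolding m_def Y_def by (intro supported_power supported_compose supp)
  have m: "real m + 1 \<le> 2 ^ (5 * N)"
  proof -
    have "m + 1 \<le> N * 2 ^ (p + 3)"
    proof -
      have "1 \<le> N * 2 ^ (p + 2)" using N by simp
      moreover have "m = N * 2 ^ (p + 2)" "N * 2 ^ (p + 3) = N * 2 ^ (p + 2) + N * 2 ^ (p + 2)"
        by (simp_all add: m_def power_add)
      ultimately show ?thesis by linarith
    qed
    \<comment> \<open>From N \<le> 2^N and p + 3 \<le> 4N.\<close>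
    also have "\<dots> \<le> 2 ^ N * 2 ^ (N + 3 * N)"
      using N less_imp_le[OF less_exp[of N]] by (intro mult_mono power_increasing) auto
    also have "\<dots> = 2 ^ (5 * N)" by (simp flip: power_add)
    finally have "real (m + 1) \<le> real (2 ^ (5 * N))" by (rule of_nat_mono)
    then show ?thesis by simp
  qed
  have "((norm (X \<epsilon>))\<^sup>2) ^ (2 * N) \<le> norm (Y \<epsilon>) ^ (2 * N)"
    by (intro power_mono norm_square_le) (simp_all add: YX)
  also have "\<dots> = (norm (Y \<epsilon>) ^ N)\<^sup>2" by (simp add: power_mult[symmetric] mult.commute)
  also have "\<dots> \<le> (norm (op_power (Y \<epsilon>) N))\<^sup>2"
    unfolding N_def by (intro power_mono norm_power_two saY) simp
  also have "\<dots> \<le> ((real m + 1)\<^sup>2 * norm (op_power (Y \<epsilon>) N (ket 1)))\<^sup>2"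
    using suppY by (intro power_mono haagerup_norm_le) (auto simp: supported_def)
  also have "\<dots> = ((real m + 1)\<^sup>2)\<^sup>2 * (norm (op_power (Y \<epsilon>) N (ket 1)))\<^sup>2"
    by (simp only: power_mult_distrib)
  \<comment> \<open>By self-adjointness the norm left over from Haagerup's inequality is again the
    moment for which the signs were selected.\<close>
  also have t_eq: "(norm (op_power (Y \<epsilon>) N (ket 1)))\<^sup>2 = t \<epsilon>"
  proof -
    have "(norm (op_power (Y \<epsilon>) N (ket 1)))\<^sup>2 = inner (ket 1) (op_power (Y \<epsilon>) N (op_power (Y \<epsilon>) N (ket 1)))"
      using self_adj_power[OF saY] by (simp add: power2_norm_eq_inner self_adj_def)
    also have "\<dots> = inner (ket 1) (op_power (Y \<epsilon>) (2 * N) (ket 1))"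
      using op_power_add[where T = "Y \<epsilon>" and i = N and j = N] by (simp add: mult_2)
    finally show ?thesis by (simp add: t_def inner_ell2_def cinner_ket)
  qed
  also have "((real m + 1)\<^sup>2)\<^sup>2 * t \<epsilon> \<le> ((2 ^ (5 * N))\<^sup>2)\<^sup>2 * K"
  proof (rule mult_mono)
    show "((real m + 1)\<^sup>2)\<^sup>2 \<le> ((2 ^ (5 * N))\<^sup>2)\<^sup>2" using m by (intro power_mono) auto
    show "0 \<le> t \<epsilon>" unfolding t_eq[symmetric] by simp
  qed (use \<epsilon> in auto)
  \<comment> \<open>The Haagerup factor and the factor 2 in K give 2^(20N + 1), which is at most
    (2^11)^(2N).\<close>
  also have "\<dots> \<le> (2 ^ 11 * (36 * real N * s\<^sup>2)) ^ (2 * N)"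
  proof -
    have "((2 ^ (5 * N))\<^sup>2)\<^sup>2 * 2 = (2 :: real) ^ (20 * N + 1)"
      by (simp flip: power_mult)
    also have "\<dots> \<le> 2 ^ (22 * N)" using N by (intro power_increasing) auto
    also have "\<dots> = (2 ^ 11) ^ (2 * N)"
    proof -
      have "22 * N = 11 * (2 * N)" by simp
      then show ?thesis by (simp only: power_mult)
    qed
    finally have "((2 ^ (5 * N))\<^sup>2)\<^sup>2 * 2 * (36 * real N * s\<^sup>2) ^ (2 * N) \<le> (2 ^ 11) ^ (2 * N) * (36 * real N * s\<^sup>2) ^ (2 * N)"
      by (intro mult_right_mono) auto
    then show ?thesis
      unfolding K_def power_mult_distrib[of "2 ^ 11"] by (simp only: mult.assoc)
  qed
  finally have pow: "((norm (X \<epsilon>))\<^sup>2) ^ (2 * N) \<le> (2 ^ 11 * (36 * real N * s\<^sup>2)) ^ (2 * N)" .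
  have "(norm (X \<epsilon>))\<^sup>2 \<le> 2 ^ 11 * (36 * real N * s\<^sup>2)"
  proof (rule ccontr)
    assume "\<not> (norm (X \<epsilon>))\<^sup>2 \<le> 2 ^ 11 * (36 * real N * s\<^sup>2)"
    then have "(2 ^ 11 * (36 * real N * s\<^sup>2)) ^ (2 * N) < ((norm (X \<epsilon>))\<^sup>2) ^ (2 * N)"
      using N by (intro power_strict_mono) auto
    then show False using pow by linarith
  qed
  also have "\<dots> \<le> 2 ^ 11 * (36 * (2 * real p) * s\<^sup>2)"
    using N(2) by (intro mult_left_mono mult_right_mono) auto
  \<comment> \<open>72 times 2^11 is below 2^18.\<close>
  also have "\<dots> \<le> (2 ^ 9)\<^sup>2 * (real p * s\<^sup>2)" by (simp add: mult_right_mono)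
  also have "\<dots> = (2 ^ 9 * sqrt (real p * s\<^sup>2))\<^sup>2" by (simp add: power_mult_distrib)
  finally have "norm (X \<epsilon>) \<le> 2 ^ 9 * sqrt (real p * s\<^sup>2)"
    by (rule power2_le_imp_le) simp
  moreover have "\<forall>g\<in>B. \<epsilon> g = 1 \<or> \<epsilon> g = -1" using \<epsilon>(1) by (auto simp: signs_def PiE_def Pi_def)
  ultimately show ?thesis unfolding s(1) Xlin by blast
qed

section \<open>Good partial sums and enumerations\<close>

lemma ex_small_block:
  fixes \<beta> :: "nat \<Rightarrow> real"
  assumes \<beta>: "\<And>p. \<beta> p \<ge> 0" "summable \<beta>" and \<eta>: "\<eta> > 0"
  shows "\<exists>p\<ge>P. real p * \<beta> p \<le> \<eta>"
proof (rule ccontr)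
  assume neg: "\<not> (\<exists>p\<ge>P. real p * \<beta> p \<le> \<eta>)"
  have "summable (\<lambda>p. inverse (of_nat p :: real))"
  proof (rule summable_comparison_test')
    show "summable (\<lambda>p. \<beta> p / \<eta>)" using \<beta>(2) by (rule summable_divide)
    fix p assume p: "p \<ge> P"
    then have "\<eta> < real p * \<beta> p" using neg by (meson not_le)
    moreover from this have "p > 0" using \<eta> by (cases p) auto
    ultimately show "norm (inverse (of_nat p :: real)) \<le> \<beta> p / \<eta>"
      using \<eta> by (simp add: field_simps)
  qed
  then show False using not_summable_harmonic[where 'a = real] by simp
qed

text \<open>The weights of the cut-off are 1 on the ball of radius 2^p, so only the annulus
  \<open>A p\<close> has to be rounded, and its energy \<open>\<beta> p\<close> bounds that of every
  subset on which signs are chosen.\<close>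

lemma ex_good_set:
  assumes f: "f \<in> reduced_cstar" and \<delta>: "\<delta> > 0"
  shows "\<exists>p E. p \<ge> P \<and> ball_word (2 ^ p) \<subseteq> E \<and> E \<subseteq> ball_word (2 ^ (p + 1))
    \<and> norm (lincomb E (symbol f) - f) \<le> \<delta>"
proof -
  have tf: "toeplitz f" using reduced_cstar_toeplitz[OF f] by blast
  define A where "A = (\<lambda>p. ball_word (2 ^ (p + 1)) - ball_word (2 ^ p))"
  define \<beta> where "\<beta> = (\<lambda>p. \<Sum>g\<in>A p. (cmod (symbol f g))\<^sup>2)"
  have "summable \<beta>"
  proof (rule summableI_nonneg_bounded)
    show "\<beta> p \<ge> 0" for p by (simp add: \<beta>_def sum_nonneg)
    \<comment> \<open>The blocks telescope, and the sums over balls are bounded by the squared norm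
      of \<open>f (ket 1)\<close>.\<close>
    define S where "S = (\<lambda>m. \<Sum>g\<in>ball_word m. (cmod (symbol f g))\<^sup>2)"
    have "\<beta> p = S (2 ^ Suc p) - S (2 ^ p)" for p
    proof -
      have "ball_word (2 ^ p) \<subseteq> ball_word (2 ^ Suc p)" by (rule ball_word_mono) simp
      then show ?thesis unfolding \<beta>_def A_def S_def by (simp add: sum_diff)
    qed
    then have "sum \<beta> {..<n} = (\<Sum>p<n. S (2 ^ Suc p) - S (2 ^ p))" for n
      by (intro sum.cong refl)
    then have "sum \<beta> {..<n} = S (2 ^ n) - S (2 ^ 0)" for n
      by (simp only: sum_lessThan_telescope[where f = "\<lambda>p. S (2 ^ p)"])
    moreover have "S m \<le> (norm (f (ket 1)))\<^sup>2" "S m \<ge> 0" for m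
      unfolding S_def symbol_def by (simp_all add: sum_coord_le_norm sum_nonneg)
    ultimately show "sum \<beta> {..<n} \<le> (norm (f (ket 1)))\<^sup>2" for n
      by (smt (verit))
  qed
  \<comment> \<open>The distance from f to its cut-off is at most 8 + 1 times this error, that is
    \<delta> / 2.\<close>
  moreover obtain R c where Rc: "norm (f - lincomb (ball_word R) c) < \<delta> / 18"
    using reduced_cstar_approx[OF f, of "\<delta> / 18"] \<delta> by auto
  moreover have "\<beta> p \<ge> 0" for p by (simp add: \<beta>_def sum_nonneg)
  \<comment> \<open>The threshold brings the rounding bound, with its factor 2^9, down to \<delta> /
    2; p \<ge> R puts the approximating combination inside the ball of radius 2^p.\<close>
  ultimately obtain p where p: "p \<ge> max (max P 2) R" "real p * \<beta> p \<le> (\<delta> / 2 ^ 10)\<^sup>2"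
    using ex_small_block[of \<beta> "(\<delta> / 2 ^ 10)\<^sup>2" "max (max P 2) R"] \<delta> by auto
  have p2: "p \<ge> 2" and pP: "p \<ge> P" and "R \<le> p" using p by auto
  then have R: "R \<le> 2 ^ p" using less_imp_le[OF less_exp[of p]] by linarith
  define D where "D = 2 ^ 9 * sqrt (real p * \<beta> p)"
  have "sqrt (real p * \<beta> p) \<le> \<delta> / 2 ^ 10"
    using p(2) \<delta> by (intro real_le_lsqrt) auto
  then have D: "D \<le> \<delta> / 2" by (simp add: D_def)
  have D0: "D \<ge> 0" by (simp add: D_def \<beta>_def sum_nonneg)
  define v where "v = (\<lambda>g. scaleC_op (symbol f g) (lam g))"
  define w where "w = (\<lambda>g :: F2. real (vp_weight p (word_length g)) / 2 ^ (2 * p - 3))"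
  have fA: "finite (A p)" by (simp add: A_def)
  have "\<exists>\<xi>. (\<forall>g\<in>A p. \<xi> g = 0 \<or> \<xi> g = 1) \<and>
    norm (\<Sum>g\<in>A p. (\<xi> g - real (vp_weight p (word_length g)) / 2 ^ (2 * p - 3)) *\<^sub>R v g) \<le> D * (1 - 1 / 2 ^ (2 * p - 3))"
  proof (rule dyadic_rounding[OF fA])
    fix B assume B: "B \<subseteq> A p"
    have "B \<subseteq> ball_word (2 ^ (p + 1))" using B by (auto simp: A_def)
    then obtain e where e: "\<forall>g\<in>B. e g = 1 \<or> e g = -1"
        "norm (lincomb B (\<lambda>g. of_real (e g) * symbol f g)) \<le> 2 ^ 9 * sqrt (real p * (\<Sum>g\<in>B. (cmod (symbol f g))\<^sup>2))"
      using ex_signs_norm_le[of B p "symbol f"] p2 by auto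
    have "(\<Sum>g\<in>B. (cmod (symbol f g))\<^sup>2) \<le> \<beta> p"
      unfolding \<beta>_def by (rule sum_mono2[OF fA B]) simp
    then have "2 ^ 9 * sqrt (real p * (\<Sum>g\<in>B. (cmod (symbol f g))\<^sup>2)) \<le> D"
      unfolding D_def by (intro mult_left_mono real_sqrt_le_mono) auto
    moreover have "lincomb B (\<lambda>g. of_real (e g) * symbol f g) = (\<Sum>g\<in>B. e g *\<^sub>R v g)"
      by (simp add: lincomb_def v_def scaleC_op_simps)
    ultimately show "\<exists>e. (\<forall>g\<in>B. e g = 1 \<or> e g = -1) \<and> norm (\<Sum>g\<in>B. e g *\<^sub>R v g) \<le> D"
      using e by (intro exI[of _ e]) auto
  qed (rule vp_weight(2)[OF p2])
  then obtain \<xi> where \<xi>: "\<And>g. g \<in> A p \<Longrightarrow> \<xi> g = 0 \<or> \<xi> g = 1"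
      "norm (\<Sum>g\<in>A p. (\<xi> g - w g) *\<^sub>R v g) \<le> D * (1 - 1 / 2 ^ (2 * p - 3))"
    unfolding w_def by blast
  define E where "E = ball_word (2 ^ p) \<union> {g \<in> A p. \<xi> g = 1}"
  have sub: "ball_word (2 ^ p) \<subseteq> ball_word (2 ^ (p + 1))" by (rule ball_word_mono) simp
  have "lincomb E (symbol f) = (\<Sum>g\<in>ball_word (2 ^ p). v g) + (\<Sum>g\<in>{g \<in> A p. \<xi> g = 1}. v g)"
    unfolding E_def lincomb_def v_def by (rule sum.union_disjoint) (auto simp: fA A_def)
  also have "(\<Sum>g\<in>{g \<in> A p. \<xi> g = 1}. v g) = (\<Sum>g\<in>A p. \<xi> g *\<^sub>R v g)"
    by (rule sum.mono_neutral_cong_left) (use fA \<xi>(1) in auto)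
  finally have E1: "lincomb E (symbol f) = (\<Sum>g\<in>ball_word (2 ^ p). v g) + (\<Sum>g\<in>A p. \<xi> g *\<^sub>R v g)" .
  have "vp_op p f = (\<Sum>g\<in>ball_word (2 ^ (p + 1)). w g *\<^sub>R v g)"
    by (simp only: vp_op_def lincomb_def v_def w_def scaleC_op_simps)
  also have "\<dots> = (\<Sum>g\<in>A p. w g *\<^sub>R v g) + (\<Sum>g\<in>ball_word (2 ^ p). w g *\<^sub>R v g)"
    unfolding A_def by (rule sum.subset_diff[OF sub]) simp
  also have "(\<Sum>g\<in>ball_word (2 ^ p). w g *\<^sub>R v g) = (\<Sum>g\<in>ball_word (2 ^ p). v g)"
    by (rule sum.cong) (auto simp: w_def ball_word_def vp_weight(1)[OF p2])
  finally have "lincomb E (symbol f) - vp_op p f = (\<Sum>g\<in>A p. (\<xi> g - w g) *\<^sub>R v g)"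
    by (simp add: E1 scaleR_left_diff_distrib sum_subtractf)
  also have "norm \<dots> \<le> \<delta> / 2"
  proof -
    have "D * (1 - 1 / 2 ^ (2 * p - 3)) \<le> D * 1" using D0 by (intro mult_left_mono) auto
    then show ?thesis using \<xi>(2) D by linarith
  qed
  finally have n1: "norm (lincomb E (symbol f) - vp_op p f) \<le> \<delta> / 2" .
  define h where "h = f - lincomb (ball_word R) c"
  \<comment> \<open>The finite combination is fixed by the cut-off and drops out.\<close>
  have "vp_op p f - f = vp_op p h - h"
    by (simp add: h_def vp_op_diff vp_op_lincomb[OF p2 R])
  also have "norm \<dots> \<le> norm (vp_op p h) + norm h" by (rule norm_triangle_ineq4)
  also have "norm (vp_op p h) \<le> 8 * norm h"
    unfolding h_def by (intro norm_vp_op_le p2 toeplitz_diff tf toeplitz_lincomb)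
  finally have n2: "norm (vp_op p f - f) \<le> \<delta> / 2" using Rc by (simp add: h_def)
  have "norm (lincomb E (symbol f) - f) \<le> norm (lincomb E (symbol f) - vp_op p f) + norm (vp_op p f - f)"
    using norm_triangle_ineq[of "lincomb E (symbol f) - vp_op p f" "vp_op p f - f"] by simp
  then have "norm (lincomb E (symbol f) - f) \<le> \<delta>" using n1 n2 by simp
  moreover have "ball_word (2 ^ p) \<subseteq> E" "E \<subseteq> ball_word (2 ^ (p + 1))"
    using sub by (auto simp: E_def A_def)
  ultimately show ?thesis using pP by blast
qed

text \<open>The sets are listed so that each list is a prefix of the next, and h reads the diagonal.
  Entry i of list i exists because a strictly growing chain that starts with a nonempty set has more
  than i elements at stage i.\<close>

lemma enumeration_of_chain:
  fixes E :: "nat \<Rightarrow> 'a set"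
  assumes fin: "\<And>j. finite (E j)" and chain: "\<And>j. E j \<subset> E (Suc j)"
    and ne: "E 0 \<noteq> {}" and un: "(\<Union>j. E j) = UNIV"
  obtains h where "bij h" "\<And>j. E j = h ` {..<card (E j)}"
proof -
  have "\<exists>L. \<forall>j. (set (L j) = E j \<and> distinct (L j)) \<and> (\<exists>ys. L (Suc j) = L j @ ys)"
  proof (rule dependent_nat_choice)
    show "\<exists>xs. set xs = E 0 \<and> distinct xs" using finite_distinct_list[OF fin] .
    fix xs j assume xs: "set xs = E j \<and> distinct xs"
    obtain ys where ys: "set ys = E (Suc j) - E j" "distinct ys"
      using finite_distinct_list[of "E (Suc j) - E j"] fin by blast
    then show "\<exists>zs. (set zs = E (Suc j) \<and> distinct zs) \<and> (\<exists>ys. zs = xs @ ys)"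
      using xs chain[of j] by (intro exI[of _ "xs @ ys"]) auto
  qed
  then obtain L where L: "\<And>j. set (L j) = E j" "\<And>j. distinct (L j)" "\<And>j. \<exists>ys. L (Suc j) = L j @ ys"
    by blast
  have len: "length (L j) = card (E j)" for j using L(1,2)[of j] distinct_card by metis
  have big: "j < card (E j)" for j
  proof (induction j)
    case 0
    show ?case using ne fin[of 0] by (simp add: card_gt_0_iff)
  next
    case (Suc j)
    have "card (E j) < card (E (Suc j))" by (rule psubset_card_mono[OF fin chain])
    then show ?case using Suc by linarith
  qed
  have ext: "\<exists>ys. L k = L j @ ys" if "j \<le> k" for j k
    using that
  proof (induction k rule: dec_induct)
    case (step k)
    then show ?case using L(3)[of k] by force
  qed simp
  define h where "h = (\<lambda>i. L i ! i)"
  have h: "h i = L j ! i" if "i < card (E j)" for i j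
  proof (cases "i \<le> j")
    case True
    then obtain ys where "L j = L i @ ys" using ext by blast
    then show ?thesis using big[of i] by (simp add: h_def nth_append len)
  next
    case False
    then obtain ys where "L i = L j @ ys" using ext[of j i] by auto
    then show ?thesis using that by (simp add: h_def nth_append len)
  qed
  have img: "E j = h ` {..<card (E j)}" for j
  proof -
    have "E j = (!) (L j) ` {..<length (L j)}"
      unfolding L(1)[symmetric] by (auto simp: set_conv_nth)
    then show ?thesis using h by (auto simp: len intro!: image_eqI)
  qed
  have "inj h"
  proof (rule injI)
    fix x y assume "h x = h y"
    define j where "j = max x y"
    have "x < card (E j)" "y < card (E j)" using big[of j] by (auto simp: j_def)
    then show "x = y"
      using \<open>h x = h y\<close> L(2)[of j] by (simp add: h[of _ j] nth_eq_iff_index_eq len)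
  qed
  moreover have "surj h"
    unfolding surj_def
  proof
    fix x
    obtain j where "x \<in> E j" using un by blast
    then show "\<exists>i. x = h i" using img[of j] by blast
  qed
  ultimately show ?thesis using that img by (simp add: bij_def)
qed

theorem theorem1p2:
  fixes f :: "F2 op"
  assumes "f \<in> reduced_cstar"
  shows "\<exists>(g :: nat \<Rightarrow> F2) (M :: nat \<Rightarrow> nat) (n :: nat \<Rightarrow> int) (E :: nat \<Rightarrow> F2 set).
    bij_betw g {1..} UNIV \<and>
    (\<forall>j\<ge>1. 0 < M j) \<and> strict_mono_on {1..} M \<and>
    (\<lambda>j. norm ((\<Sum>l = 1..M j. scaleC_op (fourier f (g l)) (lam (g l))) - f)) \<longlonglongrightarrow> 0 \<and>
    (\<forall>j\<ge>1. E j = g ` {1..M j}) \<and>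
    (\<forall>j\<ge>1. n (j + 1) > 2 * n j) \<and>
    (\<forall>j\<ge>1. {h. int (word_length h) \<le> n j} \<subseteq> E j \<and> E j \<subseteq> {h. int (word_length h) \<le> 2 * n j}) \<and>
    (\<forall>j\<ge>1. E j \<subset> E (j + 1)) \<and>
    (\<Union>j\<in>{1..}. E j) = UNIV \<and>
    (\<forall>j\<ge>1. norm ((\<Sum>h\<in>E j. scaleC_op (fourier f h) (lam h)) - f) \<le> 2 powr (1 - real j)) \<and>
    (\<forall>q\<ge>1. (\<lambda>j. Lq_norm q ((\<Sum>l = 1..M j. scaleC_op (fourier f (g l)) (lam (g l))) - f)) \<longlonglongrightarrow> 0)"
proof -
  \<comment> \<open>Stages are counted from 0 with error 2^(-j); the later shift of the index by one
    turns this into 2^(1-j).\<close>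
  define good where "good = (\<lambda>j (p, E). ball_word (2 ^ p) \<subseteq> E \<and> E \<subseteq> ball_word (2 ^ (p + 1))
    \<and> norm (lincomb E (symbol f) - f) \<le> 2 powr (- real j))"
  \<comment> \<open>The gap 2 in the exponents makes twice the radius of one stage strictly smaller
    than the radius of the next.\<close>
  have "\<exists>s. \<forall>j. good j (s j) \<and> fst (s j) + 2 \<le> fst (s (Suc j))"
  proof (rule dependent_nat_choice)
    show "\<exists>s. good 0 s"
      using ex_good_set[OF assms, of "2 powr (- real 0)" 0] by (auto simp: good_def)
    show "\<exists>s'. good (Suc j) s' \<and> fst s + 2 \<le> fst s'" for s j
      using ex_good_set[OF assms, of "2 powr (- real (Suc j))" "fst s + 2"] by (auto simp: good_def)
  qed
  then obtain s where s: "\<And>j. good j (s j)" "\<And>j. fst (s j) + 2 \<le> fst (s (Suc j))" by blast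
  define p C where "p = (\<lambda>j. fst (s j))" and "C = (\<lambda>j. snd (s j))"
  have C: "ball_word (2 ^ p j) \<subseteq> C j" "C j \<subseteq> ball_word (2 ^ (p j + 1))"
    "norm (lincomb (C j) (symbol f) - f) \<le> 2 powr (- real j)" for j
    using s(1)[of j] by (auto simp: good_def p_def C_def case_prod_beta)
  have p_step: "p j + 2 \<le> p (Suc j)" for j using s(2) by (simp add: p_def)
  have p_ge: "j \<le> p j" for j
  proof (induction j)
    case (Suc j)
    then show ?case using p_step[of j] by linarith
  qed simp
  have finC: "finite (C j)" for j by (rule finite_subset[OF C(2) finite_ball_word])
  have chain: "C j \<subset> C (Suc j)" for j
  proof -
    have lt: "(2 :: nat) ^ (p j + 1) < 2 ^ p (Suc j)"
      using p_step[of j] by (intro power_strict_increasing) auto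
    \<comment> \<open>A word on the boundary of the next inner ball is too long for the present set,
      which makes the inclusion strict.\<close>
    obtain g :: F2 where g: "word_length g = 2 ^ p (Suc j)" using ex_word_length by blast
    have "g \<in> C (Suc j)" using C(1)[of "Suc j"] g by (auto simp: ball_word_def)
    moreover have "g \<notin> C j" using C(2)[of j] g lt by (auto simp: ball_word_def)
    moreover have "C j \<subseteq> C (Suc j)"
      using C(2)[of j] C(1)[of "Suc j"] ball_word_mono[OF less_imp_le[OF lt]] by blast
    ultimately show ?thesis by blast
  qed
  have un: "(\<Union>j. C j) = UNIV"
  proof -
    have "g \<in> C (word_length g)" for g
    proof -
      have "word_length g \<le> 2 ^ word_length g" by (simp add: less_imp_le)
      also have "\<dots> \<le> 2 ^ p (word_length g)" by (intro power_increasing p_ge) simp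
      finally show ?thesis using C(1) by (auto simp: ball_word_def)
    qed
    then show ?thesis by blast
  qed
  have "1 \<in> C 0" using C(1)[of 0] by (auto simp: ball_word_def)
  then obtain h where h: "bij h" "\<And>j. C j = h ` {..<card (C j)}"
    using enumeration_of_chain[of C, OF finC chain _ un] by blast
  define g where "g = (\<lambda>l. h (l - 1))"
  \<comment> \<open>At j = 0 truncated subtraction repeats the first stage; the assertions start at
    j = 1 or concern limits.\<close>
  define E where "E = (\<lambda>j. C (j - 1))"
  define M where "M = (\<lambda>j. card (E j))"
  define n where "n = (\<lambda>j. 2 ^ p (j - 1) :: int)"
  have bij_pred: "bij_betw (\<lambda>l. l - 1) {1::nat..} UNIV"
    by (rule bij_betw_byWitness[where f' = Suc]) auto
  have bij: "bij_betw g {1..} UNIV"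
    using bij_betw_trans[OF bij_pred h(1)] by (simp add: g_def comp_def)
  have Eg: "E j = g ` {1..M j}" for j
  proof -
    have "(\<lambda>l. l - 1) ` {1..M j} = {..<M j}"
    proof (intro equalityI subsetI)
      fix i assume "i \<in> {..<M j}"
      then show "i \<in> (\<lambda>l. l - 1) ` {1..M j}" by (intro image_eqI[of _ _ "Suc i"]) auto
    qed auto
    moreover have "g ` {1..M j} = h ` (\<lambda>l. l - 1) ` {1..M j}" by (simp only: g_def image_image)
    ultimately have "g ` {1..M j} = h ` {..<M j}" by (simp only:)
    then show ?thesis using h(2)[of "j - 1"] by (simp add: M_def E_def)
  qed
  have sum_eq: "(\<Sum>l = 1..M j. scaleC_op (fourier f (g l)) (lam (g l))) = lincomb (E j) (symbol f)" for j
  proof -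
    have "inj_on g {1..M j}" using bij by (auto simp: bij_betw_def intro: inj_on_subset)
    then have "lincomb (E j) (symbol f) = (\<Sum>l = 1..M j. scaleC_op (symbol f (g l)) (lam (g l)))"
      unfolding lincomb_def by (subst Eg) (simp add: sum.reindex)
    then show ?thesis by (simp add: fourier_eq_symbol)
  qed
  have sum_eq': "(\<Sum>x\<in>E j. scaleC_op (fourier f x) (lam x)) = lincomb (E j) (symbol f)" for j
    by (simp add: lincomb_def fourier_eq_symbol)
  have bound: "norm (lincomb (E j) (symbol f) - f) \<le> 2 powr (1 - real j)" if "j \<ge> 1" for j
  proof -
    have "- real (j - 1) = 1 - real j" using that by simp
    then show ?thesis using C(3)[of "j - 1"] by (simp add: E_def)
  qed
  have "(\<lambda>j. 2 * (1 / 2) ^ j :: real) \<longlonglongrightarrow> 0"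
    by (intro tendsto_mult_right_zero LIMSEQ_realpow_zero) auto
  then have "(\<lambda>j. 2 powr (1 - real j)) \<longlonglongrightarrow> 0"
    by (simp add: powr_diff powr_realpow power_one_over)
  then have lim: "(\<lambda>j. norm (lincomb (E j) (symbol f) - f)) \<longlonglongrightarrow> 0"
    by (rule Lim_null_comparison[rotated]) (use bound in \<open>auto intro: eventually_sequentiallyI[of 1]\<close>)
  have Lq: "(\<lambda>j. Lq_norm q (lincomb (E j) (symbol f) - f)) \<longlonglongrightarrow> 0" if "q \<ge> 1" for q
  proof (rule Lim_null_comparison[OF _ lim])
    \<comment> \<open>The comparison of the q-norm with the operator norm asks for an explicit
      adjoint of the difference.\<close>
    obtain S where "adj_pair S f" using reduced_cstar_toeplitz[OF assms] by blast
    then have "\<exists>S. adj_pair S (lincomb (E j) (symbol f) - f)" for j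
      using adj_pair_diff[OF adj_pair_lincomb] by blast
    then show "\<forall>\<^sub>F j in sequentially. norm (Lq_norm q (lincomb (E j) (symbol f) - f)) \<le> norm (lincomb (E j) (symbol f) - f)"
      using Lq_norm_le[OF _ that] by (metis (mono_tags, lifting) abs_of_nonneg always_eventually real_norm_def)
  qed
  have E_step: "E j \<subset> E (j + 1)" if "j \<ge> 1" for j
    using chain[of "j - 1"] that by (simp add: E_def)
  show ?thesis
  proof (intro exI[of _ g] exI[of _ M] exI[of _ n] exI[of _ E] conjI allI impI)
    show "bij_betw g {1..} UNIV" by (rule bij)
    show "0 < M j" if "j \<ge> 1" for j
    proof -
      have "1 \<in> E j" using C(1)[of "j - 1"] by (auto simp: E_def ball_word_def)
      then show ?thesis using finC by (auto simp: M_def E_def card_gt_0_iff)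
    qed
    have "strict_mono (\<lambda>j. card (C j))"
      unfolding strict_mono_Suc_iff using psubset_card_mono[OF finC chain] by blast
    then show "strict_mono_on {1..} M"
      by (auto intro!: strict_mono_onI simp: M_def E_def strict_mono_def)
    show "n (j + 1) > 2 * n j" if "j \<ge> 1" for j
    proof -
      have "(2 :: int) ^ (p (j - 1) + 1) < 2 ^ p (Suc (j - 1))"
        using p_step[of "j - 1"] by (intro power_strict_increasing) auto
      then show ?thesis using that by (simp add: n_def)
    qed
    have nat_int: "int (word_length x) \<le> 2 ^ k \<longleftrightarrow> word_length x \<le> 2 ^ k" for x :: F2 and k
      by (metis of_nat_le_iff of_nat_numeral of_nat_power)
    show "{x. int (word_length x) \<le> n j} \<subseteq> E j" for j
      using C(1)[of "j - 1"] by (simp add: n_def E_def ball_word_def nat_int)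
    show "E j \<subseteq> {x. int (word_length x) \<le> 2 * n j}" for j
      using C(2)[of "j - 1"] nat_int[of _ "p (j - 1) + 1"] by (auto simp: n_def E_def ball_word_def)
    show "(\<Union>j\<in>{1..}. E j) = UNIV"
      using un bij_pred unfolding E_def bij_betw_def by (metis image_image)
    show "E j = g ` {1..M j}" for j by (rule Eg)
  qed (simp_all only: sum_eq sum_eq' lim Lq bound E_step)
qed

end
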